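(* The variety of complex $3$-dimensional $\mathfrak{perm}$ superalgebras of type $(2,1)$ has dimension $4$ and has exactly $7$ irreducible components: $\overline{\mathcal{O}(\mathbf{R}_{01})},\ \overline{\mathcal{O}(\mathbf{R}_{02})},\ \overline{\mathcal{O}(\mathbf{R}_{04})},\ \overline{\mathcal{O}(\mathbf{R}_{10})},\ \overline{\mathcal{O}(\mathbf{R}_{25})},\ \overline{\mathcal{O}(\mathbf{R}_{31})},\ \overline{\mathcal{O}(\mathbf{R}_{33})}$. In particular, exactly $7$ superalgebras are rigid in this variety.
   Context: All algebras are over $\mathbb{C}$. A superalgebra is a $\mathbb{Z}_2$-graded algebra $A=A_0\oplus A_1$ with $A_iA_j\subseteq A_{i+j \bmod 2}$; $|x|\in\{0,1\}$ is the degree of a homogeneous $x$. It has type $(n,m)$ if $\dim A_0=n$, $\dim A_1=m$. The associator is $(x,y,z)=(xy)z-x(yz)$. A $\mathfrak{perm}$ superalgebra is a superalgebra satisfying $(x,y,z)=0$ and $x(yz)=(-1)^{|y||z|}x(zy)$ for all homogeneous $x,y,z$. Geometric setting: fix a graded space $V=V_0\oplus V_1$ of type $(n,m)$ with a homogeneous basis. Superalgebra structures on $V$ are even bilinear maps $\mu:V\times V\to V$, identified with their structure constants; those satisfying a given family of graded polynomial identities form a Zariski-closed subset (an affine variety) of this affine space. The group $GL(V_0)\times GL(V_1)$ acts by $(g*\mu)(x,y)=g\mu(g^{-1}x,g^{-1}y)$; its orbits are the isomorphism classes. $\mathcal{O}(A)$ denotes the orbit of (a structure representing) $A$ and $\overline{\mathcal{O}(A)}$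 its Zariski closure. A superalgebra is rigid if its orbit is open in the variety. The dimension of the variety is the maximal dimension of its irreducible components. Superalgebras of type $(2,1)$, in basis $e_1,e_2$ (even), $f_1$ (odd), listed by nonzero products (unlisted products are zero): $\mathbf{R}_{01}$: $e_1e_1=e_1,\ e_2e_2=e_2$; $\mathbf{R}_{02}$: $e_1e_1=e_1,\ e_2e_2=e_2,\ e_1f_1=f_1,\ f_1e_1=f_1$; $\mathbf{R}_{04}$: $e_1e_1=e_1,\ e_2e_2=e_2,\ f_1e_1=f_1$; $\mathbf{R}_{10}$: $e_1e_1=e_1,\ f_1f_1=e_2$; $\mathbf{R}_{25}$: $e_1e_1=e_1,\ e_2e_1=e_2$; $\mathbf{R}_{31}$: $e_1e_1=e_1,\ e_2e_1=e_2,\ f_1e_1=f_1$; $\mathbf{R}_{33}$: $e_1e_1=e_1,\ e_2e_1=e_2,\ e_1f_1=f_1,\ f_1e_1=f_1$. *)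

theory Defs
  imports Complex_Main "HOL-Library.Extended_Nat"
begin

datatype idx = E1 | E2 | F1

lemma UNIV_idx: "(UNIV :: idx set) = {E1, E2, F1}"
  using idx.exhaust by auto

instance idx :: finite
  by standard (simp add: UNIV_idx)

fun par :: "idx \<Rightarrow> nat" where
  "par E1 = 0" | "par E2 = 0" | "par F1 = 1"

text \<open>Vectors of V, and structure constants: mu(b_i,b_j) = sum_k c i j k b_k.
  The affine space of all bilinear maps V x V -> V is identified with sc.\<close>
type_synonym vec = "idx \<Rightarrow> complex"
type_synonym sc = "idx \<Rightarrow> idx \<Rightarrow> idx \<Rightarrow> complex"

definition mult :: "sc \<Rightarrow> vec \<Rightarrow> vec \<Rightarrow> vec" where
  "mult c x y = (\<lambda>k. \<Sum>i\<in>UNIV. \<Sum>j\<in>UNIV. x i * y j * c i j k)"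

definition homog :: "vec \<Rightarrow> nat \<Rightarrow> bool" where
  "homog x d \<longleftrightarrow> d \<in> {0, 1} \<and> (\<forall>i. par i \<noteq> d \<longrightarrow> x i = 0)"

definition even_sc :: "sc \<Rightarrow> bool" where
  "even_sc c \<longleftrightarrow> (\<forall>i j k. par k \<noteq> (par i + par j) mod 2 \<longrightarrow> c i j k = 0)"

definition perm_sc :: "sc \<Rightarrow> bool" where
  "perm_sc c \<longleftrightarrow> (\<forall>x y z dx dy dz. homog x dx \<longrightarrow> homog y dy \<longrightarrow> homog z dz \<longrightarrow>
      mult c (mult c x y) z = mult c x (mult c y z) \<and>
      mult c x (mult c y z) = (\<lambda>k. (-1) ^ (dy * dz) * mult c x (mult c z y) k))"

definition PermVar :: "sc set" where
  "PermVar = {c. even_sc c \<and> perm_sc c}"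

definition is_inv :: "(idx \<Rightarrow> idx \<Rightarrow> complex) \<Rightarrow> (idx \<Rightarrow> idx \<Rightarrow> complex) \<Rightarrow> bool" where
  "is_inv M N \<longleftrightarrow> (\<forall>i j. (\<Sum>k\<in>UNIV. M i k * N k j) = (if i = j then 1 else 0) \<and>
                          (\<Sum>k\<in>UNIV. N i k * M k j) = (if i = j then 1 else 0))"

text \<open>Matrix M represents g with g(b_r) = sum_k M k r b_k; even (block diagonal) maps.\<close>
definition grading_preserving :: "(idx \<Rightarrow> idx \<Rightarrow> complex) \<Rightarrow> bool" where
  "grading_preserving M \<longleftrightarrow> (\<forall>i j. par i \<noteq> par j \<longrightarrow> M i j = 0)"

text \<open>(g*mu)(x,y) = g mu(g^-1 x, g^-1 y), with N the matrix of g^-1.\<close>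
definition act :: "(idx \<Rightarrow> idx \<Rightarrow> complex) \<Rightarrow> (idx \<Rightarrow> idx \<Rightarrow> complex) \<Rightarrow> sc \<Rightarrow> sc" where
  "act M N c = (\<lambda>i j k. \<Sum>r\<in>UNIV. M k r * (\<Sum>p\<in>UNIV. \<Sum>q\<in>UNIV. N p i * N q j * c p q r))"

definition orbit :: "sc \<Rightarrow> sc set" where
  "orbit c = {act M N c | M N. grading_preserving M \<and> is_inv M N}"

inductive_set polyfun :: "(sc \<Rightarrow> complex) set" where
  pconst: "(\<lambda>_. a) \<in> polyfun"
| pcoord: "(\<lambda>c. c i j k) \<in> polyfun"
| padd: "p \<in> polyfun \<Longrightarrow> q \<in> polyfun \<Longrightarrow> (\<lambda>c. p c + q c) \<in> polyfun"
| pmult: "p \<in> polyfun \<Longrightarrow> q \<in> polyfun \<Longrightarrow> (\<lambda>c. p c * q c) \<in> polyfun"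

definition zclosed :: "sc set \<Rightarrow> bool" where
  "zclosed S \<longleftrightarrow> (\<exists>P \<subseteq> polyfun. S = {c. \<forall>p\<in>P. p c = 0})"

definition zclosure :: "sc set \<Rightarrow> sc set" where
  "zclosure A = \<Inter>{Z. zclosed Z \<and> A \<subseteq> Z}"

definition irreducible_set :: "sc set \<Rightarrow> bool" where
  "irreducible_set Z \<longleftrightarrow> Z \<noteq> {} \<and>
     (\<forall>A B. zclosed A \<longrightarrow> zclosed B \<longrightarrow> Z \<subseteq> A \<union> B \<longrightarrow> Z \<subseteq> A \<or> Z \<subseteq> B)"

definition irr_component :: "sc set \<Rightarrow> sc set \<Rightarrow> bool" where
  "irr_component X Z \<longleftrightarrow> Z \<subseteq> X \<and> irreducible_set Z \<and>
     (\<forall>W. W \<subseteq> X \<longrightarrow> irreducible_set W \<longrightarrow> Z \<subseteq> W \<longrightarrow> W = Z)"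

definition has_chain :: "sc set \<Rightarrow> nat \<Rightarrow> bool" where
  "has_chain X n \<longleftrightarrow> (\<exists>Z :: nat \<Rightarrow> sc set.
      (\<forall>i\<le>n. Z i \<subseteq> X \<and> zclosed (Z i) \<and> irreducible_set (Z i)) \<and>
      (\<forall>i<n. Z i \<subset> Z (Suc i)))"

definition variety_dim :: "sc set \<Rightarrow> enat" where
  "variety_dim X = Sup (enat ` {n. has_chain X n})"

definition zopenin :: "sc set \<Rightarrow> sc set \<Rightarrow> bool" where
  "zopenin X U \<longleftrightarrow> U \<subseteq> X \<and> (\<exists>Z. zclosed Z \<and> U = X - Z)"

definition rigid :: "sc set \<Rightarrow> sc \<Rightarrow> bool" where
  "rigid X c \<longleftrightarrow> c \<in> X \<and> zopenin X (orbit c)"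

definition str :: "(idx \<times> idx \<times> idx) list \<Rightarrow> sc" where
  "str L = (\<lambda>i j k. if (i, j, k) \<in> set L then 1 else 0)"

definition "R01 = str [(E1,E1,E1), (E2,E2,E2)]"
definition "R02 = str [(E1,E1,E1), (E2,E2,E2), (E1,F1,F1), (F1,E1,F1)]"
definition "R04 = str [(E1,E1,E1), (E2,E2,E2), (F1,E1,F1)]"
definition "R10 = str [(E1,E1,E1), (F1,F1,E2)]"
definition "R25 = str [(E1,E1,E1), (E2,E1,E2)]"
definition "R31 = str [(E1,E1,E1), (E2,E1,E2), (F1,E1,F1)]"
definition "R33 = str [(E1,E1,E1), (E2,E1,E2), (E1,F1,F1), (F1,E1,F1)]"

end

theory Submission
  imports "HOL-Computational_Algebra.Polynomial" Defs
begin

text \<open>If the odd square \<open>t = f f\<close> is nonzero, it annihilates everything, so the even part is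
  \<open>x y = \<lambda>(x) \<lambda>(y) v\<close> with \<open>\<lambda>(t) = 0\<close>; if the even part is noncommutative, it is
  \<open>x y = l(y) x\<close>; and otherwise the commuting multiplications by even elements have a common eigenvector.
  In each case the left and right actions on the odd part are characters, the left one being zero or
  equal to the right one, so these normal forms lie on polynomial curves whose generic points belong to
  one of the seven orbits. Each of the seven points has a Zariski neighbourhood contained in its orbit;
  hence the orbits are open, which gives rigidity and the incomparability of the closures.

  Every orbit is swept out by four parameters. In a chain of length five, functions \<open>g\<^sub>i\<close> vanishing on
  the \<open>i\<close>-th member but not on the next one would have linearly independent monomials, whose number
  grows faster than four parameters allow.\<close>

section \<open>Zariski topology\<close>

text \<open>Some of the seven algebras are singled out by equations, such as zero actions on the odd
  part, while an open orbit asks for inequalities. Characters bridge the gap: at a given even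
  element a nonzero character can take only finitely many values, determined by the even part, so a
  polynomial saying that these values are avoided forces the character to be zero. Such a polynomial
  need not be invariant, since all its translates can be used together. Degenerations and
  irreducibility are reduced to one variable. A polynomial vanishing along a curve outside finitely
  many parameters vanishes along all of it, and two polynomials, each nonzero somewhere on a
  rational curve, are both nonzero at some common point of it. The bound 4 is one less than the
  dimension of the group because each of the seven algebras has automorphisms scaling the odd part
  by any nonzero factor. It is attained by algebras with zero odd products and diagonalisable even
  part: two scalars and two directions are free.\<close>

lemma polyfun_diff:
  assumes "p \<in> polyfun" "q \<in> polyfun"
  shows "(\<lambda>c. p c - q c) \<in> polyfun"
  using padd[OF assms(1) pmult[OF pconst[of "-1"] assms(2)]] by simp

lemma polyfun_sum:
  "(\<And>i. i \<in> I \<Longrightarrow> p i \<in> polyfun) \<Longrightarrow> (\<lambda>c. \<Sum>i\<in>I. p i c) \<in> polyfun"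
  by (induction I rule: infinite_finite_induct) (auto intro: pconst padd)

lemma polyfun_power: "p \<in> polyfun \<Longrightarrow> (\<lambda>c. p c ^ n) \<in> polyfun"
  by (induction n) (auto intro: pconst pmult)

lemmas polyfun_intros = pconst pcoord padd pmult polyfun_diff polyfun_sum polyfun_power

text \<open>With \<open>zclosedI\<close>, this replaces a chosen family of equations by all
  polynomials vanishing on \<open>Z\<close>, so that later arguments need not carry such a
  family.\<close>

lemma zclosedD:
  assumes "zclosed Z" "\<And>p. p \<in> polyfun \<Longrightarrow> (\<And>a. a \<in> Z \<Longrightarrow> p a = 0) \<Longrightarrow> p c = 0"
  shows "c \<in> Z"
proof -
  obtain P where P: "P \<subseteq> polyfun" "Z = {c. \<forall>p\<in>P. p c = 0}"
    using assms(1) unfolding zclosed_def by (elim exE conjE) (rule that)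
  have "p c = 0" if "p \<in> P" for p
    using that P by (intro assms(2)[of p]) auto
  then show ?thesis unfolding P(2) by simp
qed

lemma zclosedI:
  assumes "\<And>c. (\<And>p. p \<in> polyfun \<Longrightarrow> (\<And>a. a \<in> Z \<Longrightarrow> p a = 0) \<Longrightarrow> p c = 0) \<Longrightarrow> c \<in> Z"
  shows "zclosed Z"
  unfolding zclosed_def
proof (intro exI conjI)
  let ?P = "{p \<in> polyfun. \<forall>a\<in>Z. p a = 0}"
  show "?P \<subseteq> polyfun" by auto
  show "Z = {c. \<forall>p\<in>?P. p c = 0}" using assms by auto
qed

lemma zclosed_separate:
  assumes "zclosed Z" "c \<notin> Z"
  obtains p where "p \<in> polyfun" "\<And>a. a \<in> Z \<Longrightarrow> p a = 0" "p c \<noteq> 0"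
  using zclosedD[OF assms(1), of c] assms(2) that by auto

lemma zclosed_zeros: "p \<in> polyfun \<Longrightarrow> zclosed {c. p c = 0}"
  by (rule zclosedI) auto

lemma zclosed_Inter:
  assumes "\<And>Z. Z \<in> F \<Longrightarrow> zclosed Z"
  shows "zclosed (\<Inter>F)"
proof (rule zclosedI, rule InterI)
  fix c Z
  assume *: "\<And>p. p \<in> polyfun \<Longrightarrow> (\<And>a. a \<in> \<Inter>F \<Longrightarrow> p a = 0) \<Longrightarrow> p c = 0" and "Z \<in> F"
  show "c \<in> Z"
  proof (rule zclosedD[OF assms[OF \<open>Z \<in> F\<close>]])
    fix p assume "p \<in> polyfun" "\<And>a. a \<in> Z \<Longrightarrow> p a = 0"
    then show "p c = 0" using \<open>Z \<in> F\<close> by (intro *[of p]) auto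
  qed
qed

lemma zclosed_INT: "(\<And>i. i \<in> I \<Longrightarrow> zclosed (Z i)) \<Longrightarrow> zclosed (\<Inter>i\<in>I. Z i)"
  by (rule zclosed_Inter) auto

lemma zclosed_Un:
  assumes "zclosed A" "zclosed B"
  shows "zclosed (A \<union> B)"
proof (rule zclosedI, rule ccontr)
  fix c assume *: "\<And>p. p \<in> polyfun \<Longrightarrow> (\<And>a. a \<in> A \<union> B \<Longrightarrow> p a = 0) \<Longrightarrow> p c = 0" "c \<notin> A \<union> B"
  obtain p where p: "p \<in> polyfun" "\<And>a. a \<in> A \<Longrightarrow> p a = 0" "p c \<noteq> 0"
    using zclosed_separate[OF assms(1), of c] *(2) by auto
  obtain q where q: "q \<in> polyfun" "\<And>a. a \<in> B \<Longrightarrow> q a = 0" "q c \<noteq> 0"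
    using zclosed_separate[OF assms(2), of c] *(2) by auto
  have "p c * q c = 0"
    by (rule *(1)[OF pmult[OF p(1) q(1)]]) (use p(2) q(2) in auto)
  then show False using p q by simp
qed

lemma zclosed_zclosure: "zclosed (zclosure A)"
  unfolding zclosure_def by (rule zclosed_Inter) auto

lemma subset_zclosure: "A \<subseteq> zclosure A"
  unfolding zclosure_def by auto

lemma zclosure_least: "zclosed Z \<Longrightarrow> A \<subseteq> Z \<Longrightarrow> zclosure A \<subseteq> Z"
  unfolding zclosure_def by auto

lemma zclosureI:
  assumes "\<And>p. p \<in> polyfun \<Longrightarrow> (\<And>a. a \<in> A \<Longrightarrow> p a = 0) \<Longrightarrow> p c = 0"
  shows "c \<in> zclosure A"
  by (rule zclosedD[OF zclosed_zclosure]) (use assms subset_zclosure in blast)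

lemma zclosureD:
  assumes "c \<in> zclosure A" "p \<in> polyfun" "\<And>a. a \<in> A \<Longrightarrow> p a = 0"
  shows "p c = 0"
  using zclosure_least[OF zclosed_zeros[OF assms(2)], of A] assms by auto

lemma irreducible_set_zclosure:
  assumes "irreducible_set A"
  shows "irreducible_set (zclosure A)"
  unfolding irreducible_set_def
proof (intro conjI allI impI)
  show "zclosure A \<noteq> {}"
    using assms subset_zclosure[of A] unfolding irreducible_set_def by auto
next
  fix B C assume BC: "zclosed B" "zclosed C" "zclosure A \<subseteq> B \<union> C"
  then have "A \<subseteq> B \<or> A \<subseteq> C"
    using assms subset_zclosure[of A] unfolding irreducible_set_def by (meson subset_trans)
  then show "zclosure A \<subseteq> B \<or> zclosure A \<subseteq> C"
    using BC zclosure_least by blast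
qed

lemma irreducible_set_polyfun:
  assumes "irreducible_set Z" "p \<in> polyfun" "q \<in> polyfun" "\<And>c. c \<in> Z \<Longrightarrow> p c * q c = 0"
  shows "(\<forall>c\<in>Z. p c = 0) \<or> (\<forall>c\<in>Z. q c = 0)"
proof -
  have "Z \<subseteq> {c. p c = 0} \<union> {c. q c = 0}" using assms(4) by auto
  then show ?thesis
    using assms(1) zclosed_zeros[OF assms(2)] zclosed_zeros[OF assms(3)]
    unfolding irreducible_set_def by blast
qed

lemma irreducible_set_finite_Un:
  assumes "irreducible_set Z" "finite F" "\<And>C. C \<in> F \<Longrightarrow> zclosed C" "Z \<subseteq> \<Union>F"
  shows "\<exists>C\<in>F. Z \<subseteq> C"
  using assms(2,3,4)
proof (induction F rule: finite_induct)
  case empty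
  then show ?case using assms(1) unfolding irreducible_set_def by auto
next
  case (insert C F)
  have cl: "zclosed (\<Union>G)" if "finite G" "\<forall>C\<in>G. zclosed C" for G
    using that
  proof (induction G rule: finite_induct)
    case empty
    have "zclosed {c. (\<lambda>_. 1) c = (0::complex)}" by (rule zclosed_zeros) (rule pconst)
    then show ?case by simp
  next
    case (insert x G)
    then show ?case by (auto intro: zclosed_Un)
  qed
  have "zclosed (\<Union>F)" using cl insert by auto
  then have "Z \<subseteq> C \<or> Z \<subseteq> \<Union>F"
    using assms(1) insert.prems unfolding irreducible_set_def by (metis Union_insert insertI1)
  then show ?case using insert by auto
qed

section \<open>Polynomial curves\<close>

text \<open>One-variable polynomials as functions of a curve parameter, in contrast to
  \<open>polyfun\<close>, whose members live on structure constants.\<close>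

definition poly_fun :: "(complex \<Rightarrow> complex) \<Rightarrow> bool" where
  "poly_fun f \<longleftrightarrow> (\<exists>q. f = poly q)"

lemma poly_fun_const [simp]: "poly_fun (\<lambda>_. a)"
  unfolding poly_fun_def by (rule exI[of _ "[:a:]"]) auto

lemma poly_fun_id [simp]: "poly_fun (\<lambda>t. t)"
  unfolding poly_fun_def by (rule exI[of _ "[:0, 1:]"]) auto

lemma poly_fun_add: "poly_fun f \<Longrightarrow> poly_fun g \<Longrightarrow> poly_fun (\<lambda>t. f t + g t)"
  unfolding poly_fun_def fun_eq_iff by (metis poly_add)

lemma poly_fun_mult: "poly_fun f \<Longrightarrow> poly_fun g \<Longrightarrow> poly_fun (\<lambda>t. f t * g t)"
  unfolding poly_fun_def fun_eq_iff by (metis poly_mult)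

lemma poly_fun_diff: "poly_fun f \<Longrightarrow> poly_fun g \<Longrightarrow> poly_fun (\<lambda>t. f t - g t)"
  unfolding poly_fun_def fun_eq_iff by (metis poly_diff)

lemma poly_fun_minus: "poly_fun f \<Longrightarrow> poly_fun (\<lambda>t. - f t)"
  unfolding poly_fun_def fun_eq_iff by (metis poly_minus)

lemma poly_fun_power: "poly_fun f \<Longrightarrow> poly_fun (\<lambda>t. f t ^ n)"
  by (induction n) (auto intro: poly_fun_mult)

lemma poly_fun_sum: "(\<And>i. i \<in> I \<Longrightarrow> poly_fun (f i)) \<Longrightarrow> poly_fun (\<lambda>t. \<Sum>i\<in>I. f i t)"
  by (induction I rule: infinite_finite_induct) (auto intro: poly_fun_add)

lemmas poly_fun_intros = poly_fun_const poly_fun_id poly_fun_add poly_fun_mult poly_fun_diff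
  poly_fun_minus poly_fun_power poly_fun_sum

lemma poly_fun_finite_zeros:
  assumes "poly_fun f" "f t \<noteq> 0"
  shows "finite {t. f t = 0}"
proof -
  obtain q where q: "f = poly q" using assms(1) unfolding poly_fun_def by auto
  then have "q \<noteq> 0" using assms(2) by auto
  then show ?thesis using q poly_roots_finite by auto
qed

lemma poly_fun_eq_0:
  assumes "poly_fun f" "finite B" "\<And>t. t \<notin> B \<Longrightarrow> f t = 0"
  shows "f t = 0"
proof (rule ccontr)
  assume "f t \<noteq> 0"
  then have "finite ({t. f t = 0} \<union> B)" using poly_fun_finite_zeros assms by auto
  moreover have "{t. f t = 0} \<union> B = UNIV" using assms(3) by auto
  ultimately show False using infinite_UNIV_char_0[where 'a = complex] by simp
qed

text \<open>Clearing denominators: the entries of the curve are fractions over \<open>s\<close>, so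
  a polynomial in them is a fraction over some power of \<open>s\<close>. Nothing is claimed at the
  zeros of \<open>s\<close>.\<close>

lemma polyfun_curve:
  assumes "p \<in> polyfun" and "poly_fun s"
    and "\<And>i j k. poly_fun (\<gamma>' i j k)"
    and "\<And>t i j k. s t \<noteq> 0 \<Longrightarrow> s t * \<gamma> t i j k = \<gamma>' i j k t"
  shows "\<exists>n f. poly_fun f \<and> (\<forall>t. s t \<noteq> 0 \<longrightarrow> s t ^ n * p (\<gamma> t) = f t)"
  using assms(1)
proof (induction p rule: polyfun.induct)
  case (pconst a)
  show ?case by (rule exI[of _ 0], rule exI[of _ "\<lambda>_. a"]) auto
next
  case (pcoord i j k)
  show ?case
    by (rule exI[of _ 1], rule exI[of _ "\<gamma>' i j k"]) (use assms in auto)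
next
  case (padd p q)
  then obtain n f m g where
    1: "poly_fun f" "\<And>t. s t \<noteq> 0 \<Longrightarrow> s t ^ n * p (\<gamma> t) = f t"
    and 2: "poly_fun g" "\<And>t. s t \<noteq> 0 \<Longrightarrow> s t ^ m * q (\<gamma> t) = g t" by metis
  have "s t ^ (n + m) * (p (\<gamma> t) + q (\<gamma> t)) = s t ^ m * f t + s t ^ n * g t" if "s t \<noteq> 0" for t
    using 1(2)[OF that, symmetric] 2(2)[OF that, symmetric] by (simp add: power_add algebra_simps)
  moreover have "poly_fun (\<lambda>t. s t ^ m * f t + s t ^ n * g t)"
    using 1 2 assms(2) by (intro poly_fun_intros)
  ultimately show ?case by blast
next
  case (pmult p q)
  then obtain n f m g where
    1: "poly_fun f" "\<And>t. s t \<noteq> 0 \<Longrightarrow> s t ^ n * p (\<gamma> t) = f t"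
    and 2: "poly_fun g" "\<And>t. s t \<noteq> 0 \<Longrightarrow> s t ^ m * q (\<gamma> t) = g t" by metis
  have "s t ^ (n + m) * (p (\<gamma> t) * q (\<gamma> t)) = f t * g t" if "s t \<noteq> 0" for t
    using 1(2)[OF that, symmetric] 2(2)[OF that, symmetric] by (simp add: power_add algebra_simps)
  moreover have "poly_fun (\<lambda>t. f t * g t)"
    using 1 2 by (intro poly_fun_intros)
  ultimately show ?case by blast
qed

text \<open>If \<open>S\<close> were covered by \<open>A\<close> and \<open>B\<close> without lying
  in one of them, a polynomial vanishing on \<open>A\<close> but not at \<open>u\<close> and one
  vanishing on \<open>B\<close> but not at \<open>v\<close> would both be nonzero at some point of
  the curve through \<open>u\<close> and \<open>v\<close>, a point outside both sets.\<close>

lemma irreducible_set_if_rational_curves: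
  assumes "S \<noteq> {}"
    and "\<And>u v. u \<in> S \<Longrightarrow> v \<in> S \<Longrightarrow> \<exists>s \<gamma> \<gamma>' t0 t1. poly_fun s \<and> (\<forall>i j k. poly_fun (\<gamma>' i j k)) \<and>
      (\<forall>t i j k. s t \<noteq> 0 \<longrightarrow> \<gamma> t \<in> S \<and> s t * \<gamma> t i j k = \<gamma>' i j k t) \<and>
      s t0 \<noteq> 0 \<and> s t1 \<noteq> 0 \<and> \<gamma> t0 = u \<and> \<gamma> t1 = v"
  shows "irreducible_set S"
  unfolding irreducible_set_def
proof (intro conjI allI impI)
  fix A B assume AB: "zclosed A" "zclosed B" "S \<subseteq> A \<union> B"
  show "S \<subseteq> A \<or> S \<subseteq> B"
  proof (rule ccontr)
    assume "\<not> (S \<subseteq> A \<or> S \<subseteq> B)"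
    then obtain u v where uv: "u \<in> S" "u \<notin> A" "v \<in> S" "v \<notin> B" by auto
    obtain p where p: "p \<in> polyfun" "\<And>c. c \<in> A \<Longrightarrow> p c = 0" "p u \<noteq> 0"
      using zclosed_separate[OF AB(1) uv(2)] by blast
    obtain q where q: "q \<in> polyfun" "\<And>c. c \<in> B \<Longrightarrow> q c = 0" "q v \<noteq> 0"
      using zclosed_separate[OF AB(2) uv(4)] by blast
    from assms(2)[OF uv(1) uv(3)] obtain s \<gamma> \<gamma>' t0 t1 where
      g: "poly_fun s" "\<And>i j k. poly_fun (\<gamma>' i j k)"
      "\<And>t i j k. s t \<noteq> 0 \<Longrightarrow> \<gamma> t \<in> S" "\<And>t i j k. s t \<noteq> 0 \<Longrightarrow> s t * \<gamma> t i j k = \<gamma>' i j k t"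
      "s t0 \<noteq> 0" "s t1 \<noteq> 0" "\<gamma> t0 = u" "\<gamma> t1 = v" by blast
    obtain n f where f: "poly_fun f" "\<And>t. s t \<noteq> 0 \<Longrightarrow> s t ^ n * p (\<gamma> t) = f t"
      using polyfun_curve[where \<gamma> = \<gamma> and \<gamma>' = \<gamma>', OF p(1) g(1,2,4)] by blast
    obtain m h where h: "poly_fun h" "\<And>t. s t \<noteq> 0 \<Longrightarrow> s t ^ m * q (\<gamma> t) = h t"
      using polyfun_curve[where \<gamma> = \<gamma> and \<gamma>' = \<gamma>', OF q(1) g(1,2,4)] by blast
    have "f t0 \<noteq> 0" using f(2)[OF g(5)] g(5,7) p(3) by auto
    moreover have "h t1 \<noteq> 0" using h(2)[OF g(6)] g(6,8) q(3) by auto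
    ultimately have "finite ({t. f t = 0} \<union> {t. h t = 0} \<union> {t. s t = 0})"
      using poly_fun_finite_zeros f(1) h(1) g(1,5) by blast
    then obtain t where "t \<notin> {t. f t = 0} \<union> {t. h t = 0} \<union> {t. s t = 0}"
      using infinite_UNIV_char_0[where 'a = complex] by (metis UNIV_I ex_new_if_finite)
    then have t: "f t \<noteq> 0" "h t \<noteq> 0" "s t \<noteq> 0" by auto
    then have "p (\<gamma> t) \<noteq> 0" "q (\<gamma> t) \<noteq> 0" using f(2)[OF t(3)] h(2)[OF t(3)] by auto
    then show False using g(3)[OF t(3)] AB(3) p(2) q(2) by auto
  qed
qed (rule assms(1))

text \<open>The algebraic form of a limit: a polynomial vanishing on \<open>A\<close> vanishes along
  the curve off the finite set \<open>B\<close>, hence also at the excluded parameters.\<close>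

lemma zclosure_curve:
  assumes "\<And>i j k. poly_fun (\<lambda>t. \<gamma> t i j k)" "finite B" "\<And>t. t \<notin> B \<Longrightarrow> \<gamma> t \<in> zclosure A"
  shows "\<gamma> t \<in> zclosure A"
proof (rule zclosureI)
  fix p assume p: "p \<in> polyfun" "\<And>a. a \<in> A \<Longrightarrow> p a = 0"
  obtain n f where f: "poly_fun f" "\<And>t. 1 ^ n * p (\<gamma> t) = f t"
    using polyfun_curve[where \<gamma> = \<gamma> and \<gamma>' = "\<lambda>i j k t. \<gamma> t i j k" and s = "\<lambda>_. 1", OF p(1)] assms(1)
    by (auto simp: poly_fun_intros)
  have "f t = 0" if "t \<notin> B" for t
    using zclosureD[OF assms(3)[OF that] p] f(2)[of t] by simp
  then show "p (\<gamma> t) = 0" using poly_fun_eq_0[OF f(1) assms(2)] f(2)[of t] by simp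
qed

section \<open>The group action\<close>

definition lin :: "(idx \<Rightarrow> idx \<Rightarrow> complex) \<Rightarrow> vec \<Rightarrow> vec" where
  "lin M x = (\<lambda>k. \<Sum>r\<in>UNIV. M k r * x r)"

definition mprod :: "(idx \<Rightarrow> idx \<Rightarrow> complex) \<Rightarrow> (idx \<Rightarrow> idx \<Rightarrow> complex) \<Rightarrow> (idx \<Rightarrow> idx \<Rightarrow> complex)" where
  "mprod M N = (\<lambda>i j. \<Sum>k\<in>UNIV. M i k * N k j)"

definition unit_vec :: "idx \<Rightarrow> vec" where
  "unit_vec i = (\<lambda>k. if k = i then 1 else 0)"

lemma lin_mprod: "lin (mprod M N) x = lin M (lin N x)"
  unfolding lin_def mprod_def
  by (rule ext) (simp add: UNIV_idx algebra_simps)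

lemma lin_scale: "lin M (\<lambda>k. a * x k) = (\<lambda>k. a * lin M x k)"
  unfolding lin_def by (simp add: sum_distrib_left algebra_simps)

definition idm :: "idx \<Rightarrow> idx \<Rightarrow> complex" where
  "idm i j = (if i = j then 1 else 0)"

lemma is_inv_mprod_iff: "is_inv M N \<longleftrightarrow> mprod M N = idm \<and> mprod N M = idm"
  unfolding is_inv_def mprod_def idm_def fun_eq_iff by blast

lemma lin_idm: "lin idm x = x"
  unfolding lin_def idm_def by (auto simp: if_distrib if_distribR cong: if_cong)

lemma lin_is_inv: "is_inv M N \<Longrightarrow> lin M (lin N x) = x"
  by (simp add: is_inv_mprod_iff lin_idm flip: lin_mprod)

text \<open>Brings \<open>act\<close> into coordinate-free form; composition, inverses and changes
  of basis then follow without indices. The sums are permuted until the matrix indices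
  \<open>r\<close>, \<open>p\<close>, \<open>q\<close> stand outside \<open>i\<close>,
  \<open>j\<close>. \<open>N\<close> may be any matrix here.\<close>

lemma mult_act: "mult (act M N c) x y = lin M (mult c (lin N x) (lin N y))"
proof
  fix k
  have "mult (act M N c) x y k =
      (\<Sum>i\<in>UNIV. \<Sum>j\<in>UNIV. \<Sum>r\<in>UNIV. \<Sum>p\<in>UNIV. \<Sum>q\<in>UNIV. x i * y j * M k r * N p i * N q j * c p q r)"
    unfolding mult_def act_def by (simp add: sum_distrib_left mult.assoc)
  also have "\<dots> = (\<Sum>i\<in>UNIV. \<Sum>r\<in>UNIV. \<Sum>j\<in>UNIV. \<Sum>p\<in>UNIV. \<Sum>q\<in>UNIV. x i * y j * M k r * N p i * N q j * c p q r)"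
    by (rule sum.cong[OF refl], rule sum.swap)
  also have "\<dots> = (\<Sum>r\<in>UNIV. \<Sum>i\<in>UNIV. \<Sum>j\<in>UNIV. \<Sum>p\<in>UNIV. \<Sum>q\<in>UNIV. x i * y j * M k r * N p i * N q j * c p q r)"
    by (rule sum.swap)
  also have "\<dots> = (\<Sum>r\<in>UNIV. \<Sum>i\<in>UNIV. \<Sum>p\<in>UNIV. \<Sum>j\<in>UNIV. \<Sum>q\<in>UNIV. x i * y j * M k r * N p i * N q j * c p q r)"
    by (rule sum.cong[OF refl], rule sum.cong[OF refl], rule sum.swap)
  also have "\<dots> = (\<Sum>r\<in>UNIV. \<Sum>p\<in>UNIV. \<Sum>i\<in>UNIV. \<Sum>j\<in>UNIV. \<Sum>q\<in>UNIV. x i * y j * M k r * N p i * N q j * c p q r)"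
    by (rule sum.cong[OF refl], rule sum.swap)
  also have "\<dots> = (\<Sum>r\<in>UNIV. \<Sum>p\<in>UNIV. \<Sum>i\<in>UNIV. \<Sum>q\<in>UNIV. \<Sum>j\<in>UNIV. x i * y j * M k r * N p i * N q j * c p q r)"
    by (rule sum.cong[OF refl], rule sum.cong[OF refl], rule sum.cong[OF refl], rule sum.swap)
  also have "\<dots> = (\<Sum>r\<in>UNIV. \<Sum>p\<in>UNIV. \<Sum>q\<in>UNIV. \<Sum>i\<in>UNIV. \<Sum>j\<in>UNIV. x i * y j * M k r * N p i * N q j * c p q r)"
    by (rule sum.cong[OF refl], rule sum.cong[OF refl], rule sum.swap)
  also have "\<dots> = lin M (mult c (lin N x) (lin N y)) k"
    unfolding mult_def lin_def sum_product
    by (simp add: sum_distrib_left sum_distrib_right algebra_simps)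
  finally show "mult (act M N c) x y k = lin M (mult c (lin N x) (lin N y)) k" .
qed

lemma mult_unit_vec: "mult c (unit_vec i) (unit_vec j) = c i j"
  by (rule ext, cases i; cases j) (simp_all add: mult_def unit_vec_def UNIV_idx)

lemma mult_eqI: "(\<And>x y. mult c x y = mult d x y) \<Longrightarrow> c = d"
  by (intro ext) (simp flip: mult_unit_vec)

lemma act_mprod: "act M N (act M' N' c) = act (mprod M M') (mprod N' N) c"
  by (rule mult_eqI) (simp add: mult_act lin_mprod)

lemma is_inv_sym: "is_inv M N \<Longrightarrow> is_inv N M"
  unfolding is_inv_def by auto

lemma act_inverse: "is_inv M N \<Longrightarrow> act N M (act M N c) = c"
  by (rule mult_eqI) (simp add: mult_act lin_is_inv is_inv_sym)

lemma mprod_assoc: "mprod (mprod M N) P = mprod M (mprod N P)"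
  unfolding mprod_def by (intro ext) (simp add: UNIV_idx algebra_simps)

lemma mprod_idm [simp]: "mprod idm M = M" "mprod M idm = M"
  unfolding mprod_def idm_def by (auto simp: if_distrib if_distribR cong: if_cong)

lemma is_inv_mprod:
  assumes "is_inv M N" "is_inv M' N'"
  shows "is_inv (mprod M M') (mprod N' N)"
  using assms unfolding is_inv_mprod_iff by (metis mprod_assoc mprod_idm)

lemma grading_preserving_iff:
  "grading_preserving M \<longleftrightarrow> M E1 F1 = 0 \<and> M E2 F1 = 0 \<and> M F1 E1 = 0 \<and> M F1 E2 = 0"
proof
  assume *: "M E1 F1 = 0 \<and> M E2 F1 = 0 \<and> M F1 E1 = 0 \<and> M F1 E2 = 0"
  show "grading_preserving M" unfolding grading_preserving_def
  proof (intro allI impI)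
    fix i j assume "par i \<noteq> par j" then show "M i j = 0" using * by (cases i; cases j) auto
  qed
qed (auto simp: grading_preserving_def)

lemma grading_preserving_inverse:
  assumes "grading_preserving M" "is_inv M N"
  shows "grading_preserving N"
proof -
  have M: "M E1 F1 = 0" "M E2 F1 = 0" "M F1 E1 = 0" "M F1 E2 = 0"
    using assms(1) by (auto simp: grading_preserving_iff)
  have *: "(\<Sum>k\<in>UNIV. M i k * N k j) = (if i = j then 1 else 0)"
    "(\<Sum>k\<in>UNIV. N i k * M k j) = (if i = j then 1 else 0)" for i j
    using assms(2) unfolding is_inv_def by auto
  have "M F1 F1 * N F1 F1 = 1" using *(1)[of F1 F1] M by (simp add: UNIV_idx)
  then have nz: "M F1 F1 \<noteq> 0" by auto
  have "N F1 E1 = 0" "N F1 E2 = 0"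
    using *(1)[of F1 E1] *(1)[of F1 E2] M nz by (auto simp: UNIV_idx)
  moreover have "N E1 F1 = 0" "N E2 F1 = 0"
    using *(2)[of E1 F1] *(2)[of E2 F1] M nz by (auto simp: UNIV_idx)
  ultimately show ?thesis by (simp add: grading_preserving_iff)
qed

lemma grading_preserving_mprod:
  "grading_preserving M \<Longrightarrow> grading_preserving N \<Longrightarrow> grading_preserving (mprod M N)"
  by (auto simp: grading_preserving_iff mprod_def UNIV_idx)

lemma orbit_actI: "grading_preserving M \<Longrightarrow> is_inv M N \<Longrightarrow> act M N c \<in> orbit c"
  unfolding orbit_def by auto

lemma orbitE:
  assumes "d \<in> orbit c"
  obtains M N where "grading_preserving M" "is_inv M N" "d = act M N c"
  using assms unfolding orbit_def by auto

lemma orbit_trans: "d \<in> orbit c \<Longrightarrow> e \<in> orbit d \<Longrightarrow> e \<in> orbit c"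
  by (elim orbitE) (auto simp: act_mprod intro!: orbit_actI grading_preserving_mprod is_inv_mprod)

lemma orbit_sym: "d \<in> orbit c \<Longrightarrow> c \<in> orbit d"
  by (elim orbitE) (metis act_inverse grading_preserving_inverse is_inv_sym orbit_actI)

lemma grading_preserving_idm: "grading_preserving idm"
  by (simp add: grading_preserving_iff idm_def)

lemma is_inv_idm: "is_inv idm idm"
  by (simp add: is_inv_mprod_iff)

lemma act_idm: "act idm idm c = c"
  by (rule mult_eqI) (simp add: mult_act lin_idm)

lemma orbit_refl: "c \<in> orbit c"
  using orbit_actI[OF grading_preserving_idm is_inv_idm, of c] by (simp add: act_idm)

lemma polyfun_act: "p \<in> polyfun \<Longrightarrow> (\<lambda>c. p (act M N c)) \<in> polyfun"
proof (induction p rule: polyfun.induct)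
  case (pcoord i j k)
  show ?case unfolding act_def by (intro polyfun_intros)
qed (auto intro: polyfun_intros)

text \<open>A fixed group element acts by a polynomial map that preserves \<open>orbit d\<close>, so
  it preserves the closure as well.\<close>

lemma zclosure_orbit_act:
  assumes "c \<in> zclosure (orbit d)" "e \<in> orbit c"
  shows "e \<in> zclosure (orbit d)"
proof (rule zclosureI)
  fix p assume p: "p \<in> polyfun" "\<And>a. a \<in> orbit d \<Longrightarrow> p a = 0"
  obtain M N where MN: "grading_preserving M" "is_inv M N" "e = act M N c"
    using assms(2) by (elim orbitE)
  have "p (act M N a) = 0" if "a \<in> orbit d" for a
    using p(2) orbit_trans[OF that orbit_actI[OF MN(1,2)]] by auto
  then show "p e = 0"
    using zclosureD[OF assms(1) polyfun_act[OF p(1)]] MN(3) by auto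
qed

text \<open>The adjugate for the two blocks: the inverse of \<open>M\<close> is
  \<open>adjm M\<close> divided by \<open>detm M\<close>, so only the determinant occurs as a
  denominator.\<close>

definition adjm :: "(idx \<Rightarrow> idx \<Rightarrow> complex) \<Rightarrow> idx \<Rightarrow> idx \<Rightarrow> complex" where
  "adjm M i j = (case i of
     E1 \<Rightarrow> (case j of E1 \<Rightarrow> M E2 E2 * M F1 F1 | E2 \<Rightarrow> - M E1 E2 * M F1 F1 | F1 \<Rightarrow> 0)
   | E2 \<Rightarrow> (case j of E1 \<Rightarrow> - M E2 E1 * M F1 F1 | E2 \<Rightarrow> M E1 E1 * M F1 F1 | F1 \<Rightarrow> 0)
   | F1 \<Rightarrow> (case j of E1 \<Rightarrow> 0 | E2 \<Rightarrow> 0 | F1 \<Rightarrow> M E1 E1 * M E2 E2 - M E1 E2 * M E2 E1))"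

definition detm :: "(idx \<Rightarrow> idx \<Rightarrow> complex) \<Rightarrow> complex" where
  "detm M = (M E1 E1 * M E2 E2 - M E1 E2 * M E2 E1) * M F1 F1"

lemma is_inv_adjm:
  assumes "grading_preserving M" "detm M \<noteq> 0"
  shows "is_inv M (\<lambda>i j. adjm M i j / detm M)"
proof -
  have "(\<Sum>k\<in>UNIV. M i k * adjm M k j) = (if i = j then detm M else 0)"
       "(\<Sum>k\<in>UNIV. adjm M i k * M k j) = (if i = j then detm M else 0)" for i j
    using assms(1) unfolding grading_preserving_iff
    by (cases i; cases j; simp add: UNIV_idx adjm_def detm_def algebra_simps)+
  then show ?thesis
    unfolding is_inv_def using assms(2) 
    by (auto simp: sum_divide_distrib[symmetric])
qed

lemma detm_nonzero:
  assumes "grading_preserving M" "is_inv M N"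
  shows "detm M \<noteq> 0"
proof -
  have N: "grading_preserving N" using grading_preserving_inverse assms by auto
  have *: "(\<Sum>k\<in>UNIV. M i k * N k j) = (if i = j then 1 else 0)" for i j
    using assms(2) unfolding is_inv_def by auto
  have 1: "M F1 F1 * N F1 F1 = 1" "M E1 E1 * N E1 E1 + M E1 E2 * N E2 E1 = 1"
    "M E1 E1 * N E1 E2 + M E1 E2 * N E2 E2 = 0" "M E2 E1 * N E1 E1 + M E2 E2 * N E2 E1 = 0"
    "M E2 E1 * N E1 E2 + M E2 E2 * N E2 E2 = 1"
    using *[of F1 F1] *[of E1 E1] *[of E1 E2] *[of E2 E1] *[of E2 E2] assms(1) N
    by (simp_all add: UNIV_idx grading_preserving_iff)
  \<comment> \<open>Multiplicativity of the determinant on the even block.\<close>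
  have "(M E1 E1 * M E2 E2 - M E1 E2 * M E2 E1) * (N E1 E1 * N E2 E2 - N E1 E2 * N E2 E1) = 1"
    using 1(2-5) by algebra
  then show ?thesis using 1(1) unfolding detm_def by auto
qed

lemma is_inv_unique: "is_inv M N \<Longrightarrow> is_inv M N' \<Longrightarrow> N = N'"
  unfolding is_inv_mprod_iff by (metis mprod_assoc mprod_idm)

text \<open>The determinant is squared because the inverse matrix enters the action twice.\<close>

lemma act_adjm:
  assumes "grading_preserving M" "is_inv M N"
  shows "detm M ^ 2 * act M N c i j k = act M (adjm M) c i j k"
proof -
  have N: "N = (\<lambda>i j. adjm M i j / detm M)"
    using is_inv_unique assms is_inv_adjm detm_nonzero by blast
  have nz: "detm M \<noteq> 0" using detm_nonzero assms by blast
  then have "adjm M p q = detm M * N p q" for p q using N by auto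
  then show ?thesis
    unfolding act_def by (simp add: sum_distrib_left algebra_simps power2_eq_square)
qed

lemma irreducible_set_orbit: "irreducible_set (orbit c)"
proof (rule irreducible_set_if_rational_curves)
  show "orbit c \<noteq> {}" using orbit_refl by auto
next
  fix u v assume "u \<in> orbit c" "v \<in> orbit c"
  then obtain M N M' N' where M: "grading_preserving M" "is_inv M N" "u = act M N c"
    and M': "grading_preserving M'" "is_inv M' N'" "v = act M' N' c" by (metis orbitE)
  define L where "L t = (\<lambda>i j. (1 - t) * M i j + t * M' i j)" for t
  define s where "s t = detm (L t) ^ 2" for t
  define \<gamma> where "\<gamma> t = act (L t) (\<lambda>i j. adjm (L t) i j / detm (L t)) c" for t
  define \<gamma>' where "\<gamma>' i j k t = act (L t) (adjm (L t)) c i j k" for i j k t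
  have L: "grading_preserving (L t)" for t
    using M(1) M'(1) by (simp add: L_def grading_preserving_iff)
  have Lp: "poly_fun (\<lambda>t. L t i j)" for i j unfolding L_def by (intro poly_fun_intros)
  have Ap: "poly_fun (\<lambda>t. adjm (L t) i j)" for i j
    unfolding adjm_def by (cases i; cases j; simp; intro poly_fun_intros Lp)
  have "poly_fun s" unfolding s_def detm_def by (intro poly_fun_intros Lp)
  moreover have "poly_fun (\<gamma>' i j k)" for i j k
    unfolding \<gamma>'_def act_def by (intro poly_fun_intros Lp Ap)
  moreover have "\<gamma> t \<in> orbit c" "s t * \<gamma> t i j k = \<gamma>' i j k t" if "s t \<noteq> 0" for t i j k
  proof -
    have i: "is_inv (L t) (\<lambda>i j. adjm (L t) i j / detm (L t))"
      using that L by (intro is_inv_adjm) (auto simp: s_def)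
    show "\<gamma> t \<in> orbit c" unfolding \<gamma>_def using L i by (rule orbit_actI)
    show "s t * \<gamma> t i j k = \<gamma>' i j k t"
      unfolding s_def \<gamma>_def \<gamma>'_def by (rule act_adjm[OF L i])
  qed
  moreover have L01: "L 0 = M" "L 1 = M'" by (auto simp: L_def)
  moreover have nz: "s 0 \<noteq> 0" "s 1 \<noteq> 0"
    unfolding s_def L01 using detm_nonzero[OF M(1,2)] detm_nonzero[OF M'(1,2)] by simp_all
  moreover have "\<gamma> 0 = u"
    unfolding \<gamma>_def L01 M(3)
    using is_inv_unique[OF M(2) is_inv_adjm[OF M(1) detm_nonzero[OF M(1,2)]]] by simp
  moreover have "\<gamma> 1 = v"
    unfolding \<gamma>_def L01 M'(3)
    using is_inv_unique[OF M'(2) is_inv_adjm[OF M'(1) detm_nonzero[OF M'(1,2)]]] by simp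
  ultimately show "\<exists>s \<gamma> \<gamma>' t0 t1. poly_fun s \<and> (\<forall>i j k. poly_fun (\<gamma>' i j k)) \<and>
      (\<forall>t i j k. s t \<noteq> 0 \<longrightarrow> \<gamma> t \<in> orbit c \<and> s t * \<gamma> t i j k = \<gamma>' i j k t) \<and>
      s t0 \<noteq> 0 \<and> s t1 \<noteq> 0 \<and> \<gamma> t0 = u \<and> \<gamma> t1 = v" by blast
qed

section \<open>The variety of perm superalgebras\<close>

lemma all_idx: "(\<forall>i. P i) \<longleftrightarrow> P E1 \<and> P E2 \<and> P F1"
  by (metis idx.exhaust)

lemma mult_unit_vec_right: "mult c x (unit_vec k) l = (\<Sum>m\<in>UNIV. x m * c m k l)"
  by (cases k) (simp_all add: mult_def unit_vec_def UNIV_idx)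

lemma mult_unit_vec_left: "mult c (unit_vec i) y l = (\<Sum>m\<in>UNIV. y m * c i m l)"
  by (cases i) (simp_all add: mult_def unit_vec_def UNIV_idx)

lemma homog_unit_vec: "homog (unit_vec i) (par i)"
  by (cases i) (auto simp: homog_def unit_vec_def)

lemma mult_mult_left:
  "mult c (mult c x y) z l =
    (\<Sum>i\<in>UNIV. \<Sum>j\<in>UNIV. \<Sum>k\<in>UNIV. x i * y j * z k * (\<Sum>m\<in>UNIV. c i j m * c m k l))"
  unfolding mult_def by (simp add: UNIV_idx algebra_simps)

lemma mult_mult_right:
  "mult c x (mult c y z) l =
    (\<Sum>i\<in>UNIV. \<Sum>j\<in>UNIV. \<Sum>k\<in>UNIV. x i * y j * z k * (\<Sum>m\<in>UNIV. c j k m * c i m l))"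
  unfolding mult_def by (simp add: UNIV_idx algebra_simps)

text \<open>The identities are trilinear, so basis vectors suffice. The sign may be exchanged term
  by term, since the coordinates of a homogeneous vector vanish at basis vectors of the other
  parity.\<close>

lemma perm_sc_iff:
  "perm_sc c \<longleftrightarrow> (\<forall>i j k l.
    (\<Sum>m\<in>UNIV. c i j m * c m k l) = (\<Sum>m\<in>UNIV. c j k m * c i m l) \<and>
    (\<Sum>m\<in>UNIV. c j k m * c i m l) = (-1) ^ (par j * par k) * (\<Sum>m\<in>UNIV. c k j m * c i m l))"
  (is "_ \<longleftrightarrow> ?R")
proof
  assume *: "perm_sc c"
  show ?R
  proof (intro allI)
    fix i j k l
    have "mult c (mult c (unit_vec i) (unit_vec j)) (unit_vec k) = mult c (unit_vec i) (mult c (unit_vec j) (unit_vec k)) \<and>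
       mult c (unit_vec i) (mult c (unit_vec j) (unit_vec k)) =
        (\<lambda>l. (-1) ^ (par j * par k) * mult c (unit_vec i) (mult c (unit_vec k) (unit_vec j)) l)"
      using * homog_unit_vec unfolding perm_sc_def by blast
    then show "(\<Sum>m\<in>UNIV. c i j m * c m k l) = (\<Sum>m\<in>UNIV. c j k m * c i m l) \<and>
      (\<Sum>m\<in>UNIV. c j k m * c i m l) = (-1) ^ (par j * par k) * (\<Sum>m\<in>UNIV. c k j m * c i m l)"
      by (auto simp: fun_eq_iff mult_unit_vec mult_unit_vec_left mult_unit_vec_right)
  qed
next
  assume *: ?R
  show "perm_sc c"
    unfolding perm_sc_def
  proof (intro allI impI conjI ext)
    fix x y z dx dy dz l assume h: "homog x dx" "homog y dy" "homog z dz"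
    show "mult c (mult c x y) z l = mult c x (mult c y z) l"
      unfolding mult_mult_left mult_mult_right
      by (intro sum.cong refl arg_cong2[where f = "(*)"] conjunct1[OF *[rule_format]])
    have sgn: "y j * z k * (-1) ^ (par j * par k) = (-1) ^ (dy * dz) * (y j * z k)" for j k
    proof (cases "par j = dy \<and> par k = dz")
      case False
      then have "y j = 0 \<or> z k = 0" using h(2,3) unfolding homog_def by blast
      then show ?thesis by (elim disjE) simp_all
    qed (simp add: mult.commute)
    have "x i * y j * z k * (\<Sum>m\<in>UNIV. c j k m * c i m l) =
        (-1) ^ (dy * dz) * (x i * z k * y j * (\<Sum>m\<in>UNIV. c k j m * c i m l))" for i j k
    proof -
      have "x i * y j * z k * (\<Sum>m\<in>UNIV. c j k m * c i m l) =
        x i * (y j * z k * (-1) ^ (par j * par k)) * (\<Sum>m\<in>UNIV. c k j m * c i m l)"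
        using conjunct2[OF *[rule_format, of i j k l]] by (simp only: mult.assoc)
      then show ?thesis unfolding sgn by simp
    qed
    then have "mult c x (mult c y z) l = (-1) ^ (dy * dz) *
      (\<Sum>i\<in>UNIV. \<Sum>j\<in>UNIV. \<Sum>k\<in>UNIV. x i * z k * y j * (\<Sum>m\<in>UNIV. c k j m * c i m l))"
      unfolding mult_mult_right by (simp add: sum_distrib_left)
    also have "(\<Sum>i\<in>UNIV. \<Sum>j\<in>UNIV. \<Sum>k\<in>UNIV. x i * z k * y j * (\<Sum>m\<in>UNIV. c k j m * c i m l)) =
      mult c x (mult c z y) l"
      unfolding mult_mult_right by (rule sum.cong[OF refl]) (rule sum.swap)
    finally show "mult c x (mult c y z) l = (-1) ^ (dy * dz) * mult c x (mult c z y) l" .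
  qed
qed

lemma zclosed_PermVar: "zclosed PermVar"
proof (rule zclosedI)
  fix c
  assume *: "\<And>p. p \<in> polyfun \<Longrightarrow> (\<And>a. a \<in> PermVar \<Longrightarrow> p a = 0) \<Longrightarrow> p c = 0"
  have "c i j k = 0" if "par k \<noteq> (par i + par j) mod 2" for i j k
    by (rule *[OF pcoord]) (use that in \<open>simp add: PermVar_def even_sc_def\<close>)
  moreover have "(\<Sum>m\<in>UNIV. c i j m * c m k l) - (\<Sum>m\<in>UNIV. c j k m * c i m l) = 0" for i j k l
  proof (rule *)
    show "(\<lambda>c. (\<Sum>m\<in>UNIV. c i j m * c m k l) - (\<Sum>m\<in>UNIV. c j k m * c i m l)) \<in> polyfun"
      by (intro polyfun_intros)
    show "(\<Sum>m\<in>UNIV. a i j m * a m k l) - (\<Sum>m\<in>UNIV. a j k m * a i m l) = 0" if "a \<in> PermVar" for a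
      using that unfolding PermVar_def perm_sc_iff mem_Collect_eq by (metis right_minus_eq)
  qed
  moreover have "(\<Sum>m\<in>UNIV. c j k m * c i m l) - (-1) ^ (par j * par k) * (\<Sum>m\<in>UNIV. c k j m * c i m l) = 0"
    for i j k l
  proof (rule *)
    show "(\<lambda>c. (\<Sum>m\<in>UNIV. c j k m * c i m l) - (-1) ^ (par j * par k) * (\<Sum>m\<in>UNIV. c k j m * c i m l)) \<in> polyfun"
      by (intro polyfun_intros)
    show "(\<Sum>m\<in>UNIV. a j k m * a i m l) - (-1) ^ (par j * par k) * (\<Sum>m\<in>UNIV. a k j m * a i m l) = 0"
      if "a \<in> PermVar" for a
      using that unfolding PermVar_def perm_sc_iff mem_Collect_eq by (metis right_minus_eq)
  qed
  ultimately show "c \<in> PermVar"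
    unfolding PermVar_def even_sc_def perm_sc_iff right_minus_eq by blast
qed

lemma homog_lin:
  assumes "grading_preserving N" "homog x d"
  shows "homog (lin N x) d"
  using assms unfolding homog_def grading_preserving_iff all_idx lin_def by (auto simp: UNIV_idx)

lemma even_sc_act:
  assumes "grading_preserving M" "grading_preserving N" "even_sc c"
  shows "even_sc (act M N c)"
  unfolding even_sc_def
proof (intro allI impI)
  fix i j k assume k: "par k \<noteq> (par i + par j) mod 2"
  have "M k r * (N p i * N q j * c p q r) = 0" for p q r
  proof (rule ccontr)
    assume *: "\<not> ?thesis"
    then have "M k r \<noteq> 0" "N p i \<noteq> 0" "N q j \<noteq> 0" "c p q r \<noteq> 0" by auto
    then have "par k = par r" "par p = par i" "par q = par j" "par r = (par p + par q) mod 2"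
      using assms unfolding grading_preserving_def even_sc_def by blast+
    then show False using k by simp
  qed
  then show "act M N c i j k = 0" unfolding act_def sum_distrib_left by (intro sum.neutral ballI)
qed

lemma PermVar_act:
  assumes "grading_preserving M" "is_inv M N" "c \<in> PermVar"
  shows "act M N c \<in> PermVar"
proof -
  have N: "grading_preserving N" using grading_preserving_inverse assms by blast
  have inv: "lin N (lin M x) = x" for x using lin_is_inv is_inv_sym assms(2) by blast
  have perm: "perm_sc c" and ev: "even_sc c" using assms(3) by (auto simp: PermVar_def)
  have "perm_sc (act M N c)"
    unfolding perm_sc_def
  proof (intro allI impI)
    fix x y z dx dy dz assume "homog x dx" "homog y dy" "homog z dz"
    then have h: "homog (lin N x) dx" "homog (lin N y) dy" "homog (lin N z) dz"
      using homog_lin[OF N] by auto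
    then have "mult c (mult c (lin N x) (lin N y)) (lin N z) = mult c (lin N x) (mult c (lin N y) (lin N z))"
      "mult c (lin N x) (mult c (lin N y) (lin N z)) =
        (\<lambda>k. (-1) ^ (dy * dz) * mult c (lin N x) (mult c (lin N z) (lin N y)) k)"
      using perm unfolding perm_sc_def by blast+
    then show "mult (act M N c) (mult (act M N c) x y) z = mult (act M N c) x (mult (act M N c) y z) \<and>
      mult (act M N c) x (mult (act M N c) y z) =
        (\<lambda>k. (-1) ^ (dy * dz) * mult (act M N c) x (mult (act M N c) z y) k)"
      unfolding mult_act inv lin_scale[symmetric] by metis
  qed
  then show ?thesis using even_sc_act[OF assms(1) N ev] by (simp add: PermVar_def)
qed

lemma orbit_subset_PermVar: "c \<in> PermVar \<Longrightarrow> orbit c \<subseteq> PermVar"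
  by (auto elim!: orbitE intro: PermVar_act)

section \<open>Structure constants in coordinates\<close>

text \<open>Here \<open>p, \<dots>, w\<close> are the coordinates of \<open>e1 e1\<close>, \<open>e1 e2\<close>, \<open>e2 e1\<close>, \<open>e2 e2\<close>, while
  \<open>e\<^sub>i f = b\<^sub>i f\<close>, \<open>f e\<^sub>i = d\<^sub>i f\<close> and \<open>f f = t\<close>.\<close>
definition mk :: "complex \<Rightarrow> complex \<Rightarrow> complex \<Rightarrow> complex \<Rightarrow> complex \<Rightarrow> complex \<Rightarrow> complex \<Rightarrow> complex
    \<Rightarrow> complex \<Rightarrow> complex \<Rightarrow> complex \<Rightarrow> complex \<Rightarrow> complex \<Rightarrow> complex \<Rightarrow> sc" where
  "mk p q r s r' s' u w b1 b2 d1 d2 t1 t2 = (\<lambda>i j k. case i of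
     E1 \<Rightarrow> (case j of
       E1 \<Rightarrow> (case k of E1 \<Rightarrow> p | E2 \<Rightarrow> q | F1 \<Rightarrow> 0)
     | E2 \<Rightarrow> (case k of E1 \<Rightarrow> r | E2 \<Rightarrow> s | F1 \<Rightarrow> 0)
     | F1 \<Rightarrow> (case k of E1 \<Rightarrow> 0 | E2 \<Rightarrow> 0 | F1 \<Rightarrow> b1))
   | E2 \<Rightarrow> (case j of
       E1 \<Rightarrow> (case k of E1 \<Rightarrow> r' | E2 \<Rightarrow> s' | F1 \<Rightarrow> 0)
     | E2 \<Rightarrow> (case k of E1 \<Rightarrow> u | E2 \<Rightarrow> w | F1 \<Rightarrow> 0)
     | F1 \<Rightarrow> (case k of E1 \<Rightarrow> 0 | E2 \<Rightarrow> 0 | F1 \<Rightarrow> b2))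
   | F1 \<Rightarrow> (case j of
       E1 \<Rightarrow> (case k of E1 \<Rightarrow> 0 | E2 \<Rightarrow> 0 | F1 \<Rightarrow> d1)
     | E2 \<Rightarrow> (case k of E1 \<Rightarrow> 0 | E2 \<Rightarrow> 0 | F1 \<Rightarrow> d2)
     | F1 \<Rightarrow> (case k of E1 \<Rightarrow> t1 | E2 \<Rightarrow> t2 | F1 \<Rightarrow> 0)))"

lemma mk_simps [simp]:
  fixes p q r s r' s' u w b1 b2 d1 d2 t1 t2 :: complex
  defines "c \<equiv> mk p q r s r' s' u w b1 b2 d1 d2 t1 t2"
  shows "c E1 E1 E1 = p" "c E1 E1 E2 = q" "c E1 E2 E1 = r" "c E1 E2 E2 = s"
    "c E2 E1 E1 = r'" "c E2 E1 E2 = s'" "c E2 E2 E1 = u" "c E2 E2 E2 = w"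
    "c E1 F1 F1 = b1" "c E2 F1 F1 = b2" "c F1 E1 F1 = d1" "c F1 E2 F1 = d2"
    "c F1 F1 E1 = t1" "c F1 F1 E2 = t2"
    "c E1 E1 F1 = 0" "c E1 E2 F1 = 0" "c E2 E1 F1 = 0" "c E2 E2 F1 = 0" "c F1 F1 F1 = 0"
    "c E1 F1 E1 = 0" "c E1 F1 E2 = 0" "c E2 F1 E1 = 0" "c E2 F1 E2 = 0"
    "c F1 E1 E1 = 0" "c F1 E1 E2 = 0" "c F1 E2 E1 = 0" "c F1 E2 E2 = 0"
  unfolding c_def mk_def by simp_all

lemma sc_eq_iff: "(c :: sc) = d \<longleftrightarrow> (\<forall>i j k. c i j k = d i j k)"
  by (simp add: fun_eq_iff)

lemma even_sc_mk:
  assumes "even_sc c"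
  shows "c = mk (c E1 E1 E1) (c E1 E1 E2) (c E1 E2 E1) (c E1 E2 E2) (c E2 E1 E1) (c E2 E1 E2)
    (c E2 E2 E1) (c E2 E2 E2) (c E1 F1 F1) (c E2 F1 F1) (c F1 E1 F1) (c F1 E2 F1) (c F1 F1 E1) (c F1 F1 E2)"
  using assms unfolding even_sc_def sc_eq_iff all_idx by auto

lemma R_mk:
  "R01 = mk 1 0 0 0 0 0 0 1 0 0 0 0 0 0"
  "R02 = mk 1 0 0 0 0 0 0 1 1 0 1 0 0 0"
  "R04 = mk 1 0 0 0 0 0 0 1 0 0 1 0 0 0"
  "R10 = mk 1 0 0 0 0 0 0 0 0 0 0 0 0 1"
  "R25 = mk 1 0 0 0 0 1 0 0 0 0 0 0 0 0"
  "R31 = mk 1 0 0 0 0 1 0 0 0 0 1 0 0 0"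
  "R33 = mk 1 0 0 0 0 1 0 0 1 0 1 0 0 0"
  unfolding R01_def R02_def R04_def R10_def R25_def R31_def R33_def str_def sc_eq_iff all_idx
  by auto

lemma even_sc_mk': "even_sc (mk p q r s r' s' u w b1 b2 d1 d2 t1 t2)"
  unfolding even_sc_def all_idx by simp

lemma PermVar_mkD:
  assumes "mk p q r s r' s' u w b1 b2 d1 d2 t1 t2 \<in> PermVar"
  shows PermVar_mk_assoc: "q * r' = q * r" "q * s' = q * s"
      "q * u = r * s" "p * s + q * w = r * q + s * s"
      "r * p + s * r' = r' * p + s' * r" "r * q + s * s' = r' * q + s' * s"
      "r * r + s * u = u * p + w * r" "r * s + s * w = u * q + w * s"
      "r' * p + s' * r' = p * r' + q * u" "r' * q + s' * s' = p * s' + q * w"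
      "u * p + w * r' = r' * r' + s' * u" "u * q + w * s' = r' * s' + s' * w"
      "u * r = u * r'" "u * s = u * s'"
    and PermVar_mk_perm: "(r - r') * p + (s - s') * r = 0" "(r - r') * q + (s - s') * s = 0"
      "(r - r') * r' + (s - s') * u = 0" "(r - r') * s' + (s - s') * w = 0"
    and PermVar_mk_b: "p * b1 + q * b2 = b1 * b1" "r * b1 + s * b2 = b1 * b2"
      "r' * b1 + s' * b2 = b2 * b1" "u * b1 + w * b2 = b2 * b2"
    and PermVar_mk_d: "p * d1 + q * d2 = d1 * d1" "r * d1 + s * d2 = d1 * d2"
      "r' * d1 + s' * d2 = d2 * d1" "u * d1 + w * d2 = d2 * d2"
    and PermVar_mk_bd: "b1 * b1 = b1 * d1" "b1 * b2 = b1 * d2" "b2 * b1 = b2 * d1" "b2 * b2 = b2 * d2"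
    and PermVar_mk_et: "t1 * p + t2 * r = 0" "t1 * q + t2 * s = 0"
      "t1 * r' + t2 * u = 0" "t1 * s' + t2 * w = 0"
    and PermVar_mk_te: "t1 * p + t2 * r' = d1 * t1" "t1 * q + t2 * s' = d1 * t2"
      "t1 * r + t2 * u = d2 * t1" "t1 * s + t2 * w = d2 * t2"
    and PermVar_mk_bt: "b1 * t1 = 0" "b1 * t2 = 0" "b2 * t1 = 0" "b2 * t2 = 0"
      "d1 * t1 = 0" "d1 * t2 = 0" "d2 * t1 = 0" "d2 * t2 = 0"
proof -
  let ?c = "mk p q r s r' s' u w b1 b2 d1 d2 t1 t2"
  have A: "(\<Sum>m\<in>UNIV. ?c i j m * ?c m k l) = (\<Sum>m\<in>UNIV. ?c j k m * ?c i m l)"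
    and P: "(\<Sum>m\<in>UNIV. ?c j k m * ?c i m l) = (-1) ^ (par j * par k) * (\<Sum>m\<in>UNIV. ?c k j m * ?c i m l)"
    for i j k l
    using assms unfolding PermVar_def perm_sc_iff mem_Collect_eq by blast+
  note unf = UNIV_idx algebra_simps
  show "q * r' = q * r" using A[of E1 E1 E1 E1] by (simp add: unf)
  show "q * s' = q * s" using A[of E1 E1 E1 E2] by (simp add: unf)
  show "q * u = r * s" using A[of E1 E1 E2 E1] by (simp add: unf)
  show "p * s + q * w = r * q + s * s" using A[of E1 E1 E2 E2] by (simp add: unf)
  show "r * p + s * r' = r' * p + s' * r" using A[of E1 E2 E1 E1] by (simp add: unf)
  show "r * q + s * s' = r' * q + s' * s" using A[of E1 E2 E1 E2] by (simp add: unf)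
  show "r * r + s * u = u * p + w * r" using A[of E1 E2 E2 E1] by (simp add: unf)
  show "r * s + s * w = u * q + w * s" using A[of E1 E2 E2 E2] by (simp add: unf)
  show "r' * p + s' * r' = p * r' + q * u" using A[of E2 E1 E1 E1] by (simp add: unf)
  show "r' * q + s' * s' = p * s' + q * w" using A[of E2 E1 E1 E2] by (simp add: unf)
  show "u * p + w * r' = r' * r' + s' * u" using A[of E2 E2 E1 E1] by (simp add: unf)
  show "u * q + w * s' = r' * s' + s' * w" using A[of E2 E2 E1 E2] by (simp add: unf)
  show "u * r = u * r'" using A[of E2 E2 E2 E1] by (simp add: unf)
  show "u * s = u * s'" using A[of E2 E2 E2 E2] by (simp add: unf)
  show "(r - r') * p + (s - s') * r = 0" using P[where i = E1 and j = E1 and k = E2 and l = E1] by (simp add: unf)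
  show "(r - r') * q + (s - s') * s = 0" using P[where i = E1 and j = E1 and k = E2 and l = E2] by (simp add: unf)
  show "(r - r') * r' + (s - s') * u = 0" using P[where i = E2 and j = E1 and k = E2 and l = E1] by (simp add: unf)
  show "(r - r') * s' + (s - s') * w = 0" using P[where i = E2 and j = E1 and k = E2 and l = E2] by (simp add: unf)
  show "p * b1 + q * b2 = b1 * b1" using A[of E1 E1 F1 F1] by (simp add: unf)
  show "r * b1 + s * b2 = b1 * b2" using A[of E1 E2 F1 F1] by (simp add: unf)
  show "r' * b1 + s' * b2 = b2 * b1" using A[of E2 E1 F1 F1] by (simp add: unf)
  show "u * b1 + w * b2 = b2 * b2" using A[of E2 E2 F1 F1] by (simp add: unf)
  show "p * d1 + q * d2 = d1 * d1" using A[of F1 E1 E1 F1] by (simp add: unf)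
  show "r * d1 + s * d2 = d1 * d2" using A[of F1 E1 E2 F1] by (simp add: unf)
  show "r' * d1 + s' * d2 = d2 * d1" using A[of F1 E2 E1 F1] by (simp add: unf)
  show "u * d1 + w * d2 = d2 * d2" using A[of F1 E2 E2 F1] by (simp add: unf)
  show "b1 * b1 = b1 * d1" using P[where i = E1 and j = E1 and k = F1 and l = F1] by (simp add: unf)
  show "b1 * b2 = b1 * d2" using P[where i = E1 and j = E2 and k = F1 and l = F1] by (simp add: unf)
  show "b2 * b1 = b2 * d1" using P[where i = E2 and j = E1 and k = F1 and l = F1] by (simp add: unf)
  show "b2 * b2 = b2 * d2" using P[where i = E2 and j = E2 and k = F1 and l = F1] by (simp add: unf)
  \<comment> \<open>For two odd factors the perm identity reads \<open>e (f f) = - e (f f)\<close>,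
    so \<open>f f\<close> is killed by every even element on the left.\<close>
  have neg: "x = 0" if "x = - x" for x :: complex using that by simp
  show et: "t1 * p + t2 * r = 0" "t1 * q + t2 * s = 0" "t1 * r' + t2 * u = 0" "t1 * s' + t2 * w = 0"
    by (rule neg; use P[where i = E1 and j = F1 and k = F1 and l = E1]
      P[where i = E1 and j = F1 and k = F1 and l = E2] P[where i = E2 and j = F1 and k = F1 and l = E1]
      P[where i = E2 and j = F1 and k = F1 and l = E2] in \<open>simp add: UNIV_idx\<close>)+
  show "t1 * p + t2 * r' = d1 * t1" using A[of F1 F1 E1 E1] by (simp add: unf)
  show "t1 * q + t2 * s' = d1 * t2" using A[of F1 F1 E1 E2] by (simp add: unf)
  show "t1 * r + t2 * u = d2 * t1" using A[of F1 F1 E2 E1] by (simp add: unf)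
  show "t1 * s + t2 * w = d2 * t2" using A[of F1 F1 E2 E2] by (simp add: unf)
  \<comment> \<open>\<open>(e f) f = e (f f) = 0\<close> gives \<open>b t = 0\<close>.\<close>
  show bt: "b1 * t1 = 0" using A[of E1 F1 F1 E1] et by (simp add: UNIV_idx)
  show bt2: "b1 * t2 = 0" using A[of E1 F1 F1 E2] et by (simp add: UNIV_idx)
  show bt3: "b2 * t1 = 0" using A[of E2 F1 F1 E1] et by (simp add: UNIV_idx)
  show bt4: "b2 * t2 = 0" using A[of E2 F1 F1 E2] et by (simp add: UNIV_idx)
  \<comment> \<open>\<open>f (f e) = f (e f)\<close> carries \<open>b t = 0\<close> over to
    \<open>d t = 0\<close>.\<close>
  show "d1 * t1 = 0" using P[where i = F1 and j = E1 and k = F1 and l = E1] bt by (simp add: UNIV_idx)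
  show "d1 * t2 = 0" using P[where i = F1 and j = E1 and k = F1 and l = E2] bt2 by (simp add: UNIV_idx)
  show "d2 * t1 = 0" using P[where i = F1 and j = E2 and k = F1 and l = E1] bt3 by (simp add: UNIV_idx)
  show "d2 * t2 = 0" using P[where i = F1 and j = E2 and k = F1 and l = E2] bt4 by (simp add: UNIV_idx)
qed

lemma R_PermVar: "R01 \<in> PermVar" "R02 \<in> PermVar" "R04 \<in> PermVar" "R10 \<in> PermVar"
  "R25 \<in> PermVar" "R31 \<in> PermVar" "R33 \<in> PermVar"
  unfolding PermVar_def perm_sc_iff mem_Collect_eq R_mk all_idx
  by (simp_all add: even_sc_mk' UNIV_idx)

section \<open>Isomorphism invariants\<close>

text \<open>This and the next three properties are chosen to separate the seven algebras; by
  bilinearity, commutativity of the even part need only be tested at \<open>e1\<close>,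
  \<open>e2\<close>.\<close>

definition even_commute :: "sc \<Rightarrow> bool" where
  "even_commute c \<longleftrightarrow> c E1 E2 = c E2 E1"

definition odd_square_zero :: "sc \<Rightarrow> bool" where
  "odd_square_zero c \<longleftrightarrow> c F1 F1 E1 = 0 \<and> c F1 F1 E2 = 0"

definition left_zero :: "sc \<Rightarrow> bool" where
  "left_zero c \<longleftrightarrow> c E1 F1 F1 = 0 \<and> c E2 F1 F1 = 0"

definition left_eq_right :: "sc \<Rightarrow> bool" where
  "left_eq_right c \<longleftrightarrow> c E1 F1 F1 = c F1 E1 F1 \<and> c E2 F1 F1 = c F1 E2 F1"

lemma invariants_mk:
  "even_commute (mk p q r s r' s' u w b1 b2 d1 d2 t1 t2) \<longleftrightarrow> r = r' \<and> s = s'"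
  "odd_square_zero (mk p q r s r' s' u w b1 b2 d1 d2 t1 t2) \<longleftrightarrow> t1 = 0 \<and> t2 = 0"
  "left_zero (mk p q r s r' s' u w b1 b2 d1 d2 t1 t2) \<longleftrightarrow> b1 = 0 \<and> b2 = 0"
  "left_eq_right (mk p q r s r' s' u w b1 b2 d1 d2 t1 t2) \<longleftrightarrow> b1 = d1 \<and> b2 = d2"
  unfolding even_commute_def odd_square_zero_def left_zero_def left_eq_right_def fun_eq_iff all_idx
  by auto

lemma invariants_act:
  assumes "grading_preserving M" "grading_preserving N" "even_sc c"
  shows "even_commute c \<Longrightarrow> even_commute (act M N c)"
    "odd_square_zero c \<Longrightarrow> odd_square_zero (act M N c)"
    "left_zero c \<Longrightarrow> left_zero (act M N c)"
    "left_eq_right c \<Longrightarrow> left_eq_right (act M N c)"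
proof -
  have MN: "M E1 F1 = 0" "M E2 F1 = 0" "M F1 E1 = 0" "M F1 E2 = 0"
    "N E1 F1 = 0" "N E2 F1 = 0" "N F1 E1 = 0" "N F1 E2 = 0"
    using assms by (auto simp: grading_preserving_iff)
  show "even_commute (act M N c)" if "even_commute c"
    using that MN assms(3) unfolding even_commute_def even_sc_def all_idx
    by (auto simp: act_def UNIV_idx algebra_simps fun_eq_iff)
  show "odd_square_zero (act M N c)" if "odd_square_zero c"
    using that MN assms(3) unfolding odd_square_zero_def even_sc_def all_idx
    by (auto simp: act_def UNIV_idx)
  show "left_zero (act M N c)" if "left_zero c"
    using that MN assms(3) unfolding left_zero_def even_sc_def all_idx
    by (auto simp: act_def UNIV_idx)
  show "left_eq_right (act M N c)" if "left_eq_right c"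
    using that MN assms(3) unfolding left_eq_right_def even_sc_def all_idx
    by (auto simp: act_def UNIV_idx algebra_simps)
qed

lemma invariants_orbit:
  assumes "d \<in> orbit c" "even_sc c"
  shows "even_commute d \<longleftrightarrow> even_commute c"
    "odd_square_zero d \<longleftrightarrow> odd_square_zero c"
    "left_zero d \<longleftrightarrow> left_zero c"
    "left_eq_right d \<longleftrightarrow> left_eq_right c"
proof -
  obtain M N where MN: "grading_preserving M" "is_inv M N" "d = act M N c"
    using assms(1) by (elim orbitE)
  have N: "grading_preserving N" using grading_preserving_inverse MN by blast
  have ev: "even_sc d" using MN N assms(2) even_sc_act by blast
  have c: "c = act N M d" using act_inverse MN by simp
  note 1 = invariants_act[OF MN(1) N assms(2), folded MN(3)] invariants_act[OF N MN(1) ev, folded c]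
  show "even_commute d \<longleftrightarrow> even_commute c"
    "odd_square_zero d \<longleftrightarrow> odd_square_zero c"
    "left_zero d \<longleftrightarrow> left_zero c"
    "left_eq_right d \<longleftrightarrow> left_eq_right c" using 1 by blast+
qed

section \<open>Degenerations\<close>

text \<open>The columns are the vectors of a new homogeneous basis: \<open>x1 e1 + x2 e2\<close>,
  \<open>y1 e1 + y2 e2\<close> and \<open>l f\<close>.\<close>

definition cols :: "complex \<Rightarrow> complex \<Rightarrow> complex \<Rightarrow> complex \<Rightarrow> complex \<Rightarrow> idx \<Rightarrow> idx \<Rightarrow> complex" where
  "cols x1 x2 y1 y2 l = (\<lambda>i j. case i of
     E1 \<Rightarrow> (case j of E1 \<Rightarrow> x1 | E2 \<Rightarrow> y1 | F1 \<Rightarrow> 0)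
   | E2 \<Rightarrow> (case j of E1 \<Rightarrow> x2 | E2 \<Rightarrow> y2 | F1 \<Rightarrow> 0)
   | F1 \<Rightarrow> (case j of E1 \<Rightarrow> 0 | E2 \<Rightarrow> 0 | F1 \<Rightarrow> l))"

lemma cols_simps [simp]:
  "cols x1 x2 y1 y2 l E1 E1 = x1" "cols x1 x2 y1 y2 l E2 E1 = x2" "cols x1 x2 y1 y2 l F1 E1 = 0"
  "cols x1 x2 y1 y2 l E1 E2 = y1" "cols x1 x2 y1 y2 l E2 E2 = y2" "cols x1 x2 y1 y2 l F1 E2 = 0"
  "cols x1 x2 y1 y2 l E1 F1 = 0" "cols x1 x2 y1 y2 l E2 F1 = 0" "cols x1 x2 y1 y2 l F1 F1 = l"
  by (simp_all add: cols_def)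

lemma grading_preserving_cols: "grading_preserving (cols x1 x2 y1 y2 l)"
  by (simp add: grading_preserving_iff)

text \<open>The condition says that the columns of \<open>M\<close> multiply under \<open>c'\<close>
  as the standard basis does under \<open>c\<close>; stated this way, no inverse matrix has to be
  computed.\<close>

lemma orbit_basisI:
  assumes "grading_preserving M" "detm M \<noteq> 0"
    and "\<And>i j k. (\<Sum>p\<in>UNIV. \<Sum>q\<in>UNIV. M p i * M q j * c' p q k) = (\<Sum>r\<in>UNIV. M k r * c i j r)"
  shows "c' \<in> orbit c"
proof -
  obtain N where N: "is_inv M N" using is_inv_adjm assms by blast
  \<comment> \<open>The pairs \<open>(idm, M)\<close> and \<open>(M, idm)\<close> are not mutually
    inverse; \<open>act\<close> only serves to write both sides as bilinear maps to which
    \<open>mult_act\<close> applies.\<close>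
  have "act idm M c' = act M idm c"
  proof (intro ext)
    fix i j k
    have "act idm M c' i j k = (\<Sum>p\<in>UNIV. \<Sum>q\<in>UNIV. M p i * M q j * c' p q k)"
      unfolding act_def idm_def by (cases k) (simp_all add: UNIV_idx)
    moreover have "act M idm c i j k = (\<Sum>r\<in>UNIV. M k r * c i j r)"
      unfolding act_def idm_def by (cases i; cases j) (simp_all add: UNIV_idx)
    ultimately show "act idm M c' i j k = act M idm c i j k" using assms(3) by simp
  qed
  then have eq: "mult c' (lin M x) (lin M y) = lin M (mult c x y)" for x y
    using mult_act[of idm M c' x y] mult_act[of M idm c x y] by (simp add: lin_idm)
  have "act M N c = c'"
    by (rule mult_eqI) (simp add: mult_act flip: eq, simp add: lin_is_inv[OF N])
  then show ?thesis using orbit_actI[OF assms(1) N, of c] by simp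
qed

lemma orbit_colsI:
  assumes "(x1 * y2 - y1 * x2) * l \<noteq> 0"
    and "\<forall>i j k. (\<Sum>p\<in>UNIV. \<Sum>q\<in>UNIV. cols x1 x2 y1 y2 l p i * cols x1 x2 y1 y2 l q j * c' p q k) =
      (\<Sum>r\<in>UNIV. cols x1 x2 y1 y2 l k r * c i j r)"
  shows "c' \<in> orbit c"
  by (rule orbit_basisI[OF grading_preserving_cols])
    (use assms(1) in \<open>simp add: detm_def\<close>, use assms(2) in blast)

lemma poly_fun_mk:
  assumes "poly_fun p" "poly_fun q" "poly_fun r" "poly_fun s" "poly_fun r'" "poly_fun s'" "poly_fun u"
    "poly_fun w" "poly_fun b1" "poly_fun b2" "poly_fun d1" "poly_fun d2" "poly_fun t1" "poly_fun t2"
  shows "poly_fun (\<lambda>t. mk (p t) (q t) (r t) (s t) (r' t) (s' t) (u t) (w t)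
    (b1 t) (b2 t) (d1 t) (d2 t) (t1 t) (t2 t) i j k)"
  using assms by (cases i; cases j; cases k) simp_all

lemma zclosure_orbit_trans:
  assumes "c \<in> zclosure (orbit d)" "d \<in> orbit e"
  shows "c \<in> zclosure (orbit e)"
  using assms orbit_trans zclosure_least[OF zclosed_zclosure] subset_zclosure by (meson subset_iff)

subsection \<open>Commutative even part and zero odd product\<close>

text \<open>The even part has the ideal spanned by \<open>e2\<close>; its characters are \<open>(s, w)\<close> and \<open>(p, 0)\<close>,
  and the bimodule structure on the odd part is given by multiples of these.\<close>
definition comm_alg :: "complex \<Rightarrow> complex \<Rightarrow> complex \<Rightarrow> complex \<Rightarrow>
    complex \<Rightarrow> complex \<Rightarrow> complex \<Rightarrow> complex \<Rightarrow> sc" where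
  "comm_alg p q s w \<beta>1 \<beta>2 \<delta>1 \<delta>2 =
    mk p q 0 s 0 s 0 w (\<beta>1 * s + \<beta>2 * p) (\<beta>1 * w) (\<delta>1 * s + \<delta>2 * p) (\<delta>1 * w) 0 0"

text \<open>This is \<open>comm_alg 1 0 0 1\<close>. The indices appear swapped because the first
  character \<open>(s, w) = (0, 1)\<close> is supported on \<open>e2\<close> and the second,
  \<open>(p, 0) = (1, 0)\<close>, on \<open>e1\<close>.\<close>

definition diag_alg :: "complex \<Rightarrow> complex \<Rightarrow> complex \<Rightarrow> complex \<Rightarrow> sc" where
  "diag_alg \<beta>1 \<beta>2 \<delta>1 \<delta>2 = mk 1 0 0 0 0 0 0 1 \<beta>2 \<beta>1 \<delta>2 \<delta>1 0 0"

text \<open>The characters \<open>(p, 0)\<close> and \<open>(s, w)\<close> are independent here; the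
  chosen columns are their dual basis, which consists of orthogonal idempotents.\<close>

lemma comm_alg_orbit:
  assumes "p \<noteq> 0" "w \<noteq> 0" "s * s = p * s + q * w"
  shows "comm_alg p q s w \<beta>1 \<beta>2 \<delta>1 \<delta>2 \<in> orbit (diag_alg \<beta>1 \<beta>2 \<delta>1 \<delta>2)"
proof (rule orbit_colsI[where ?x1.0 = "1 / p" and ?x2.0 = "- s / (p * w)" and ?y1.0 = 0 and ?y2.0 = "1 / w" and l = 1])
  have q: "q = (s * s - p * s) / w" using assms by (simp add: field_simps)
  show "\<forall>i j k. (\<Sum>pa\<in>UNIV. \<Sum>q'\<in>UNIV. cols (1 / p) (- s / (p * w)) 0 (1 / w) 1 pa i *
      cols (1 / p) (- s / (p * w)) 0 (1 / w) 1 q' j * comm_alg p q s w \<beta>1 \<beta>2 \<delta>1 \<delta>2 pa q' k) =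
    (\<Sum>r\<in>UNIV. cols (1 / p) (- s / (p * w)) 0 (1 / w) 1 k r * diag_alg \<beta>1 \<beta>2 \<delta>1 \<delta>2 i j r)"
    unfolding comm_alg_def diag_alg_def all_idx q
    using assms(1,2) by (simp add: UNIV_idx divide_simps) (simp add: algebra_simps)
qed (use assms in simp)

text \<open>For \<open>w = 0\<close> the relation leaves the branches \<open>s = 0\<close> and
  \<open>s = p\<close>. Each is reached by a curve with \<open>w = \<tau>\<close> along which the
  relation persists.\<close>

lemma comm_alg_zclosure_aux:
  assumes "p \<noteq> 0" "s * s = p * s + q * w"
  shows "comm_alg p q s w \<beta>1 \<beta>2 \<delta>1 \<delta>2 \<in> zclosure (orbit (diag_alg \<beta>1 \<beta>2 \<delta>1 \<delta>2))"
proof (cases "w = 0")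
  case False
  then show ?thesis using comm_alg_orbit[OF assms(1) False assms(2)] subset_zclosure by blast
next
  case True
  then have "s * (s - p) = 0" using assms(2) by (simp add: algebra_simps)
  then consider "s = 0" | "s = p" by auto
  then show ?thesis
  proof cases
    case 1
    \<comment> \<open>With \<open>w = \<tau>\<close> and \<open>s = \<tau> * \<sigma>\<close> the
      relation can be divided by \<open>\<tau>\<close> and yields the second argument of the curve;
      \<open>\<sigma>\<close> is then fitted to \<open>q\<close> at
      \<open>\<tau> = 0\<close>.\<close>
    define \<sigma> where "\<sigma> = - q / p"
    define \<gamma> where "\<gamma> \<tau> = comm_alg p (\<sigma> * (\<tau> * \<sigma> - p)) (\<tau> * \<sigma>) \<tau> \<beta>1 \<beta>2 \<delta>1 \<delta>2" for \<tau>
    have "\<gamma> 0 \<in> zclosure (orbit (diag_alg \<beta>1 \<beta>2 \<delta>1 \<delta>2))"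
    proof (rule zclosure_curve[where B = "{0}"])
      show "poly_fun (\<lambda>t. \<gamma> t i j k)" for i j k
        unfolding \<gamma>_def comm_alg_def by (intro poly_fun_mk poly_fun_intros)
      show "\<gamma> t \<in> zclosure (orbit (diag_alg \<beta>1 \<beta>2 \<delta>1 \<delta>2))" if "t \<notin> {0}" for t
        unfolding \<gamma>_def
        by (rule subsetD[OF subset_zclosure], rule comm_alg_orbit)
          (use assms(1) that in \<open>auto simp: algebra_simps\<close>)
    qed simp
    moreover have "\<gamma> 0 = comm_alg p q s w \<beta>1 \<beta>2 \<delta>1 \<delta>2"
      unfolding \<gamma>_def 1 True \<sigma>_def using assms(1) by simp
    ultimately show ?thesis by simp
  next
    case 2
    \<comment> \<open>The same with \<open>s - p = \<tau> * \<sigma>\<close>, for which the relation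
      asks for \<open>s * \<sigma>\<close> in place of \<open>q\<close>.\<close>
    define \<sigma> where "\<sigma> = q / p"
    define \<gamma> where "\<gamma> \<tau> = comm_alg p ((p + \<tau> * \<sigma>) * \<sigma>) (p + \<tau> * \<sigma>) \<tau> \<beta>1 \<beta>2 \<delta>1 \<delta>2" for \<tau>
    have "\<gamma> 0 \<in> zclosure (orbit (diag_alg \<beta>1 \<beta>2 \<delta>1 \<delta>2))"
    proof (rule zclosure_curve[where B = "{0}"])
      show "poly_fun (\<lambda>t. \<gamma> t i j k)" for i j k
        unfolding \<gamma>_def comm_alg_def by (intro poly_fun_mk poly_fun_intros)
      show "\<gamma> t \<in> zclosure (orbit (diag_alg \<beta>1 \<beta>2 \<delta>1 \<delta>2))" if "t \<notin> {0}" for t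
        unfolding \<gamma>_def
        by (rule subsetD[OF subset_zclosure], rule comm_alg_orbit)
          (use assms(1) that in \<open>auto simp: algebra_simps\<close>)
    qed simp
    moreover have "\<gamma> 0 = comm_alg p q s w \<beta>1 \<beta>2 \<delta>1 \<delta>2"
      unfolding \<gamma>_def 2 True \<sigma>_def using assms(1) by simp
    ultimately show ?thesis by simp
  qed
qed

text \<open>The parameters \<open>w\<close> and \<open>p\<close> are made nonzero one after the
  other, which is possible because \<open>zclosure_curve\<close> accepts curves in the closure
  instead of the orbit.\<close>

lemma comm_alg_zclosure:
  assumes "s * s = p * s + q * w"
  shows "comm_alg p q s w \<beta>1 \<beta>2 \<delta>1 \<delta>2 \<in> zclosure (orbit (diag_alg \<beta>1 \<beta>2 \<delta>1 \<delta>2))"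
proof (cases "p = 0")
  case False
  then show ?thesis using comm_alg_zclosure_aux assms by blast
next
  case True
  \<comment> \<open>Keeps the relation true when \<open>p\<close> becomes \<open>\<tau>\<close>. For
    \<open>w = 0\<close> it forces \<open>s = 0\<close> and no longer restricts
    \<open>q\<close>.\<close>
  define f where "f \<tau> = (if w = 0 then q else s * (s - \<tau>) / w)" for \<tau>
  define \<gamma> where "\<gamma> \<tau> = comm_alg \<tau> (f \<tau>) s w \<beta>1 \<beta>2 \<delta>1 \<delta>2" for \<tau>
  have s: "s = 0" if "w = 0" using that True assms by simp
  have "\<gamma> 0 \<in> zclosure (orbit (diag_alg \<beta>1 \<beta>2 \<delta>1 \<delta>2))"
  proof (rule zclosure_curve[where B = "{0}"])
    have "poly_fun (\<lambda>t. f t)"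
    proof (cases "w = 0")
      case False
      then show ?thesis
        unfolding f_def divide_inverse by (simp, intro poly_fun_intros)
    qed (simp add: f_def)
    then show "poly_fun (\<lambda>t. \<gamma> t i j k)" for i j k
      unfolding \<gamma>_def comm_alg_def by (intro poly_fun_mk poly_fun_intros)
    show "\<gamma> t \<in> zclosure (orbit (diag_alg \<beta>1 \<beta>2 \<delta>1 \<delta>2))" if "t \<notin> {0}" for t
      unfolding \<gamma>_def
      by (rule comm_alg_zclosure_aux)
        (use s that in \<open>auto simp: f_def field_simps\<close>)
  qed simp
  moreover have "f 0 = q" using assms True unfolding f_def by (auto simp: field_simps)
  then have "\<gamma> 0 = comm_alg p q s w \<beta>1 \<beta>2 \<delta>1 \<delta>2"
    unfolding \<gamma>_def True by simp
  ultimately show ?thesis by simp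
qed

lemma diag_alg_orbits:
  "diag_alg 0 0 0 0 \<in> orbit R01"
  "diag_alg 0 1 0 1 \<in> orbit R02" "diag_alg 1 0 1 0 \<in> orbit R02"
  "diag_alg 0 0 0 1 \<in> orbit R04" "diag_alg 0 0 1 0 \<in> orbit R04"
proof -
  show "diag_alg 0 0 0 0 \<in> orbit R01" "diag_alg 0 1 0 1 \<in> orbit R02" "diag_alg 0 0 0 1 \<in> orbit R04"
    using orbit_refl unfolding diag_alg_def R_mk by simp_all
  show "diag_alg 1 0 1 0 \<in> orbit R02"
    by (rule orbit_colsI[where ?x1.0 = 0 and ?x2.0 = 1 and ?y1.0 = 1 and ?y2.0 = 0 and l = 1])
      (simp_all add: diag_alg_def R_mk all_idx UNIV_idx)
  show "diag_alg 0 0 1 0 \<in> orbit R04"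
    by (rule orbit_colsI[where ?x1.0 = 0 and ?x2.0 = 1 and ?y1.0 = 1 and ?y2.0 = 0 and l = 1])
      (simp_all add: diag_alg_def R_mk all_idx UNIV_idx)
qed

text \<open>A character of the algebra is zero, \<open>(s, w)\<close> or \<open>(p, 0)\<close>, and the left and right actions on the
  odd part are such characters that agree unless the left one is zero.\<close>
lemma PermVar_comm_algE:
  assumes "mk p q 0 s 0 s 0 w b1 b2 d1 d2 0 0 \<in> PermVar"
  obtains \<beta>1 \<beta>2 \<delta>1 \<delta>2 where
    "(\<beta>1, \<beta>2, \<delta>1, \<delta>2) \<in> {(0,0,0,0), (0,1,0,1), (1,0,1,0), (0,0,0,1), (0,0,1,0)}"
    "mk p q 0 s 0 s 0 w b1 b2 d1 d2 0 0 = comm_alg p q s w \<beta>1 \<beta>2 \<delta>1 \<delta>2"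
    "s * s = p * s + q * w"
proof -
  note d = PermVar_mk_d[OF assms] and bd = PermVar_mk_bd[OF assms]
  have s: "s * s = p * s + q * w" using PermVar_mk_assoc[OF assms] by simp
  have "\<exists>\<delta>1 \<delta>2. (\<delta>1, \<delta>2) \<in> {(0,0), (0,1), (1,0)} \<and> d1 = \<delta>1 * s + \<delta>2 * p \<and> d2 = \<delta>1 * w"
  proof (cases "d2 = 0")
    case True
    then have "d1 * (d1 - p) = 0" using d(1) by algebra
    then consider "d1 = 0" | "d1 = p" unfolding mult_eq_0_iff right_minus_eq by blast
    then show ?thesis
    proof cases
      case 1
      then show ?thesis using True by (intro exI[of _ 0]) simp
    next
      case 2
      then show ?thesis using True by (intro exI[of _ 0] exI[of _ 1]) simp
    qed
  next
    case False
    then have "d1 = s" "d2 = w" using d(2,4) by simp_all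
    then show ?thesis by (intro exI[of _ 1] exI[of _ 0]) simp
  qed
  then obtain \<delta>1 \<delta>2 where dd: "(\<delta>1, \<delta>2) \<in> {(0,0), (0,1), (1,0)}" "d1 = \<delta>1 * s + \<delta>2 * p" "d2 = \<delta>1 * w"
    by blast
  have "b1 = 0 \<and> b2 = 0 \<or> b1 = d1 \<and> b2 = d2" using bd by auto
  then show ?thesis
  proof
    assume "b1 = 0 \<and> b2 = 0"
    then show ?thesis
      by (intro that[of 0 0 \<delta>1 \<delta>2]) (use dd s in \<open>auto simp: comm_alg_def\<close>)
  next
    assume "b1 = d1 \<and> b2 = d2"
    then show ?thesis
      by (intro that[of \<delta>1 \<delta>2 \<delta>1 \<delta>2]) (use dd s in \<open>auto simp: comm_alg_def\<close>)
  qed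
qed

text \<open>\<open>act N M c\<close> is \<open>c\<close> written in the basis of the columns of
  \<open>M\<close>: a product of two columns that is a multiple of column \<open>m\<close> has no
  other component there.\<close>

lemma act_column:
  assumes "is_inv M N" "\<And>r. (\<Sum>a\<in>UNIV. \<Sum>b\<in>UNIV. M a i * M b j * c a b r) = \<mu> * M r m"
  shows "act N M c i j k = (if k = m then \<mu> else 0)"
proof -
  have "act N M c i j k = \<mu> * (\<Sum>r\<in>UNIV. N k r * M r m)"
    unfolding act_def assms(2) by (simp add: sum_distrib_left algebra_simps)
  then show ?thesis using assms(1) unfolding is_inv_def by simp
qed

text \<open>The first three hypotheses are the vanishing minors of the coefficient rows of two
  binary quadratic forms. If the first row is nonzero, the second form is a multiple of the
  first.\<close>

lemma common_root:
  fixes q r s u x y :: complex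
  assumes "q * u = r * s" "q * y = s * x" "r * y = u * x"
    and "q \<noteq> 0 \<or> x \<noteq> 0 \<or> r \<noteq> 0" "- q * a * a + x * a * b + r * b * b = 0"
  shows "- s * a * a + y * a * b + u * b * b = 0"
proof -
  have "q * (- s * a * a + y * a * b + u * b * b) = s * (- q * a * a + x * a * b + r * b * b)"
    "x * (- s * a * a + y * a * b + u * b * b) = y * (- q * a * a + x * a * b + r * b * b)"
    "r * (- s * a * a + y * a * b + u * b * b) = u * (- q * a * a + x * a * b + r * b * b)"
    using assms(1-3) by algebra+
  then show ?thesis using assms(4,5) by auto
qed

text \<open>A nonzero first form passes its root on to the second; a zero first form admits any root
  of the second.\<close>

lemma exists_common_root:
  fixes q r s u x y :: complex
  assumes "q * u = r * s" "q * y = s * x" "r * y = u * x"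
  obtains a b where "a \<noteq> 0 \<or> b \<noteq> 0" "- q * a * a + x * a * b + r * b * b = 0"
    "- s * a * a + y * a * b + u * b * b = 0"
proof -
  have root: "\<exists>a b. (a \<noteq> 0 \<or> b \<noteq> 0) \<and> - q * a * a + x * a * b + r * b * b = 0" for q x r :: complex
  proof (cases "q = 0")
    case True
    then show ?thesis by (intro exI[of _ 1] exI[of _ 0]) simp
  next
    case False
    \<comment> \<open>The homogeneous quadratic formula: the root is
      \<open>(x + z : 2 * q)\<close>.\<close>
    define z where "z = csqrt (x\<^sup>2 + 4 * q * r)"
    have z: "z * z = x * x + 4 * q * r"
      using power2_csqrt[of "x\<^sup>2 + 4 * q * r"] unfolding z_def by (simp add: power2_eq_square)
    have "- q * (x + z) * (x + z) + x * (x + z) * (2 * q) + r * (2 * q) * (2 * q) = q * (x * x + 4 * q * r - z * z)"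
      by (simp add: algebra_simps)
    then show ?thesis using z False by (intro exI[of _ "x + z"] exI[of _ "2 * q"]) simp
  qed
  show ?thesis
  proof (cases "q = 0 \<and> x = 0 \<and> r = 0")
    case True
    then show ?thesis using root[of s y u] that by auto
  next
    case False
    obtain a b where ab: "a \<noteq> 0 \<or> b \<noteq> 0" and Q: "- q * a * a + x * a * b + r * b * b = 0"
      using root by blast
    then show ?thesis using that[OF ab Q] common_root[OF assms _ Q] False by blast
  qed
qed

text \<open>A vector at which both quadratic forms vanish is a common eigenvector of the multiplications
  by \<open>e1\<close> and \<open>e2\<close>.\<close>
lemma common_eigenvector:
  fixes a b p q r s :: complex
  assumes "a \<noteq> 0 \<or> b \<noteq> 0" "- q * a * a + (p - s) * a * b + r * b * b = 0"
  obtains \<mu> where "p * a + r * b = \<mu> * a" "q * a + s * b = \<mu> * b"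
proof (cases "a = 0")
  case True
  then have "r = 0" "b \<noteq> 0" using assms by auto
  then show ?thesis using that[of s] True by simp
next
  case False
  have "(q * a + s * b) * a = (p * a + r * b) * b" using assms(2) by algebra
  then show ?thesis using that[of "(p * a + r * b) / a"] False by (simp add: field_simps)
qed

text \<open>A common eigenvector spans an ideal of the even part: an even element with coordinates
  \<open>x\<close>, \<open>y\<close> acts on it by the scalar
  \<open>x * \<mu> + y * \<nu>\<close>.\<close>

lemma act_eigenvector_column:
  assumes ab: "a \<noteq> 0 \<or> b \<noteq> 0" "- q * a * a + (p - s) * a * b + r * b * b = 0"
      "- s * a * a + (r - w) * a * b + u * b * b = 0"
    and M: "grading_preserving M" "is_inv M N" "M E1 m = a" "M E2 m = b" "m \<noteq> F1"
    and "e \<noteq> F1" "k \<noteq> m"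
  shows "act N M (mk p q r s r s u w b1 b2 d1 d2 t1 t2) e m k = 0"
proof -
  obtain \<mu> where mu: "p * a + r * b = \<mu> * a" "q * a + s * b = \<mu> * b"
    using common_eigenvector[OF ab(1,2)] .
  obtain \<nu> where nu: "r * a + u * b = \<nu> * a" "s * a + w * b = \<nu> * b"
    using common_eigenvector[OF ab(1,3)] .
  note M0 = M(1)[unfolded grading_preserving_iff]
  have *: "x * (p * a + r * b) + y * (r * a + u * b) = (x * \<mu> + y * \<nu>) * a"
    "x * (q * a + s * b) + y * (s * a + w * b) = (x * \<mu> + y * \<nu>) * b" for x y
    unfolding mu nu by (simp_all add: algebra_simps)
  have "(\<Sum>i\<in>UNIV. \<Sum>j\<in>UNIV. M i e * M j m * mk p q r s r s u w b1 b2 d1 d2 t1 t2 i j k)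
      = (M E1 e * \<mu> + M E2 e * \<nu>) * M k m" for k
    using *[of "M E1 e" "M E2 e"] M0 M(3,4,5) assms(9)
    by (cases k; cases e; cases m) (simp_all add: UNIV_idx algebra_simps)
  from act_column[OF M(2) this] show ?thesis using assms(10) by simp
qed

lemma PermVar_mkE:
  assumes "c \<in> PermVar"
  obtains p q r s r' s' u w b1 b2 d1 d2 t1 t2 where "c = mk p q r s r' s' u w b1 b2 d1 d2 t1 t2"
  using assms even_sc_mk unfolding PermVar_def by blast

text \<open>Commuting 2 by 2 matrices have proportional parts modulo scalars. For multiplication by
  \<open>e1\<close> and \<open>e2\<close> these are \<open>(q, p - s, r)\<close> and
  \<open>(s, r - w, u)\<close>.\<close>

lemma comm_minors:
  assumes "mk p q r s r s u w b1 b2 d1 d2 t1 t2 \<in> PermVar"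
  shows "q * u = r * s" "q * (r - w) = s * (p - s)" "r * (r - w) = u * (p - s)"
  using PermVar_mk_assoc[OF assms] by algebra+

text \<open>The multiplications by even elements commute, so they have a common eigenvector.\<close>
lemma comm_orbit_ideal:
  assumes "mk p q r s r s u w b1 b2 d1 d2 0 0 \<in> PermVar"
  obtains p' q' s' w' b1' b2' d1' d2' where
    "mk p' q' 0 s' 0 s' 0 w' b1' b2' d1' d2' 0 0 \<in> PermVar"
    "mk p q r s r s u w b1 b2 d1 d2 0 0 \<in> orbit (mk p' q' 0 s' 0 s' 0 w' b1' b2' d1' d2' 0 0)"
proof -
  let ?c = "mk p q r s r s u w b1 b2 d1 d2 0 0"
  obtain a b where ab: "a \<noteq> 0 \<or> b \<noteq> 0" "- q * a * a + (p - s) * a * b + r * b * b = 0"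
      "- s * a * a + (r - w) * a * b + u * b * b = 0"
    using exists_common_root[OF comm_minors[OF assms]] .
  obtain x y where xy: "x * b - a * y \<noteq> 0"
    using ab(1) by (metis diff_zero diff_0 mult_zero_left mult_zero_right mult_1_right mult_1 neg_equal_0_iff_equal)
  \<comment> \<open>The eigenvector becomes the second basis vector, so that the new
    \<open>e2\<close> spans an ideal as \<open>comm_alg\<close> requires; \<open>(x, y)\<close> is
    any complement.\<close>
  define M where "M = cols x y a b 1"
  have M: "grading_preserving M" unfolding M_def by (rule grading_preserving_cols)
  moreover have "detm M \<noteq> 0" using xy by (simp add: M_def detm_def)
  ultimately obtain N where N: "is_inv M N" using is_inv_adjm by blast
  have N': "grading_preserving N" using grading_preserving_inverse M N by blast
  define c' where "c' = act N M ?c"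
  have P: "c' \<in> PermVar" unfolding c'_def using PermVar_act[OF N' is_inv_sym[OF N] assms] .
  have orb: "?c \<in> orbit c'" unfolding c'_def
    using orbit_actI[OF N' is_inv_sym[OF N]] orbit_sym by blast
  have ev: "even_sc ?c" by (rule even_sc_mk')
  have "c' E1 E2 E1 = 0" "c' E2 E2 E1 = 0"
    unfolding c'_def by (rule act_eigenvector_column[OF ab M N]; simp add: M_def)+
  moreover have "even_commute c'" "odd_square_zero c'"
    unfolding c'_def using invariants_act[OF N' M ev] by (auto simp: invariants_mk)
  ultimately have "c' = mk (c' E1 E1 E1) (c' E1 E1 E2) 0 (c' E1 E2 E2) 0 (c' E1 E2 E2) 0
      (c' E2 E2 E2) (c' E1 F1 F1) (c' E2 F1 F1) (c' F1 E1 F1) (c' F1 E2 F1) 0 0"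
    using even_sc_mk[of c'] P unfolding PermVar_def even_commute_def odd_square_zero_def by simp
  then show ?thesis using that P orb by metis
qed

lemma comm_zclosure:
  assumes "mk p q r s r s u w b1 b2 d1 d2 0 0 \<in> PermVar"
  shows "\<exists>R\<in>{R01, R02, R04}. mk p q r s r s u w b1 b2 d1 d2 0 0 \<in> zclosure (orbit R)"
proof -
  obtain p' q' s' w' b1' b2' d1' d2' where
    *: "mk p' q' 0 s' 0 s' 0 w' b1' b2' d1' d2' 0 0 \<in> PermVar"
    "mk p q r s r s u w b1 b2 d1 d2 0 0 \<in> orbit (mk p' q' 0 s' 0 s' 0 w' b1' b2' d1' d2' 0 0)"
    using comm_orbit_ideal[OF assms] .
  obtain \<beta>1 \<beta>2 \<delta>1 \<delta>2 where
    1: "(\<beta>1, \<beta>2, \<delta>1, \<delta>2) \<in> {(0,0,0,0), (0,1,0,1), (1,0,1,0), (0,0,0,1), (0,0,1,0)}"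
    and 2: "mk p' q' 0 s' 0 s' 0 w' b1' b2' d1' d2' 0 0 = comm_alg p' q' s' w' \<beta>1 \<beta>2 \<delta>1 \<delta>2"
    and 3: "s' * s' = p' * s' + q' * w'"
    using PermVar_comm_algE[OF *(1)] .
  have 4: "\<exists>R\<in>{R01, R02, R04}. diag_alg \<beta>1 \<beta>2 \<delta>1 \<delta>2 \<in> orbit R"
    using 1 diag_alg_orbits by auto
  have "mk p q r s r s u w b1 b2 d1 d2 0 0 \<in> zclosure (orbit (diag_alg \<beta>1 \<beta>2 \<delta>1 \<delta>2))"
    using zclosure_orbit_act[OF comm_alg_zclosure[OF 3]] *(2) unfolding 2 .
  then show ?thesis using 4 zclosure_orbit_trans by blast
qed

subsection \<open>Nonzero odd product\<close>

text \<open>The product \<open>x y = \<lambda>(x) \<lambda>(y) v\<close> of the even part, where \<open>\<lambda>\<close> vanishes at the odd square \<open>t\<close>.\<close>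
definition rank1_alg :: "complex \<Rightarrow> complex \<Rightarrow> complex \<Rightarrow> complex \<Rightarrow> sc" where
  "rank1_alg v1 v2 t1 t2 = mk (t2 * t2 * v1) (t2 * t2 * v2) (- t1 * t2 * v1) (- t1 * t2 * v2)
    (- t1 * t2 * v1) (- t1 * t2 * v2) (t1 * t1 * v1) (t1 * t1 * v2) 0 0 0 0 t1 t2"

text \<open>Since \<open>t\<close> is nonzero, both odd actions vanish, and then \<open>t\<close>
  annihilates the even part from both sides. The even product factors through the line
  \<open>V0 / t\<close>, on which \<open>\<lambda> = (t2, - t1)\<close> is a coordinate.\<close>

lemma PermVar_rank1_algE:
  assumes "mk p q r s r' s' u w b1 b2 d1 d2 t1 t2 \<in> PermVar" "t1 \<noteq> 0 \<or> t2 \<noteq> 0"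
  obtains v1 v2 where "mk p q r s r' s' u w b1 b2 d1 d2 t1 t2 = rank1_alg v1 v2 t1 t2"
proof -
  have 0: "b1 = 0" "b2 = 0" "d1 = 0" "d2 = 0" using PermVar_mk_bt[OF assms(1)] assms(2) by auto
  note e = PermVar_mk_et[OF assms(1)] PermVar_mk_te[OF assms(1)]
  have e': "t1 * p = - (t2 * r)" "t1 * q = - (t2 * s)" "t1 * r' = - (t2 * u)" "t1 * s' = - (t2 * w)"
    "t1 * p = - (t2 * r')" "t1 * q = - (t2 * s')" "t1 * r = - (t2 * u)" "t1 * s = - (t2 * w)"
    using e 0 by (auto simp: eq_neg_iff_add_eq_0)
  show ?thesis
  proof (cases "t2 = 0")
    case True
    then have "p = 0" "q = 0" "r = 0" "s = 0" "r' = 0" "s' = 0" using e' assms(2) by auto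
    then show ?thesis
      using that[of "u / (t1 * t1)" "w / (t1 * t1)"] True assms(2) 0 by (simp add: rank1_alg_def)
  next
    case False
    have r: "r = - t1 * p / t2" "s = - t1 * q / t2" "r' = - t1 * p / t2" "s' = - t1 * q / t2"
      using e' False by (simp_all add: field_simps)
    have u: "u = - t1 * r / t2" "w = - t1 * s / t2" using e' False by (simp_all add: field_simps)
    show ?thesis
      by (rule that[of "p / (t2 * t2)" "q / (t2 * t2)"])
        (use False in \<open>simp add: rank1_alg_def u r 0 mult.assoc\<close>)
  qed
qed

lemma rank1_alg_orbit:
  assumes "t2 * v1 - t1 * v2 \<noteq> 0"
  shows "rank1_alg v1 v2 t1 t2 \<in> orbit R10"
proof -
  \<comment> \<open>\<open>\<kappa>\<close> is \<open>\<lambda>(v)\<close>. As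
    \<open>v v = \<kappa>^2 v\<close>, the vector \<open>v / \<kappa>^2\<close> is idempotent; with
    \<open>t\<close> as second basis vector it gives the table of \<open>R10\<close>.\<close>
  define \<kappa> where "\<kappa> = t2 * v1 - t1 * v2"
  have nz: "\<kappa> \<noteq> 0" using assms \<kappa>_def by simp
  define x1 x2 where "x1 = v1 / \<kappa>\<^sup>2" and "x2 = v2 / \<kappa>\<^sup>2"
  have l: "t2 * x1 - t1 * x2 = 1 / \<kappa>"
  proof -
    have "t2 * x1 - t1 * x2 = \<kappa> / \<kappa>\<^sup>2"
      unfolding x1_def x2_def by (simp add: \<kappa>_def diff_divide_distrib)
    then show ?thesis using nz by (simp add: power2_eq_square)
  qed
  have v: "v1 = x1 * \<kappa>\<^sup>2" "v2 = x2 * \<kappa>\<^sup>2" unfolding x1_def x2_def using nz by simp_all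
  have l': "(t2 * x1 - t1 * x2)\<^sup>2 * \<kappa>\<^sup>2 = 1" unfolding l using nz by (simp add: field_simps)
  show ?thesis
  proof (rule orbit_colsI[where ?x1.0 = x1 and ?x2.0 = x2 and ?y1.0 = t1 and ?y2.0 = t2 and l = 1])
    show "(x1 * t2 - t1 * x2) * 1 \<noteq> 0" using l nz by (simp add: mult.commute)
    have "x1 * x1 * (t2 * t2 * v1) + x1 * x2 * (- t1 * t2 * v1) + (x2 * x1 * (- t1 * t2 * v1) + x2 * x2 * (t1 * t1 * v1))
      = (t2 * x1 - t1 * x2)\<^sup>2 * \<kappa>\<^sup>2 * x1"
      "x1 * x1 * (t2 * t2 * v2) + x1 * x2 * (- t1 * t2 * v2) + (x2 * x1 * (- t1 * t2 * v2) + x2 * x2 * (t1 * t1 * v2))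
      = (t2 * x1 - t1 * x2)\<^sup>2 * \<kappa>\<^sup>2 * x2"
      unfolding v by (simp_all add: power2_eq_square algebra_simps)
    then show "\<forall>i j k. (\<Sum>p\<in>UNIV. \<Sum>q\<in>UNIV. cols x1 x2 t1 t2 1 p i * cols x1 x2 t1 t2 1 q j * rank1_alg v1 v2 t1 t2 p q k) =
      (\<Sum>r\<in>UNIV. cols x1 x2 t1 t2 1 k r * R10 i j r)"
      unfolding l' all_idx rank1_alg_def R_mk by (simp add: UNIV_idx algebra_simps)
  qed
qed

lemma rank1_alg_zclosure:
  assumes "t1 \<noteq> 0 \<or> t2 \<noteq> 0"
  shows "rank1_alg v1 v2 t1 t2 \<in> zclosure (orbit R10)"
proof (cases "t2 * v1 - t1 * v2 = 0")
  case False
  then show ?thesis using rank1_alg_orbit subset_zclosure by blast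
next
  case True
  \<comment> \<open>Moves \<open>v\<close> out of the kernel of \<open>\<lambda>\<close>, along
    \<open>e1\<close> if \<open>t2\<close> is nonzero and along \<open>e2\<close> otherwise, when
    \<open>t1\<close> is nonzero.\<close>
  define \<gamma> where "\<gamma> \<tau> = rank1_alg (v1 + \<tau> * (if t2 = 0 then 0 else 1)) (v2 + \<tau> * (if t2 = 0 then 1 else 0)) t1 t2" for \<tau>
  have "\<gamma> 0 \<in> zclosure (orbit R10)"
  proof (rule zclosure_curve[where B = "{0}"])
    show "poly_fun (\<lambda>t. \<gamma> t i j k)" for i j k
      unfolding \<gamma>_def rank1_alg_def by (intro poly_fun_mk poly_fun_intros)
    show "\<gamma> t \<in> zclosure (orbit R10)" if "t \<notin> {0}" for t
      unfolding \<gamma>_def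
      by (rule subsetD[OF subset_zclosure], rule rank1_alg_orbit)
        (use assms True that in \<open>auto simp: algebra_simps\<close>)
  qed simp
  then show ?thesis by (simp add: \<gamma>_def)
qed

subsection \<open>Noncommutative even part\<close>

text \<open>The product \<open>x y = l(y) x\<close> of the even part.\<close>
definition left_alg :: "complex \<Rightarrow> complex \<Rightarrow> complex \<Rightarrow> complex \<Rightarrow> sc" where
  "left_alg l1 l2 \<beta> \<delta> = mk l1 0 l2 0 0 l1 0 l2 (\<beta> * l1) (\<beta> * l2) (\<delta> * l1) (\<delta> * l2) 0 0"

text \<open>The new first basis vector has \<open>l = 1\<close> and the second spans the kernel of
  \<open>l\<close>.\<close>

lemma left_alg_orbit:
  assumes "l1 \<noteq> 0 \<or> l2 \<noteq> 0"
  shows "left_alg l1 l2 \<beta> \<delta> \<in> orbit (left_alg 1 0 \<beta> \<delta>)"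
proof (cases "l1 = 0")
  case True
  then show ?thesis
    using assms
    by (intro orbit_colsI[where ?x1.0 = 0 and ?x2.0 = "1 / l2" and ?y1.0 = 1 and ?y2.0 = 0 and l = 1])
      (simp_all add: left_alg_def all_idx UNIV_idx)
next
  case False
  then show ?thesis
    by (intro orbit_colsI[where ?x1.0 = "1 / l1" and ?x2.0 = 0 and ?y1.0 = l2 and ?y2.0 = "- l1" and l = 1])
      (simp_all add: left_alg_def all_idx UNIV_idx field_simps)
qed

text \<open>The perm identity makes every left multiplication kill the nonzero commutator of
  \<open>e1\<close> and \<open>e2\<close>. With associativity this leaves
  \<open>x y = l(y) x\<close> for \<open>l = (p, r)\<close>.\<close>

lemma PermVar_noncomm:
  assumes "mk p q r s r' s' u w b1 b2 d1 d2 t1 t2 \<in> PermVar" "\<not> (r = r' \<and> s = s')"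
  shows "q = 0" "s = 0" "r' = 0" "u = 0" "s' = p" "w = r"
proof -
  note a = PermVar_mk_assoc[OF assms(1)] and k = PermVar_mk_perm[OF assms(1)]
  have "q = 0 \<and> s = 0 \<and> r' = 0 \<and> u = 0 \<and> s' = p \<and> w = r"
  proof (cases "s = s'")
    case False
    have q: "q = 0" using a(2) False by auto
    have s: "s = 0" using k(2) q False by auto
    then have s': "s' \<noteq> 0" using False by auto
    have r': "r' = 0" using a(9) q s' by auto
    have u: "u = 0" using k(3) r' s s' by auto
    have p: "s' = p" using a(10) q s' by auto
    have "s' * (r - w) = 0" using k(4) s r' by (simp add: algebra_simps)
    then show ?thesis using q s r' u p s' by auto
  next
    case True
    then have r: "r \<noteq> r'" using assms(2) by auto
    have 1: "p = 0" "q = 0" "r' = 0" "s' = 0" using k True r by auto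
    then have u: "u = 0" using a(13) r by auto
    have "w = r" using a(7) u True 1 r by auto
    then show ?thesis using 1 u True by auto
  qed
  then show "q = 0" "s = 0" "r' = 0" "u = 0" "s' = p" "w = r" by auto
qed

lemma PermVar_left_algE:
  assumes "mk p q r s r' s' u w b1 b2 d1 d2 t1 t2 \<in> PermVar" "\<not> (r = r' \<and> s = s')"
  obtains \<beta> \<delta> where "(\<beta>, \<delta>) \<in> {(0, 0), (0, 1), (1, 1)}" "p \<noteq> 0 \<or> r \<noteq> 0"
    "mk p q r s r' s' u w b1 b2 d1 d2 t1 t2 = left_alg p r \<beta> \<delta>"
proof -
  note 1 = PermVar_noncomm[OF assms]
  have nz: "p \<noteq> 0 \<or> r \<noteq> 0" using 1 assms(2) by auto
  \<comment> \<open>Here \<open>t e_i = l(e_i) t\<close> with \<open>l\<close> nonzero, whereas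
    always \<open>t e_i = d_i t = 0\<close>.\<close>
  have t: "t1 = 0" "t2 = 0" using PermVar_mk_et[OF assms(1)] 1 nz PermVar_mk_te[OF assms(1)] PermVar_mk_bt[OF assms(1)] by auto
  note d = PermVar_mk_d[OF assms(1)] and bd = PermVar_mk_bd[OF assms(1)]
  have d: "d1 = 0 \<and> d2 = 0 \<or> d1 = p \<and> d2 = r" using d 1 by auto
  have b: "b1 = 0 \<and> b2 = 0 \<or> b1 = d1 \<and> b2 = d2" using bd by auto
  show ?thesis
    using d b that[of 0 0] that[of 0 1] that[of 1 1] 1 t nz unfolding left_alg_def by auto
qed

lemma left_alg_R: "R25 = left_alg 1 0 0 0" "R31 = left_alg 1 0 0 1" "R33 = left_alg 1 0 1 1"
  by (simp_all add: R_mk left_alg_def)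

definition Rs :: "sc set" where
  "Rs = {R01, R02, R04, R10, R25, R31, R33}"

lemma PermVar_covered:
  assumes "c \<in> PermVar"
  shows "\<exists>R\<in>Rs. c \<in> zclosure (orbit R)"
proof -
  obtain p q r s r' s' u w b1 b2 d1 d2 t1 t2 where c: "c = mk p q r s r' s' u w b1 b2 d1 d2 t1 t2"
    using PermVar_mkE[OF assms] .
  note P = assms[unfolded c]
  consider "t1 \<noteq> 0 \<or> t2 \<noteq> 0" | "t1 = 0" "t2 = 0" "r = r'" "s = s'" | "\<not> (r = r' \<and> s = s')" by blast
  then show ?thesis
  proof cases
    case 1
    then obtain v1 v2 where "c = rank1_alg v1 v2 t1 t2"
      using PermVar_rank1_algE[OF P] unfolding c by blast
    then show ?thesis using rank1_alg_zclosure[OF 1] unfolding Rs_def by auto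
  next
    case 2
    then have P': "mk p q r s r s u w b1 b2 d1 d2 0 0 \<in> PermVar" using P by simp
    then show ?thesis using comm_zclosure[OF P'] 2 unfolding Rs_def c by auto
  next
    case 3
    obtain \<beta> \<delta> where *: "(\<beta>, \<delta>) \<in> {(0, 0), (0, 1), (1, 1)}" "p \<noteq> 0 \<or> r \<noteq> 0" "c = left_alg p r \<beta> \<delta>"
      using PermVar_left_algE[OF P 3] unfolding c .
    have "c \<in> zclosure (orbit (left_alg 1 0 \<beta> \<delta>))"
      using left_alg_orbit[OF *(2)] subset_zclosure *(3) by auto
    then show ?thesis using *(1) unfolding Rs_def left_alg_R by auto
  qed
qed

section \<open>Open orbits\<close>

text \<open>\<open>f\<close> need not be invariant: the common zeros of all its translates form a
  closed set, and the complement of that set in the variety is exactly the orbit.\<close>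

lemma zopenin_orbitI:
  assumes "c0 \<in> PermVar" "f \<in> polyfun" "f c0 \<noteq> 0"
    and "\<And>c. c \<in> PermVar \<Longrightarrow> f c \<noteq> 0 \<Longrightarrow> c \<in> orbit c0"
  shows "zopenin PermVar (orbit c0)"
proof -
  define G where "G = {(M, N). grading_preserving M \<and> is_inv M N}"
  define Z where "Z = (\<Inter>g\<in>G. {c. f (act (fst g) (snd g) c) = 0})"
  have "zclosed Z" unfolding Z_def
    by (intro zclosed_INT zclosed_zeros[OF polyfun_act[OF assms(2)]])
  moreover have "orbit c0 = PermVar - Z"
  proof (intro set_eqI iffI)
    fix c assume c: "c \<in> orbit c0"
    obtain M N where MN: "grading_preserving M" "is_inv M N" "c = act M N c0" using c by (elim orbitE)
    have "(N, M) \<in> G" unfolding G_def using MN grading_preserving_inverse is_inv_sym by auto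
    moreover have "act N M c = c0" using act_inverse MN by simp
    ultimately have "c \<notin> Z" using assms(3) unfolding Z_def by force
    then show "c \<in> PermVar - Z" using orbit_subset_PermVar[OF assms(1)] c by auto
  next
    fix c assume c: "c \<in> PermVar - Z"
    then obtain M N where MN: "grading_preserving M" "is_inv M N" "f (act M N c) \<noteq> 0"
      unfolding Z_def G_def by auto
    then have "act M N c \<in> orbit c0" using assms(4) PermVar_act c by blast
    then show "c \<in> orbit c0" using orbit_trans orbit_sym orbit_actI[OF MN(1,2)] by blast
  qed
  ultimately show ?thesis
    unfolding zopenin_def using orbit_subset_PermVar[OF assms(1)] by blast
qed

lemma zopenin_meets:
  assumes "zopenin X U" "c \<in> U" "c \<in> zclosure A" "A \<subseteq> X"
  shows "U \<inter> A \<noteq> {}"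
proof
  assume "U \<inter> A = {}"
  obtain Z where Z: "zclosed Z" "U = X - Z" using assms(1) unfolding zopenin_def by blast
  then have "A \<subseteq> Z" using \<open>U \<inter> A = {}\<close> assms(4) by blast
  then show False using zclosure_least[OF Z(1)] assms(2,3) Z(2) by blast
qed

lemma two_roots:
  fixes q x r :: complex
  assumes "x\<^sup>2 + 4 * q * r \<noteq> 0"
  obtains a b a' b' where "a * b' - a' * b \<noteq> 0"
    "- q * a * a + x * a * b + r * b * b = 0" "- q * a' * a' + x * a' * b' + r * b' * b' = 0"
proof (cases "q = 0")
  case True
  then have "x \<noteq> 0" using assms by auto
  \<comment> \<open>For \<open>q = 0\<close> the form is \<open>b * (x * a + r * b)\<close>, with
    roots \<open>(1, 0)\<close> and \<open>(r, - x)\<close>.\<close>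
  then show ?thesis using that[of 1 "- x" r 0] True by simp
next
  case False
  define z where "z = csqrt (x\<^sup>2 + 4 * q * r)"
  have z: "z * z = x * x + 4 * q * r"
    using power2_csqrt[of "x\<^sup>2 + 4 * q * r"] unfolding z_def by (simp add: power2_eq_square)
  then have nz: "z \<noteq> 0" using assms by (auto simp: power2_eq_square)
  have "- q * (x + y) * (x + y) + x * (x + y) * (2 * q) + r * (2 * q) * (2 * q) = q * (x * x + 4 * q * r - y * y)"
    for y by (simp add: algebra_simps)
  from this[of z] this[of "- z"] show ?thesis
    using that[of "x + z" "2 * q" "x - z" "2 * q"] z nz False by (simp add: algebra_simps)
qed

text \<open>If \<open>p\<close> or \<open>w\<close> is zero, all even products are multiples of one
  vector, whatever the basis; so \<open>e1 e1\<close> and \<open>e2 e2\<close> remain linearly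
  dependent.\<close>

lemma diag_wedge:
  assumes "grading_preserving M" "c = act M N (mk p 0 0 0 0 0 0 w b1 b2 d1 d2 t1 t2)"
    "grading_preserving N" "t1 = 0" "t2 = 0" "p = 0 \<or> w = 0"
  shows "c E1 E1 E1 * c E2 E2 E2 - c E1 E1 E2 * c E2 E2 E1 = 0"
  using assms(1,3-6) unfolding assms(2) grading_preserving_iff
  by (elim disjE) (simp_all add: act_def UNIV_idx algebra_simps)

text \<open>Two common eigenlines of the multiplications diagonalise the even part.\<close>
lemma comm_disc_orbit:
  fixes c :: sc
  assumes "c \<in> PermVar" "c = mk p q r s r s u w b1 b2 d1 d2 0 0"
    and disc: "(p - s)\<^sup>2 + 4 * q * r \<noteq> 0" and wedge: "p * w - q * u \<noteq> 0"
  obtains \<beta>1 \<beta>2 \<delta>1 \<delta>2 where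
    "(\<beta>1, \<beta>2, \<delta>1, \<delta>2) \<in> {(0,0,0,0), (0,1,0,1), (1,0,1,0), (0,0,0,1), (0,0,1,0)}"
    "c \<in> orbit (diag_alg \<beta>1 \<beta>2 \<delta>1 \<delta>2)"
proof -
  obtain a b a' b' where det: "a * b' - a' * b \<noteq> 0"
    and ab: "- q * a * a + (p - s) * a * b + r * b * b = 0"
    and ab': "- q * a' * a' + (p - s) * a' * b' + r * b' * b' = 0"
    using two_roots[OF disc] .
  have nz: "q \<noteq> 0 \<or> p - s \<noteq> 0 \<or> r \<noteq> 0" using disc by auto
  note minors = comm_minors[OF assms(1)[unfolded assms(2)]]
  have ab2: "- s * a * a + (r - w) * a * b + u * b * b = 0"
    and ab2': "- s * a' * a' + (r - w) * a' * b' + u * b' * b' = 0"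
    using common_root[OF minors nz ab] common_root[OF minors nz ab'] by auto
  have nz1: "a \<noteq> 0 \<or> b \<noteq> 0" and nz2: "a' \<noteq> 0 \<or> b' \<noteq> 0" using det by auto
  define M where "M = cols a b a' b' 1"
  have M: "grading_preserving M" unfolding M_def by (rule grading_preserving_cols)
  moreover have "detm M \<noteq> 0" using det by (simp add: M_def detm_def)
  ultimately obtain N where N: "is_inv M N" using is_inv_adjm by blast
  have N': "grading_preserving N" using grading_preserving_inverse M N by blast
  define c' where "c' = act N M c"
  have P: "c' \<in> PermVar" unfolding c'_def using PermVar_act[OF N' is_inv_sym[OF N] assms(1)] .
  have c: "c = act M N c'" unfolding c'_def using act_inverse is_inv_sym[OF N] by simp
  have ev: "even_sc c" using assms(1) by (simp add: PermVar_def)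
  have "c' E1 E2 E1 = 0" "c' E2 E2 E1 = 0" "c' E1 E1 E2 = 0" "c' E2 E1 E2 = 0"
    unfolding c'_def assms(2)
    by (rule act_eigenvector_column[OF nz2 ab' ab2' M N] act_eigenvector_column[OF nz1 ab ab2 M N];
      simp add: M_def)+
  moreover have "even_commute c" "odd_square_zero c" by (simp_all add: assms(2) invariants_mk)
  then have "even_commute c'" "odd_square_zero c'"
    unfolding c'_def using invariants_act[OF N' M ev] by auto
  ultimately have "c' = mk (c' E1 E1 E1) 0 0 0 0 0 0
      (c' E2 E2 E2) (c' E1 F1 F1) (c' E2 F1 F1) (c' F1 E1 F1) (c' F1 E2 F1) 0 0"
    using even_sc_mk[of c'] P unfolding PermVar_def even_commute_def odd_square_zero_def by simp
  then obtain p' w' e1 e2 g1 g2 where c': "c' = mk p' 0 0 0 0 0 0 w' e1 e2 g1 g2 0 0" by blast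
  obtain \<beta>1 \<beta>2 \<delta>1 \<delta>2 where
    1: "(\<beta>1, \<beta>2, \<delta>1, \<delta>2) \<in> {(0,0,0,0), (0,1,0,1), (1,0,1,0), (0,0,0,1), (0,0,1,0)}"
    and 2: "c' = comm_alg p' 0 0 w' \<beta>1 \<beta>2 \<delta>1 \<delta>2"
    using PermVar_comm_algE[OF P[unfolded c']] unfolding c' .
  have "p' \<noteq> 0 \<and> w' \<noteq> 0"
    using diag_wedge[OF M c[unfolded c'] N' refl refl] wedge assms(2) by auto
  then have "c' \<in> orbit (diag_alg \<beta>1 \<beta>2 \<delta>1 \<delta>2)"
    unfolding 2 by (intro comm_alg_orbit) auto
  then have "c \<in> orbit (diag_alg \<beta>1 \<beta>2 \<delta>1 \<delta>2)"
    using orbit_trans orbit_actI[OF M N, of c', folded c] by blast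
  then show ?thesis using that 1 by blast
qed

text \<open>The discriminant excludes repeated eigenlines, the wedge product excludes a nonzero odd square and
  nilpotent elements, and the factor \<open>p - s'\<close> excludes noncommutative even parts.\<close>
definition split_poly :: "sc \<Rightarrow> complex" where
  "split_poly c = (c E1 E1 E1 - c E2 E1 E2) *
    (c E1 E1 E1 * c E2 E2 E2 - c E1 E1 E2 * c E2 E2 E1) *
    ((c E1 E1 E1 - c E1 E2 E2)\<^sup>2 + 4 * c E1 E1 E2 * c E1 E2 E1)"

lemma polyfun_split_poly: "split_poly \<in> polyfun"
  unfolding split_poly_def by (intro polyfun_intros)

lemma split_poly_orbit:
  assumes "c \<in> PermVar" "split_poly c \<noteq> 0"
  shows "left_zero c \<Longrightarrow> left_eq_right c \<Longrightarrow> c \<in> orbit R01"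
    "\<not> left_zero c \<Longrightarrow> left_eq_right c \<Longrightarrow> c \<in> orbit R02"
    "\<not> left_eq_right c \<Longrightarrow> c \<in> orbit R04"
proof -
  obtain p q r s r' s' u w b1 b2 d1 d2 t1 t2 where c: "c = mk p q r s r' s' u w b1 b2 d1 d2 t1 t2"
    using PermVar_mkE[OF assms(1)] .
  note P = assms(1)[unfolded c]
  have nz: "p \<noteq> s'" "p * w - q * u \<noteq> 0" "(p - s)\<^sup>2 + 4 * q * r \<noteq> 0"
    using assms(2) unfolding c split_poly_def by auto
  have comm: "r = r'" "s = s'" using PermVar_noncomm(5)[OF P] nz(1) by auto
  have t: "t1 = 0" "t2 = 0"
  proof -
    have "t1 = 0 \<and> t2 = 0"
    proof (rule ccontr)
      assume "\<not> ?thesis"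
      then obtain v1 v2 where "c = rank1_alg v1 v2 t1 t2"
        using PermVar_rank1_algE[OF P] unfolding c by blast
      then have "c E1 E1 E1 * c E2 E2 E2 - c E1 E1 E2 * c E2 E2 E1 = 0"
        by (simp add: rank1_alg_def)
      then show False using nz(2) by (simp add: c)
    qed
    then show "t1 = 0" "t2 = 0" by auto
  qed
  obtain \<beta>1 \<beta>2 \<delta>1 \<delta>2 where
    1: "(\<beta>1, \<beta>2, \<delta>1, \<delta>2) \<in> {(0,0,0,0), (0,1,0,1), (1,0,1,0), (0,0,0,1), (0,0,1,0)}"
    and 2: "c \<in> orbit (diag_alg \<beta>1 \<beta>2 \<delta>1 \<delta>2)"
  proof -
    have "c = mk p q r s r s u w b1 b2 d1 d2 0 0" using c comm t by simp
    from comm_disc_orbit[OF assms(1) this nz(3,2)] show ?thesis using that .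
  qed
  have ev: "even_sc (diag_alg \<beta>1 \<beta>2 \<delta>1 \<delta>2)" unfolding diag_alg_def by (rule even_sc_mk')
  have inv: "left_zero c \<longleftrightarrow> \<beta>2 = 0 \<and> \<beta>1 = 0" "left_eq_right c \<longleftrightarrow> \<beta>2 = \<delta>2 \<and> \<beta>1 = \<delta>1"
    using invariants_orbit[OF 2 ev] by (simp_all add: diag_alg_def invariants_mk)
  have o: "c \<in> orbit R" if "diag_alg \<beta>1 \<beta>2 \<delta>1 \<delta>2 \<in> orbit R" for R
    using orbit_trans[OF that 2] .
  show "c \<in> orbit R01" if "left_zero c" "left_eq_right c"
    by (rule o) (use that 1 diag_alg_orbits in \<open>auto simp: inv\<close>)
  show "c \<in> orbit R02" if "\<not> left_zero c" "left_eq_right c"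
    by (rule o) (use that 1 diag_alg_orbits in \<open>auto simp: inv\<close>)
  show "c \<in> orbit R04" if "\<not> left_eq_right c"
    by (rule o) (use that 1 diag_alg_orbits in \<open>auto simp: inv\<close>)
qed

text \<open>A nonzero right action is a character, hence an eigenvalue of the multiplication by \<open>e1 + e2\<close>.\<close>
lemma right_action_zero:
  assumes "mk p q r s r' s' u w b1 b2 d1 d2 t1 t2 \<in> PermVar"
    and "(d1 + d2 - p - r') * (d1 + d2 - s - w) - (q + s') * (r + u) \<noteq> 0"
  shows "d1 = 0" "d2 = 0"
proof -
  let ?x = "d1 + d2 - p - r'" and ?y = "d1 + d2 - s - w"
  note d = PermVar_mk_d[OF assms(1)]
  \<comment> \<open>The row \<open>(d1, d2)\<close> is an eigenvector for the eigenvalue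
    \<open>d1 + d2\<close>, and the expression assumed nonzero is the characteristic polynomial at
    this value.\<close>
  have 1: "?x * d1 = (q + s') * d2" "?y * d2 = (r + u) * d1" using d by algebra+
  have "(?x * ?y - (q + s') * (r + u)) * d1 = 0" "(?x * ?y - (q + s') * (r + u)) * d2 = 0"
    using 1 by algebra+
  then show "d1 = 0" "d2 = 0" using assms(2) by auto
qed

lemma zopenin_orbit_R01: "zopenin PermVar (orbit R01)"
proof (rule zopenin_orbitI[OF R_PermVar(1)])
  \<comment> \<open>The second factor is the expression of \<open>right_action_zero\<close>. In
    \<open>R01\<close> multiplication by \<open>e1 + e2\<close> is the identity on the even part, so
    0 is no eigenvalue; \<open>e1\<close> alone would make the factor vanish at
    \<open>R01\<close>.\<close>
  let ?f = "\<lambda>c::sc. split_poly c * ((c F1 E1 F1 + c F1 E2 F1 - c E1 E1 E1 - c E2 E1 E1) *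
    (c F1 E1 F1 + c F1 E2 F1 - c E1 E2 E2 - c E2 E2 E2) - (c E1 E1 E2 + c E2 E1 E2) * (c E1 E2 E1 + c E2 E2 E1))"
  show "?f \<in> polyfun" by (intro polyfun_intros polyfun_split_poly)
  show "?f R01 \<noteq> 0" by (simp add: R_mk split_poly_def)
  fix c assume c: "c \<in> PermVar" "?f c \<noteq> 0"
  obtain p q r s r' s' u w b1 b2 d1 d2 t1 t2 where mk: "c = mk p q r s r' s' u w b1 b2 d1 d2 t1 t2"
    using PermVar_mkE[OF c(1)] .
  have "d1 = 0" "d2 = 0" using right_action_zero[OF c(1)[unfolded mk]] c(2) unfolding mk by auto
  moreover from this have "b1 = 0" "b2 = 0" using PermVar_mk_bd[OF c(1)[unfolded mk]] by auto
  ultimately have "left_zero c" "left_eq_right c" by (simp_all add: mk invariants_mk)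
  then show "c \<in> orbit R01" using split_poly_orbit(1)[OF c(1)] c(2) by auto
qed

lemma zopenin_orbit_R02: "zopenin PermVar (orbit R02)"
proof (rule zopenin_orbitI[OF R_PermVar(2)])
  let ?f = "\<lambda>c::sc. split_poly c * c E1 F1 F1"
  show "?f \<in> polyfun" by (intro polyfun_intros polyfun_split_poly)
  show "?f R02 \<noteq> 0" by (simp add: R_mk split_poly_def)
  fix c assume c: "c \<in> PermVar" "?f c \<noteq> 0"
  obtain p q r s r' s' u w b1 b2 d1 d2 t1 t2 where mk: "c = mk p q r s r' s' u w b1 b2 d1 d2 t1 t2"
    using PermVar_mkE[OF c(1)] .
  have "b1 = d1" "b2 = d2" "b1 \<noteq> 0" using PermVar_mk_bd[OF c(1)[unfolded mk]] c(2) unfolding mk by auto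
  then have "\<not> left_zero c" "left_eq_right c" by (simp_all add: mk invariants_mk)
  then show "c \<in> orbit R02" using split_poly_orbit(2)[OF c(1)] c(2) by auto
qed

lemma zopenin_orbit_R04: "zopenin PermVar (orbit R04)"
proof (rule zopenin_orbitI[OF R_PermVar(3)])
  let ?f = "\<lambda>c::sc. split_poly c * (c E1 F1 F1 - c F1 E1 F1)"
  show "?f \<in> polyfun" by (intro polyfun_intros polyfun_split_poly)
  show "?f R04 \<noteq> 0" by (simp add: R_mk split_poly_def)
  fix c assume c: "c \<in> PermVar" "?f c \<noteq> 0"
  then have "\<not> left_eq_right c" by (auto simp: left_eq_right_def)
  then show "c \<in> orbit R04" using split_poly_orbit(3)[OF c(1)] c(2) by auto
qed

lemma zopenin_orbit_R10: "zopenin PermVar (orbit R10)"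
proof (rule zopenin_orbitI[OF R_PermVar(4)])
  \<comment> \<open>The sum is the trace of multiplication by \<open>e1\<close> on the even part; in
    \<open>rank1_alg\<close> it equals \<open>t2 * \<lambda>(v)\<close>, so it detects that
    \<open>v\<close> lies off the kernel.\<close>
  let ?f = "\<lambda>c::sc. c F1 F1 E2 * (c E1 E1 E1 + c E1 E2 E2)"
  show "?f \<in> polyfun" by (intro polyfun_intros)
  show "?f R10 \<noteq> 0" by (simp add: R_mk)
  fix c assume c: "c \<in> PermVar" "?f c \<noteq> 0"
  obtain p q r s r' s' u w b1 b2 d1 d2 t1 t2 where mk: "c = mk p q r s r' s' u w b1 b2 d1 d2 t1 t2"
    using PermVar_mkE[OF c(1)] .
  have "t2 \<noteq> 0" using c(2) unfolding mk by auto
  then obtain v1 v2 where v: "c = rank1_alg v1 v2 t1 t2"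
    using PermVar_rank1_algE[OF c(1)[unfolded mk]] unfolding mk by blast
  have "?f c = t2 * t2 * (t2 * v1 - t1 * v2)" unfolding v rank1_alg_def by (simp add: algebra_simps)
  then have "t2 * v1 - t1 * v2 \<noteq> 0" using c(2) by (intro notI) simp
  then show "c \<in> orbit R10" unfolding v by (rule rank1_alg_orbit)
qed

lemma noncomm_orbit:
  assumes "c \<in> PermVar" "\<not> even_commute c"
  shows "left_zero c \<Longrightarrow> left_eq_right c \<Longrightarrow> c \<in> orbit R25"
    "\<not> left_eq_right c \<Longrightarrow> c \<in> orbit R31"
    "\<not> left_zero c \<Longrightarrow> c \<in> orbit R33"
proof -
  obtain p q r s r' s' u w b1 b2 d1 d2 t1 t2 where c: "c = mk p q r s r' s' u w b1 b2 d1 d2 t1 t2"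
    using PermVar_mkE[OF assms(1)] .
  have nc: "\<not> (r = r' \<and> s = s')" using assms(2) unfolding c invariants_mk .
  obtain \<beta> \<delta> where *: "(\<beta>, \<delta>) \<in> {(0, 0), (0, 1), (1, 1)}" "p \<noteq> 0 \<or> r \<noteq> 0" "c = left_alg p r \<beta> \<delta>"
    using PermVar_left_algE[OF assms(1)[unfolded c] nc] unfolding c .
  have inv: "left_zero c \<longleftrightarrow> \<beta> = 0" "left_eq_right c \<longleftrightarrow> \<beta> = \<delta>"
    unfolding *(3) left_alg_def invariants_mk using *(2) by auto
  have o: "c \<in> orbit (left_alg 1 0 \<beta> \<delta>)" using left_alg_orbit[OF *(2)] *(3) by simp
  show "c \<in> orbit R25" if "left_zero c" "left_eq_right c"
    using that o unfolding inv left_alg_R by auto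
  show "c \<in> orbit R31" if "\<not> left_eq_right c"
    using that o *(1) unfolding inv left_alg_R by auto
  show "c \<in> orbit R33" if "\<not> left_zero c"
    using that o *(1) unfolding inv left_alg_R by auto
qed

lemma zopenin_orbit_R25: "zopenin PermVar (orbit R25)"
proof (rule zopenin_orbitI[OF R_PermVar(5)])
  \<comment> \<open>In the noncommutative normal form \<open>d1 = \<delta> * p\<close> with
    \<open>\<delta>\<close> equal to 0 or 1, so \<open>d1 \<noteq> p\<close> expresses a zero right
    action as an inequality.\<close>
  let ?f = "\<lambda>c::sc. (c E1 E2 E2 - c E2 E1 E2) * (c F1 E1 F1 - c E1 E1 E1)"
  show "?f \<in> polyfun" by (intro polyfun_intros)
  show "?f R25 \<noteq> 0" by (simp add: R_mk)
  fix c assume c: "c \<in> PermVar" "?f c \<noteq> 0"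
  obtain p q r s r' s' u w b1 b2 d1 d2 t1 t2 where mk: "c = mk p q r s r' s' u w b1 b2 d1 d2 t1 t2"
    using PermVar_mkE[OF c(1)] .
  have nc: "\<not> (r = r' \<and> s = s')" and d1: "d1 \<noteq> p" using c(2) unfolding mk by auto
  obtain \<beta> \<delta> where *: "(\<beta>, \<delta>) \<in> {(0, 0), (0, 1), (1, 1)}" "p \<noteq> 0 \<or> r \<noteq> 0" "c = left_alg p r \<beta> \<delta>"
    using PermVar_left_algE[OF c(1)[unfolded mk] nc] unfolding mk .
  have "c F1 E1 F1 = d1" by (simp add: mk)
  then have "\<delta> * p \<noteq> p" using d1 unfolding *(3) left_alg_def by simp
  then have "\<delta> = 0" "\<beta> = 0" using *(1) by auto
  then have "left_zero c" "left_eq_right c" unfolding *(3) left_alg_def invariants_mk by auto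
  moreover have "\<not> even_commute c" unfolding mk invariants_mk by (rule nc)
  ultimately show "c \<in> orbit R25" using noncomm_orbit(1) c(1) by blast
qed

lemma zopenin_orbit_R31: "zopenin PermVar (orbit R31)"
proof (rule zopenin_orbitI[OF R_PermVar(6)])
  let ?f = "\<lambda>c::sc. (c E1 E2 E2 - c E2 E1 E2) * (c E1 F1 F1 - c F1 E1 F1)"
  show "?f \<in> polyfun" by (intro polyfun_intros)
  show "?f R31 \<noteq> 0" by (simp add: R_mk)
  fix c assume c: "c \<in> PermVar" "?f c \<noteq> 0"
  then show "c \<in> orbit R31"
    by (intro noncomm_orbit(2)) (auto simp: even_commute_def left_eq_right_def)
qed

lemma zopenin_orbit_R33: "zopenin PermVar (orbit R33)"
proof (rule zopenin_orbitI[OF R_PermVar(7)])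
  let ?f = "\<lambda>c::sc. (c E1 E2 E2 - c E2 E1 E2) * c E1 F1 F1"
  show "?f \<in> polyfun" by (intro polyfun_intros)
  show "?f R33 \<noteq> 0" by (simp add: R_mk)
  fix c assume c: "c \<in> PermVar" "?f c \<noteq> 0"
  then show "c \<in> orbit R33"
    by (intro noncomm_orbit(3)) (auto simp: even_commute_def left_zero_def)
qed

section \<open>Irreducible components and rigid algebras\<close>

lemma Rs_PermVar: "R \<in> Rs \<Longrightarrow> R \<in> PermVar"
  unfolding Rs_def using R_PermVar by auto

lemma Rs_zopenin: "R \<in> Rs \<Longrightarrow> zopenin PermVar (orbit R)"
  unfolding Rs_def using zopenin_orbit_R01 zopenin_orbit_R02 zopenin_orbit_R04 zopenin_orbit_R10
    zopenin_orbit_R25 zopenin_orbit_R31 zopenin_orbit_R33 by auto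

definition invariants :: "sc \<Rightarrow> bool \<times> bool \<times> bool \<times> bool" where
  "invariants c = (even_commute c, odd_square_zero c, left_zero c, left_eq_right c)"

lemma invariants_orbit_eq: "d \<in> orbit c \<Longrightarrow> even_sc c \<Longrightarrow> invariants d = invariants c"
  using invariants_orbit unfolding invariants_def by simp

lemma invariants_R:
  "invariants R01 = (True, True, True, True)" "invariants R02 = (True, True, False, True)"
  "invariants R04 = (True, True, True, False)" "invariants R10 = (True, False, True, True)"
  "invariants R25 = (False, True, True, True)" "invariants R31 = (False, True, True, False)"
  "invariants R33 = (False, True, False, True)"
  by (simp_all add: invariants_def R_mk invariants_mk)

lemma inj_on_invariants: "inj_on invariants Rs"
  unfolding Rs_def inj_on_def by (simp add: invariants_R)

lemma card_Rs: "card Rs = 7"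
proof -
  have "invariants ` Rs = {(True, True, True, True), (True, True, False, True), (True, True, True, False),
    (True, False, True, True), (False, True, True, True), (False, True, True, False), (False, True, False, True)}"
    unfolding Rs_def by (simp add: invariants_R)
  then have "card (invariants ` Rs) = 7" by simp
  then show ?thesis using card_image[OF inj_on_invariants] by simp
qed

lemma orbit_eqI: "d \<in> orbit c \<Longrightarrow> orbit d = orbit c"
  using orbit_trans orbit_sym by blast

text \<open>The open orbit of \<open>R\<close> meets the closure of the orbit of \<open>R'\<close>,
  hence that orbit itself; the invariants then identify \<open>R\<close> and
  \<open>R'\<close>.\<close>

lemma Rs_zclosure_subset:
  assumes "R \<in> Rs" "R' \<in> Rs" "zclosure (orbit R) \<subseteq> zclosure (orbit R')"
  shows "R = R'"
proof -
  have "R \<in> zclosure (orbit R')" using assms(3) subset_zclosure orbit_refl by blast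
  then have "orbit R \<inter> orbit R' \<noteq> {}"
    using zopenin_meets[OF Rs_zopenin[OF assms(1)] orbit_refl] orbit_subset_PermVar[OF Rs_PermVar[OF assms(2)]]
    by blast
  then obtain c where "c \<in> orbit R" "c \<in> orbit R'" by blast
  then have "invariants R = invariants R'"
    using invariants_orbit_eq Rs_PermVar[OF assms(1)] Rs_PermVar[OF assms(2)] unfolding PermVar_def
    by (metis (mono_tags, lifting) mem_Collect_eq)
  then show ?thesis using inj_on_invariants assms(1,2) unfolding inj_on_def by blast
qed

lemma zclosure_orbit_subset_PermVar: "R \<in> Rs \<Longrightarrow> zclosure (orbit R) \<subseteq> PermVar"
  by (intro zclosure_least[OF zclosed_PermVar] orbit_subset_PermVar Rs_PermVar)

lemma finite_Rs: "finite Rs"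
  unfolding Rs_def by simp

lemma irreducible_subset_PermVar:
  assumes "irreducible_set W" "W \<subseteq> PermVar"
  obtains R where "R \<in> Rs" "W \<subseteq> zclosure (orbit R)"
proof -
  have "W \<subseteq> \<Union>((\<lambda>R. zclosure (orbit R)) ` Rs)" using assms(2) PermVar_covered by blast
  then show ?thesis
    using irreducible_set_finite_Un[OF assms(1) finite_imageI[OF finite_Rs], of "\<lambda>R. zclosure (orbit R)"]
      zclosed_zclosure that by auto
qed

lemma irr_components_PermVar: "{Z. irr_component PermVar Z} = (\<lambda>R. zclosure (orbit R)) ` Rs"
proof (intro set_eqI iffI)
  fix Z assume "Z \<in> {Z. irr_component PermVar Z}"
  then have Z: "Z \<subseteq> PermVar" "irreducible_set Z"
    "\<And>W. W \<subseteq> PermVar \<Longrightarrow> irreducible_set W \<Longrightarrow> Z \<subseteq> W \<Longrightarrow> W = Z" unfolding irr_component_def by auto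
  obtain R where R: "R \<in> Rs" "Z \<subseteq> zclosure (orbit R)" using irreducible_subset_PermVar[OF Z(2,1)] .
  then have "zclosure (orbit R) = Z"
    by (intro Z(3) zclosure_orbit_subset_PermVar irreducible_set_zclosure irreducible_set_orbit)
  then show "Z \<in> (\<lambda>R. zclosure (orbit R)) ` Rs" using R by blast
next
  fix Z assume "Z \<in> (\<lambda>R. zclosure (orbit R)) ` Rs"
  then obtain R where R: "R \<in> Rs" "Z = zclosure (orbit R)" by blast
  have "W = Z" if W: "W \<subseteq> PermVar" "irreducible_set W" "Z \<subseteq> W" for W
  proof -
    obtain R' where "R' \<in> Rs" "W \<subseteq> zclosure (orbit R')" using irreducible_subset_PermVar[OF W(2,1)] .
    then show ?thesis using Rs_zclosure_subset[OF R(1)] W(3) R(2) by blast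
  qed
  then show "Z \<in> {Z. irr_component PermVar Z}"
    unfolding irr_component_def
    using zclosure_orbit_subset_PermVar[OF R(1)] irreducible_set_zclosure[OF irreducible_set_orbit] R(2) by blast
qed

text \<open>A rigid point lies in one of the seven closures, so its open orbit meets the
  corresponding orbit and coincides with it.\<close>

lemma rigid_PermVar_iff: "rigid PermVar c \<longleftrightarrow> (\<exists>R\<in>Rs. c \<in> orbit R)"
proof
  assume c: "rigid PermVar c"
  then obtain R where R: "R \<in> Rs" "c \<in> zclosure (orbit R)" using PermVar_covered unfolding rigid_def by blast
  have "orbit c \<inter> orbit R \<noteq> {}"
    using zopenin_meets[OF _ orbit_refl R(2)] c orbit_subset_PermVar[OF Rs_PermVar[OF R(1)]]
    unfolding rigid_def by blast
  then show "\<exists>R\<in>Rs. c \<in> orbit R" using R(1) orbit_sym orbit_trans by blast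
next
  assume "\<exists>R\<in>Rs. c \<in> orbit R"
  then obtain R where R: "R \<in> Rs" "c \<in> orbit R" by blast
  then show "rigid PermVar c"
    unfolding rigid_def orbit_eqI[OF R(2)]
    using Rs_zopenin orbit_subset_PermVar[OF Rs_PermVar] by blast
qed

section \<open>Dimension\<close>

subsection \<open>Polynomials in four variables\<close>

type_synonym param = "complex \<times> complex \<times> complex \<times> complex"

definition monom4 :: "nat \<times> nat \<times> nat \<times> nat \<Rightarrow> param \<Rightarrow> complex" where
  "monom4 = (\<lambda>(i, j, k, l) (a, b, c, d). a ^ i * b ^ j * c ^ k * d ^ l)"

definition box4 :: "nat \<Rightarrow> (nat \<times> nat \<times> nat \<times> nat) set" where
  "box4 D = {..D} \<times> {..D} \<times> {..D} \<times> {..D}"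

text \<open>\<open>D\<close> bounds the exponent of each variable separately: such bounds add under
  products, and the spanning monomials number \<open>(D + 1) ^ 4\<close>.\<close>

inductive_set poly4 :: "nat \<Rightarrow> (param \<Rightarrow> complex) set" for D where
  monom: "e \<in> box4 D \<Longrightarrow> monom4 e \<in> poly4 D"
| add: "f \<in> poly4 D \<Longrightarrow> g \<in> poly4 D \<Longrightarrow> (\<lambda>x. f x + g x) \<in> poly4 D"
| scale: "f \<in> poly4 D \<Longrightarrow> (\<lambda>x. a * f x) \<in> poly4 D"

lemma finite_box4: "finite (box4 D)"
  unfolding box4_def by simp

lemma card_box4: "card (box4 D) = Suc D ^ 4"
  unfolding box4_def by (simp add: card_cartesian_product power4_eq_xxxx algebra_simps)

lemma poly4_expand: "f \<in> poly4 D \<Longrightarrow> \<exists>co. \<forall>x. f x = (\<Sum>e\<in>box4 D. co e * monom4 e x)"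
proof (induction rule: poly4.induct)
  case (monom e)
  have "monom4 e x = (\<Sum>e'\<in>box4 D. (if e' = e then 1 else 0) * monom4 e' x)" for x
    using monom finite_box4[of D] by (simp add: if_distribR if_distrib cong: if_cong)
  then show ?case by (intro exI[of _ "\<lambda>e'. if e' = e then 1 else 0"] allI)
next
  case (add f g)
  then obtain co co' where "\<forall>x. f x = (\<Sum>e\<in>box4 D. co e * monom4 e x)"
    "\<forall>x. g x = (\<Sum>e\<in>box4 D. co' e * monom4 e x)" by blast
  then have "\<forall>x. f x + g x = (\<Sum>e\<in>box4 D. (co e + co' e) * monom4 e x)"
    by (simp add: sum.distrib algebra_simps)
  then show ?case by (rule exI[of _ "\<lambda>e. co e + co' e"])
next
  case (scale f a)
  then obtain co where "\<forall>x. f x = (\<Sum>e\<in>box4 D. co e * monom4 e x)" by blast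
  then have "\<forall>x. a * f x = (\<Sum>e\<in>box4 D. (a * co e) * monom4 e x)"
    by (simp add: sum_distrib_left algebra_simps)
  then show ?case by (rule exI[of _ "\<lambda>e. a * co e"])
qed

lemma poly4_mono: "D \<le> D' \<Longrightarrow> f \<in> poly4 D \<Longrightarrow> f \<in> poly4 D'"
  by (erule poly4.induct) (auto intro!: poly4.intros simp: box4_def)

lemma poly4_mult:
  assumes "f \<in> poly4 D" "g \<in> poly4 D'"
  shows "(\<lambda>x. f x * g x) \<in> poly4 (D + D')"
  using assms(1)
proof (induction rule: poly4.induct)
  case (monom e)
  show ?case using assms(2)
  proof (induction rule: poly4.induct)
    case (monom e')
    obtain i j k l i' j' k' l' where e: "e = (i, j, k, l)" "e' = (i', j', k', l')" by (metis prod_cases4)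
    have "(\<lambda>x. monom4 e x * monom4 e' x) = monom4 (i + i', j + j', k + k', l + l')"
      unfolding e monom4_def by (auto simp: power_add)
    then show ?case using monom \<open>e \<in> box4 D\<close> unfolding e
      by (auto intro!: poly4.monom simp: box4_def)
  next
    case (add f g)
    then show ?case using poly4.add by (fastforce simp: distrib_left)
  next
    case (scale f a)
    have "(\<lambda>x. monom4 e x * (a * f x)) = (\<lambda>x. a * (monom4 e x * f x))" by (auto simp: algebra_simps)
    then show ?case using poly4.scale[OF scale(2), of a] by simp
  qed
next
  case (add f h)
  have "(\<lambda>x. (f x + h x) * g x) = (\<lambda>x. f x * g x + h x * g x)" by (auto simp: algebra_simps)
  then show ?case using poly4.add[OF add(3,4)] by simp
next
  case (scale f a)
  have "(\<lambda>x. a * f x * g x) = (\<lambda>x. a * (f x * g x))" by (auto simp: algebra_simps)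
  then show ?case using poly4.scale[OF scale(2), of a] by simp
qed

lemma poly4_const: "(\<lambda>_. a) \<in> poly4 D"
proof -
  have "(\<lambda>x. a * monom4 (0, 0, 0, 0) x) \<in> poly4 D"
    by (intro poly4.scale poly4.monom) (simp add: box4_def)
  then show ?thesis by (simp add: monom4_def case_prod_unfold)
qed

lemma poly4_power: "f \<in> poly4 D \<Longrightarrow> (\<lambda>x. f x ^ n) \<in> poly4 (n * D)"
  by (induction n) (auto intro: poly4_const poly4_mult)

definition is_poly4 :: "(param \<Rightarrow> complex) \<Rightarrow> bool" where
  "is_poly4 f \<longleftrightarrow> (\<exists>D. f \<in> poly4 D)"

lemma is_poly4_const: "is_poly4 (\<lambda>_. a)"
  unfolding is_poly4_def using poly4_const by blast

lemma is_poly4_add: "is_poly4 f \<Longrightarrow> is_poly4 g \<Longrightarrow> is_poly4 (\<lambda>x. f x + g x)"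
  unfolding is_poly4_def
  by (metis poly4.add poly4_mono max.cobounded1 max.cobounded2)

lemma is_poly4_mult: "is_poly4 f \<Longrightarrow> is_poly4 g \<Longrightarrow> is_poly4 (\<lambda>x. f x * g x)"
  unfolding is_poly4_def by (metis poly4_mult)

lemma is_poly4_power: "is_poly4 f \<Longrightarrow> is_poly4 (\<lambda>x. f x ^ n)"
  unfolding is_poly4_def by (metis poly4_power)

lemma is_poly4_minus: "is_poly4 f \<Longrightarrow> is_poly4 (\<lambda>x. - f x)"
  using is_poly4_mult[OF is_poly4_const[of "-1"]] by simp

lemma is_poly4_diff: "is_poly4 f \<Longrightarrow> is_poly4 g \<Longrightarrow> is_poly4 (\<lambda>x. f x - g x)"
  using is_poly4_add[OF _ is_poly4_minus] by simp

lemma is_poly4_sum: "(\<And>i. i \<in> I \<Longrightarrow> is_poly4 (f i)) \<Longrightarrow> is_poly4 (\<lambda>x. \<Sum>i\<in>I. f i x)"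
  by (induction I rule: infinite_finite_induct) (auto intro: is_poly4_add is_poly4_const)

lemma is_poly4_coords:
  "is_poly4 (\<lambda>x. fst x)" "is_poly4 (\<lambda>x. fst (snd x))"
  "is_poly4 (\<lambda>x. fst (snd (snd x)))" "is_poly4 (\<lambda>x. snd (snd (snd x)))"
proof -
  have *: "is_poly4 (monom4 e)" if "e \<in> box4 1" for e
    unfolding is_poly4_def using poly4.monom[OF that] by blast
  show "is_poly4 (\<lambda>x. fst x)" using *[of "(1, 0, 0, 0)"]
    by (simp add: box4_def monom4_def case_prod_unfold)
  show "is_poly4 (\<lambda>x. fst (snd x))" using *[of "(0, 1, 0, 0)"]
    by (simp add: box4_def monom4_def case_prod_unfold)
  show "is_poly4 (\<lambda>x. fst (snd (snd x)))" using *[of "(0, 0, 1, 0)"]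
    by (simp add: box4_def monom4_def case_prod_unfold)
  show "is_poly4 (\<lambda>x. snd (snd (snd x)))" using *[of "(0, 0, 0, 1)"]
    by (simp add: box4_def monom4_def case_prod_unfold)
qed

lemmas is_poly4_intros = is_poly4_const is_poly4_add is_poly4_mult is_poly4_power is_poly4_minus
  is_poly4_diff is_poly4_sum is_poly4_coords

text \<open>Gaussian elimination: equation \<open>b\<close> is solved for the unknown at a pivot
  \<open>a0\<close>, leaving one unknown and one equation fewer.\<close>

lemma underdetermined_system:
  fixes m :: "'a \<Rightarrow> 'b \<Rightarrow> complex"
  assumes "finite B" "finite A" "card B < card A"
  shows "\<exists>x. (\<exists>a\<in>A. x a \<noteq> 0) \<and> (\<forall>b\<in>B. (\<Sum>a\<in>A. x a * m a b) = 0)"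
  using assms
proof (induction B arbitrary: A m rule: finite_induct)
  case empty
  then have "A \<noteq> {}" by auto
  then show ?case by (intro exI[of _ "\<lambda>_. 1"]) auto
next
  case (insert b B)
  show ?case
  proof (cases "\<forall>a\<in>A. m a b = 0")
    case True
    obtain x where "\<exists>a\<in>A. x a \<noteq> 0" "\<forall>b\<in>B. (\<Sum>a\<in>A. x a * m a b) = 0"
      using insert.IH[of A m] insert.prems insert.hyps by auto
    then show ?thesis using True by (intro exI[of _ x]) auto
  next
    case False
    then obtain a0 where a0: "a0 \<in> A" "m a0 b \<noteq> 0" by auto
    define m' where "m' a b' = m a b' - m a b / m a0 b * m a0 b'" for a b'
    have "card B < card (A - {a0})" using insert.prems insert.hyps a0 by simp
    then obtain x where x: "\<exists>a\<in>A - {a0}. x a \<noteq> 0" "\<forall>b\<in>B. (\<Sum>a\<in>A - {a0}. x a * m' a b) = 0"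
      using insert.IH[of "A - {a0}" m'] insert.prems by auto
    define y where "y a = (if a = a0 then - (\<Sum>a\<in>A - {a0}. x a * m a b) / m a0 b else x a)" for a
    have eq: "(\<Sum>a\<in>A. y a * m a b') = (\<Sum>a\<in>A - {a0}. x a * m' a b')" for b'
    proof -
      have "(\<Sum>a\<in>A. y a * m a b') = y a0 * m a0 b' + (\<Sum>a\<in>A - {a0}. y a * m a b')"
        using insert.prems(1) a0(1) by (rule sum.remove)
      also have "(\<Sum>a\<in>A - {a0}. y a * m a b') = (\<Sum>a\<in>A - {a0}. x a * m a b')"
        by (rule sum.cong) (auto simp: y_def)
      also have "y a0 * m a0 b' = - (\<Sum>a\<in>A - {a0}. x a * (m a b / m a0 b * m a0 b'))"
        unfolding y_def by (simp add: sum_distrib_right sum_divide_distrib mult.assoc)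
      finally show ?thesis unfolding m'_def by (simp add: right_diff_distrib sum_subtractf)
    qed
    \<comment> \<open>The reduced coefficients \<open>m'\<close> vanish in column
      \<open>b\<close>.\<close>
    have "(\<Sum>a\<in>A. y a * m a b) = 0" unfolding eq m'_def using a0(2) by simp
    moreover have "\<forall>b\<in>B. (\<Sum>a\<in>A. y a * m a b) = 0" using x(2) eq by simp
    moreover have "\<exists>a\<in>A. y a \<noteq> 0" using x(1) by (auto simp: y_def)
    ultimately show ?thesis by auto
  qed
qed

subsection \<open>Monomials along a chain\<close>

definition exps :: "nat \<Rightarrow> nat \<Rightarrow> nat list set" where
  "exps K n = {as. set as \<subseteq> {..<K} \<and> length as = n}"

lemma finite_exps: "finite (exps K n)"
  unfolding exps_def by (rule finite_lists_length_eq) simp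

lemma card_exps: "card (exps K n) = K ^ n"
  unfolding exps_def by (subst card_lists_length_eq) simp_all

lemma sum_exps_Suc: "(\<Sum>as\<in>exps K (Suc n). f as) = (\<Sum>j<K. \<Sum>as\<in>exps K n. f (j # as))"
proof -
  have "(\<Sum>as\<in>exps K (Suc n). f as) = (\<Sum>(as, j)\<in>exps K n \<times> {..<K}. f (j # as))"
    unfolding exps_def lists_length_Suc_eq
    by (subst sum.reindex) (auto simp: inj_on_def case_prod_unfold)
  also have "\<dots> = (\<Sum>as\<in>exps K n. \<Sum>j<K. f (j # as))"
    by (rule sum.cartesian_product[symmetric])
  finally show ?thesis by (simp add: sum.swap[of _ "exps K n"])
qed

text \<open>The head of the list is the exponent of the generator with the largest index, so the
  tail involves only the earlier ones and induction along the chain removes the head.\<close>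

fun chain_monom :: "(nat \<Rightarrow> sc \<Rightarrow> complex) \<Rightarrow> nat list \<Rightarrow> sc \<Rightarrow> complex" where
  "chain_monom g [] c = 1"
| "chain_monom g (a # as) c = g (length as) c ^ a * chain_monom g as c"

lemma polyfun_chain_monom:
  "(\<And>i. i < length as \<Longrightarrow> g i \<in> polyfun) \<Longrightarrow> chain_monom g as \<in> polyfun"
proof (induction as)
  case Nil
  have "chain_monom g [] = (\<lambda>_. 1)" by auto
  then show ?case using pconst[of 1] by simp
next
  case (Cons a as)
  have "chain_monom g (a # as) = (\<lambda>c. g (length as) c ^ a * chain_monom g as c)" by auto
  moreover have "\<dots> \<in> polyfun"
    by (intro pmult polyfun_power Cons.IH) (use Cons.prems in auto)
  ultimately show ?case by simp
qed

text \<open>In a relation on \<open>Z (Suc n)\<close> the lowest power of \<open>g n\<close> can be cancelled, as \<open>Z (Suc n)\<close> is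
  irreducible; restricting to \<open>Z n\<close>, where \<open>g n\<close> vanishes, leaves a relation in fewer variables.\<close>
lemma chain_monom_independent:
  assumes "\<And>i. i \<le> n \<Longrightarrow> irreducible_set (Z i)"
    and "\<And>i. i < n \<Longrightarrow> Z i \<subseteq> Z (Suc i)"
    and "\<And>i. i < n \<Longrightarrow> g i \<in> polyfun"
    and "\<And>i c. i < n \<Longrightarrow> c \<in> Z i \<Longrightarrow> g i c = 0"
    and "\<And>i. i < n \<Longrightarrow> \<exists>c\<in>Z (Suc i). g i c \<noteq> 0"
    and "\<And>c. c \<in> Z n \<Longrightarrow> (\<Sum>as\<in>exps K n. x as * chain_monom g as c) = 0"
  shows "\<forall>as\<in>exps K n. x as = 0"
  using assms
proof (induction n arbitrary: x)
  case 0
  obtain c where c: "c \<in> Z 0" using 0(1)[of 0] unfolding irreducible_set_def by auto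
  have "exps K 0 = {[]}" by (auto simp: exps_def)
  then show ?case using 0(6)[OF c] by simp
next
  case (Suc n)
  define S where "S j c = (\<Sum>as\<in>exps K n. x (j # as) * chain_monom g as c)" for j c
  have S: "S j \<in> polyfun" for j
    unfolding S_def using Suc.prems(3)
    by (intro polyfun_intros polyfun_chain_monom) (auto simp: exps_def)
  have rel: "(\<Sum>j<K. g n c ^ j * S j c) = 0" if "c \<in> Z (Suc n)" for c
  proof -
    have "(\<Sum>j<K. g n c ^ j * S j c) = (\<Sum>j<K. \<Sum>as\<in>exps K n. x (j # as) * chain_monom g (j # as) c)"
      unfolding S_def sum_distrib_left
      by (intro sum.cong refl) (auto simp: exps_def algebra_simps)
    then show ?thesis using Suc.prems(6)[OF that] unfolding sum_exps_Suc by simp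
  qed
  have "\<forall>as\<in>exps K n. x (j # as) = 0" if "j < K" for j
    using that
  proof (induction j rule: less_induct)
    case (less j)
    have S0: "S i c = 0" if "i < j" for i c
      unfolding S_def using less that by (intro sum.neutral) auto
    define T where "T c = (\<Sum>i\<in>{j..<K}. g n c ^ (i - j) * S i c)" for c
    have T: "T \<in> polyfun" unfolding T_def
      using S Suc.prems(3)[of n] by (intro polyfun_intros) auto
    have gT: "g n c ^ j * T c = 0" if "c \<in> Z (Suc n)" for c
    proof -
      have "(\<Sum>i<K. g n c ^ i * S i c) = (\<Sum>i\<in>{j..<K}. g n c ^ i * S i c)"
        by (rule sum.mono_neutral_right) (auto simp: S0 not_le)
      also have "\<dots> = g n c ^ j * T c"
        unfolding T_def sum_distrib_left
        by (intro sum.cong refl) (simp add: mult.assoc[symmetric] power_add[symmetric])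
      finally show ?thesis using rel[OF that] by simp
    qed
    have "\<forall>c\<in>Z (Suc n). T c = 0"
    proof -
      have "(\<forall>c\<in>Z (Suc n). g n c = 0) \<or> (\<forall>c\<in>Z (Suc n). T c = 0)"
      proof (rule irreducible_set_polyfun)
        show "g n c * T c = 0" if "c \<in> Z (Suc n)" for c using gT[OF that] by auto
      qed (use Suc.prems(1,3) T in auto)
      then show ?thesis using Suc.prems(5)[of n] by auto
    qed
    then have T0: "T c = 0" if "c \<in> Z n" for c using Suc.prems(2)[of n] that by auto
    have "S j c = 0" if c: "c \<in> Z n" for c
    proof -
      \<comment> \<open>On \<open>Z n\<close> the function \<open>g n\<close> vanishes, and
        \<open>0 ^ 0 = 1\<close> keeps exactly the lowest term.\<close>
      have "T c = (\<Sum>i\<in>{j..<K}. if i = j then S j c else 0)"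
        unfolding T_def using Suc.prems(4)[of n c] c by (intro sum.cong refl) auto
      also have "\<dots> = S j c" using less.prems by simp
      finally show ?thesis using T0[OF c] by simp
    qed
    then show ?case
      using Suc.IH[of "\<lambda>as. x (j # as)"] Suc.prems(1-5) unfolding S_def by auto
  qed
  then show ?case by (auto simp: exps_def length_Suc_conv)
qed

subsection \<open>Upper bound\<close>

definition param_matrix :: "param \<Rightarrow> idx \<Rightarrow> idx \<Rightarrow> complex" where
  "param_matrix x = cols (fst x) (fst (snd x)) (fst (snd (snd x))) (snd (snd (snd x))) 1"

definition param_det :: "param \<Rightarrow> complex" where
  "param_det x = detm (param_matrix x)"

definition param_act :: "sc \<Rightarrow> param \<Rightarrow> sc" where
  "param_act R x = act (param_matrix x) (\<lambda>i j. adjm (param_matrix x) i j / param_det x) R"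

lemma is_poly4_param_matrix: "is_poly4 (\<lambda>x. param_matrix x i j)"
  unfolding param_matrix_def by (cases i; cases j) (simp_all add: is_poly4_intros)

lemma is_poly4_param_det: "is_poly4 param_det"
proof -
  have "is_poly4 (\<lambda>x. param_det x)"
    unfolding param_det_def detm_def by (intro is_poly4_intros is_poly4_param_matrix)
  then show ?thesis .
qed

lemma is_poly4_adjm_param_matrix: "is_poly4 (\<lambda>x. adjm (param_matrix x) i j)"
  unfolding adjm_def
  by (cases i; cases j; simp; intro is_poly4_intros is_poly4_param_matrix)

text \<open>The analogue of \<open>polyfun_curve\<close> with four parameters and
  \<open>param_det\<close> as denominator.\<close>

lemma polyfun_param_act:
  assumes "p \<in> polyfun"
  shows "\<exists>e F. is_poly4 F \<and> (\<forall>x. param_det x \<noteq> 0 \<longrightarrow> param_det x ^ e * p (param_act R x) = F x)"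
  using assms
proof (induction p rule: polyfun.induct)
  case (pconst a)
  show ?case by (rule exI[of _ 0], rule exI[of _ "\<lambda>_. a"]) (simp add: is_poly4_const)
next
  case (pcoord i j k)
  have "param_det x ^ 2 * param_act R x i j k = act (param_matrix x) (adjm (param_matrix x)) R i j k"
    if "param_det x \<noteq> 0" for x
  proof -
    have gp: "grading_preserving (param_matrix x)"
      unfolding param_matrix_def by (rule grading_preserving_cols)
    have "is_inv (param_matrix x) (\<lambda>i j. adjm (param_matrix x) i j / detm (param_matrix x))"
      using is_inv_adjm[OF gp] that unfolding param_det_def by blast
    then show ?thesis
      unfolding param_act_def param_det_def by (rule act_adjm[OF gp])
  qed
  moreover have "is_poly4 (\<lambda>x. act (param_matrix x) (adjm (param_matrix x)) R i j k)"
    unfolding act_def by (intro is_poly4_intros is_poly4_param_matrix is_poly4_adjm_param_matrix)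
  ultimately show ?case by blast
next
  case (padd p q)
  then obtain n f m g where
    1: "is_poly4 f" "\<And>x. param_det x \<noteq> 0 \<Longrightarrow> param_det x ^ n * p (param_act R x) = f x"
    and 2: "is_poly4 g" "\<And>x. param_det x \<noteq> 0 \<Longrightarrow> param_det x ^ m * q (param_act R x) = g x" by metis
  have "param_det x ^ (n + m) * (p (param_act R x) + q (param_act R x)) =
      param_det x ^ m * f x + param_det x ^ n * g x" if "param_det x \<noteq> 0" for x
    using 1(2)[OF that, symmetric] 2(2)[OF that, symmetric] by (simp add: power_add algebra_simps)
  moreover have "is_poly4 (\<lambda>x. param_det x ^ m * f x + param_det x ^ n * g x)"
    using 1 2 is_poly4_param_det by (intro is_poly4_intros)
  ultimately show ?case by blast
next
  case (pmult p q)
  then obtain n f m g where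
    1: "is_poly4 f" "\<And>x. param_det x \<noteq> 0 \<Longrightarrow> param_det x ^ n * p (param_act R x) = f x"
    and 2: "is_poly4 g" "\<And>x. param_det x \<noteq> 0 \<Longrightarrow> param_det x ^ m * q (param_act R x) = g x" by metis
  have "param_det x ^ (n + m) * (p (param_act R x) * q (param_act R x)) = f x * g x"
    if "param_det x \<noteq> 0" for x
    using 1(2)[OF that, symmetric] 2(2)[OF that, symmetric] by (simp add: power_add algebra_simps)
  moreover have "is_poly4 (\<lambda>x. f x * g x)"
    using 1 2 by (intro is_poly4_intros)
  ultimately show ?case by blast
qed

text \<open>One denominator and one degree bound for all \<open>g i\<close>: the count in
  \<open>param_relation\<close> needs a single \<open>D\<close>, fixed before \<open>K\<close> is
  chosen.\<close>

lemma polyfun_param_act_uniform: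
  fixes n :: nat
  assumes "\<And>i. i < n \<Longrightarrow> g i \<in> polyfun"
  shows "\<exists>D Q P. Q \<in> poly4 D \<and> (\<forall>i<n. P i \<in> poly4 D) \<and> (\<forall>x. param_det x \<noteq> 0 \<longrightarrow> Q x \<noteq> 0) \<and>
    (\<forall>i<n. \<forall>x. param_det x \<noteq> 0 \<longrightarrow> Q x * g i (param_act R x) = P i x)"
proof -
  have "\<exists>e F. is_poly4 F \<and> (\<forall>x. param_det x \<noteq> 0 \<longrightarrow> param_det x ^ e * g i (param_act R x) = F x)"
    if "i < n" for i
    using polyfun_param_act[OF assms[OF that]] .
  then obtain e F where F: "\<And>i. i < n \<Longrightarrow> is_poly4 (F i)"
    "\<And>i x. i < n \<Longrightarrow> param_det x \<noteq> 0 \<Longrightarrow> param_det x ^ e i * g i (param_act R x) = F i x"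
    by metis
  define E where "E = (\<Sum>i<n. e i)"
  define Q where "Q x = param_det x ^ E" for x
  define P where "P i x = param_det x ^ (E - e i) * F i x" for i x
  have E: "e i \<le> E" if "i < n" for i
    unfolding E_def using that by (intro member_le_sum) auto
  have "is_poly4 (\<lambda>x. Q x)" unfolding Q_def using is_poly4_param_det by (intro is_poly4_intros)
  then obtain DQ where DQ: "Q \<in> poly4 DQ" unfolding is_poly4_def by auto
  have "\<exists>D. P i \<in> poly4 D" if "i < n" for i
  proof -
    have "is_poly4 (\<lambda>x. P i x)"
      unfolding P_def using F(1)[OF that] is_poly4_param_det by (intro is_poly4_intros)
    then show ?thesis unfolding is_poly4_def by simp
  qed
  then obtain d where d: "\<And>i. i < n \<Longrightarrow> P i \<in> poly4 (d i)" by metis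
  define D where "D = DQ + (\<Sum>i<n. d i)"
  have "d i \<le> D" if "i < n" for i
    unfolding D_def using member_le_sum[of i "{..<n}" d] that by auto
  then have 1: "P i \<in> poly4 D" if "i < n" for i using d that poly4_mono by blast
  have 2: "Q \<in> poly4 D" using poly4_mono[OF _ DQ] unfolding D_def by auto
  have "Q x * g i (param_act R x) = P i x" if "i < n" "param_det x \<noteq> 0" for i x
  proof -
    have "Q x = param_det x ^ (E - e i) * param_det x ^ e i"
      unfolding Q_def power_add[symmetric] using E[OF that(1)] by simp
    then show ?thesis unfolding P_def using F(2)[OF that] by (simp add: mult.assoc)
  qed
  moreover have "Q x \<noteq> 0" if "param_det x \<noteq> 0" for x unfolding Q_def using that by simp
  ultimately show ?thesis using 1 2 by blast
qed

text \<open>The \<open>K\<^sup>5\<close> monomials, pulled back to the parameters and multiplied by a common denominator, lie in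
  the span of only \<open>(5 K D + 1)\<^sup>4\<close> monomials in four variables.\<close>
lemma param_relation:
  assumes g: "\<And>i. i < 5 \<Longrightarrow> g i \<in> polyfun"
  shows "\<exists>K x. (\<exists>as\<in>exps K 5. x as \<noteq> 0) \<and>
    (\<forall>y. param_det y \<noteq> 0 \<longrightarrow> (\<Sum>as\<in>exps K 5. x as * chain_monom g as (param_act R y)) = 0)"
proof -
  obtain D Q P where QP0: "Q \<in> poly4 D" "\<forall>i<5. P i \<in> poly4 D" "\<forall>x. param_det x \<noteq> 0 \<longrightarrow> Q x \<noteq> 0"
    "\<forall>i<5. \<forall>x. param_det x \<noteq> 0 \<longrightarrow> Q x * g i (param_act R x) = P i x"
  proof -
    have "\<exists>D Q P. Q \<in> poly4 D \<and> (\<forall>i<5. P i \<in> poly4 D) \<and> (\<forall>x. param_det x \<noteq> 0 \<longrightarrow> Q x \<noteq> 0) \<and>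
      (\<forall>i<5. \<forall>x. param_det x \<noteq> 0 \<longrightarrow> Q x * g i (param_act R x) = P i x)"
      by (rule polyfun_param_act_uniform) (rule g)
    then show ?thesis by (elim exE conjE) (rule that)
  qed
  note Q = QP0(1) and P = QP0(2)[rule_format] and nz = QP0(3)[rule_format] and QP = QP0(4)[rule_format]
  \<comment> \<open>This choice gives
    \<open>(5 * K * D + 1) ^ 4 \<le> K ^ 4 * (5 * D + 1) ^ 4 < K ^ 5\<close>.\<close>
  define K where "K = Suc (Suc (5 * D) ^ 4)"
  \<comment> \<open>Each power \<open>g ^ a\<close> is multiplied by \<open>Q ^ K\<close> and
    becomes \<open>P ^ a * Q ^ (K - a)\<close>, so neither the denominator nor the degree bound
    depends on the exponents.\<close>
  have H: "\<exists>h\<in>poly4 (length as * (K * D)). \<forall>x. param_det x \<noteq> 0 \<longrightarrow>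
      h x = Q x ^ (length as * K) * chain_monom g as (param_act R x)"
    if "set as \<subseteq> {..<K}" "length as \<le> 5" for as
    using that
  proof (induction as)
    case Nil
    show ?case by (rule bexI[of _ "\<lambda>_. 1"]) (simp_all add: poly4_const)
  next
    case (Cons a as)
    then obtain h where h: "h \<in> poly4 (length as * (K * D))"
      "\<And>x. param_det x \<noteq> 0 \<Longrightarrow> h x = Q x ^ (length as * K) * chain_monom g as (param_act R x)"
      by auto
    have a: "a < K" and l: "length as < 5" using Cons.prems by auto
    have "(\<lambda>x. P (length as) x ^ a * Q x ^ (K - a) * h x) \<in> poly4 (a * D + (K - a) * D + length as * (K * D))"
      by (intro poly4_mult poly4_power P Q h l)
    moreover have "a * D + (K - a) * D + length as * (K * D) = length (a # as) * (K * D)"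
      using a by (simp add: add_mult_distrib[symmetric])
    moreover have "P (length as) x ^ a * Q x ^ (K - a) * h x =
        Q x ^ (length (a # as) * K) * chain_monom g (a # as) (param_act R x)" if "param_det x \<noteq> 0" for x
    proof -
      have "Q x ^ a * Q x ^ (K - a) = Q x ^ K" using a by (simp add: power_add[symmetric])
      then show ?thesis
        using h(2)[OF that] by (simp add: QP[OF l that, symmetric] power_mult_distrib power_add algebra_simps)
    qed
    ultimately show ?case by (metis (no_types, lifting))
  qed
  have "\<exists>h\<in>poly4 (5 * (K * D)). \<forall>x. param_det x \<noteq> 0 \<longrightarrow>
      h x = Q x ^ (5 * K) * chain_monom g as (param_act R x)" if "as \<in> exps K 5" for as
    using H[of as] that unfolding exps_def by auto
  then obtain h where h: "\<And>as. as \<in> exps K 5 \<Longrightarrow> h as \<in> poly4 (5 * (K * D))"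
    "\<And>as x. as \<in> exps K 5 \<Longrightarrow> param_det x \<noteq> 0 \<Longrightarrow>
      h as x = Q x ^ (5 * K) * chain_monom g as (param_act R x)" by metis
  have "\<exists>co. \<forall>x. h as x = (\<Sum>e\<in>box4 (5 * (K * D)). co e * monom4 e x)" if "as \<in> exps K 5" for as
    using poly4_expand[OF h(1)[OF that]] .
  then obtain co where co: "\<And>as x. as \<in> exps K 5 \<Longrightarrow>
      h as x = (\<Sum>e\<in>box4 (5 * (K * D)). co as e * monom4 e x)" by metis
  have "card (box4 (5 * (K * D))) < card (exps K 5)"
  proof -
    have "Suc (5 * (K * D)) \<le> K * Suc (5 * D)" unfolding K_def by simp
    then have "Suc (5 * (K * D)) ^ 4 \<le> (K * Suc (5 * D)) ^ 4" by (rule power_mono) simp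
    also have "\<dots> = K ^ 4 * Suc (5 * D) ^ 4" by (rule power_mult_distrib)
    also have "\<dots> < K ^ 4 * K" by (rule mult_strict_left_mono) (simp_all add: K_def)
    also have "\<dots> = K ^ 5" by (simp add: eval_nat_numeral)
    finally show ?thesis unfolding card_box4 card_exps .
  qed
  then obtain x where x: "\<exists>as\<in>exps K 5. x as \<noteq> 0"
    "\<And>e. e \<in> box4 (5 * (K * D)) \<Longrightarrow> (\<Sum>as\<in>exps K 5. x as * co as e) = 0"
    using underdetermined_system[OF finite_box4 finite_exps, of "5 * (K * D)" K 5 co] by blast
  have "(\<Sum>as\<in>exps K 5. x as * chain_monom g as (param_act R y)) = 0" if y: "param_det y \<noteq> 0" for y
  proof -
    have "Q y ^ (5 * K) * (\<Sum>as\<in>exps K 5. x as * chain_monom g as (param_act R y)) =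
        (\<Sum>as\<in>exps K 5. x as * h as y)"
      unfolding sum_distrib_left using h(2)[OF _ y] by (intro sum.cong refl) (simp add: algebra_simps)
    also have "\<dots> = (\<Sum>as\<in>exps K 5. \<Sum>e\<in>box4 (5 * (K * D)). x as * co as e * monom4 e y)"
      using co by (intro sum.cong refl) (simp add: sum_distrib_left algebra_simps)
    also have "\<dots> = (\<Sum>e\<in>box4 (5 * (K * D)). (\<Sum>as\<in>exps K 5. x as * co as e) * monom4 e y)"
      by (subst sum.swap) (simp add: sum_distrib_right)
    also have "\<dots> = 0" using x(2) by simp
    finally show ?thesis using nz[OF y] by simp
  qed
  then show ?thesis using x(1) by blast
qed

lemma chain_bound:
  assumes "has_chain (zclosure (param_act R ` {x. param_det x \<noteq> 0})) n"
  shows "n \<le> 4"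
proof (rule ccontr)
  assume "\<not> n \<le> 4"
  obtain Z where Z: "\<And>i. i \<le> n \<Longrightarrow> Z i \<subseteq> zclosure (param_act R ` {x. param_det x \<noteq> 0})"
    "\<And>i. i \<le> n \<Longrightarrow> zclosed (Z i)" "\<And>i. i \<le> n \<Longrightarrow> irreducible_set (Z i)"
    "\<And>i. i < n \<Longrightarrow> Z i \<subset> Z (Suc i)"
    using assms unfolding has_chain_def by blast
  have "\<exists>g. g \<in> polyfun \<and> (\<forall>c\<in>Z i. g c = 0) \<and> (\<exists>c\<in>Z (Suc i). g c \<noteq> 0)" if "i < 5" for i
  proof -
    have i: "i < n" using that \<open>\<not> n \<le> 4\<close> by simp
    obtain c where c: "c \<in> Z (Suc i)" "c \<notin> Z i" using Z(4)[OF i] by blast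
    then show ?thesis using zclosed_separate[OF Z(2)[of i] c(2)] i by (metis less_imp_le)
  qed
  then obtain g where g: "\<And>i. i < 5 \<Longrightarrow> g i \<in> polyfun" "\<And>i c. i < 5 \<Longrightarrow> c \<in> Z i \<Longrightarrow> g i c = 0"
    "\<And>i. i < 5 \<Longrightarrow> \<exists>c\<in>Z (Suc i). g i c \<noteq> 0" by metis
  obtain K x where x: "\<exists>as\<in>exps K 5. x as \<noteq> 0"
    "\<forall>y. param_det y \<noteq> 0 \<longrightarrow> (\<Sum>as\<in>exps K 5. x as * chain_monom g as (param_act R y)) = 0"
  proof -
    have "\<exists>K x. (\<exists>as\<in>exps K 5. x as \<noteq> 0) \<and>
      (\<forall>y. param_det y \<noteq> 0 \<longrightarrow> (\<Sum>as\<in>exps K 5. x as * chain_monom g as (param_act R y)) = 0)"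
      by (rule param_relation) (rule g(1))
    then show ?thesis by (elim exE conjE) (rule that)
  qed
  \<comment> \<open>The relation holds on the parametrised points, hence on their closure, which
    contains the whole chain; only \<open>Z 0\<close> to \<open>Z 5\<close> are used.\<close>
  have "(\<Sum>as\<in>exps K 5. x as * chain_monom g as c) = 0" if "c \<in> Z 5" for c
  proof (rule zclosureD[of c])
    show "c \<in> zclosure (param_act R ` {x. param_det x \<noteq> 0})"
      using Z(1)[of 5] that \<open>\<not> n \<le> 4\<close> by auto
    show "(\<lambda>c. \<Sum>as\<in>exps K 5. x as * chain_monom g as c) \<in> polyfun"
      using g(1) by (intro polyfun_intros polyfun_chain_monom) (auto simp: exps_def)
  qed (use x(2) in auto)
  moreover have "Z i \<subseteq> Z (Suc i)" if "i < 5" for i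
    using Z(4)[of i] that \<open>\<not> n \<le> 4\<close> by auto
  ultimately have "\<forall>as\<in>exps K 5. x as = 0"
    using Z(3) g \<open>\<not> n \<le> 4\<close> by (intro chain_monom_independent[where Z = Z and g = g]) auto
  then show False using x(1) by auto
qed

lemma grading_preserving_eq_cols:
  "grading_preserving M \<Longrightarrow> M = cols (M E1 E1) (M E2 E1) (M E1 E2) (M E2 E2) (M F1 F1)"
  unfolding grading_preserving_iff by (intro ext, rename_tac i j, case_tac i; case_tac j) simp_all

text \<open>Scaling the odd part is compensated by the stabiliser, so four of the five parameters of the group
  suffice to sweep out the orbit.\<close>
lemma Rs_stabiliser:
  assumes "R \<in> Rs" "\<mu> \<noteq> 0"
  obtains \<nu> where "\<nu> \<noteq> 0" "act (cols 1 0 0 \<nu> \<mu>) (cols 1 0 0 (1 / \<nu>) (1 / \<mu>)) R = R"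
proof -
  \<comment> \<open>Only \<open>R10\<close> has a nonzero odd product: there
    \<open>f f = e2\<close>, so scaling \<open>f\<close> by \<open>\<mu>\<close> must scale
    \<open>e2\<close> by its square.\<close>
  have "act (cols 1 0 0 \<nu> \<mu>) (cols 1 0 0 (1 / \<nu>) (1 / \<mu>)) R = R"
    if "\<nu> = (if R F1 F1 E2 = 0 then 1 else \<mu>\<^sup>2)" for \<nu>
  proof -
    have "\<nu> \<noteq> 0" using that assms(2) by auto
    then show ?thesis
      using assms that unfolding Rs_def sc_eq_iff all_idx
      by (elim insertE) (simp_all add: R_mk act_def UNIV_idx power2_eq_square)
  qed
  then show ?thesis using that assms(2) by (metis power_not_zero zero_neq_one)
qed

lemma is_inv_diag: "\<nu> \<noteq> 0 \<Longrightarrow> \<mu> \<noteq> 0 \<Longrightarrow> is_inv (cols 1 0 0 \<nu> \<mu>) (cols 1 0 0 (1 / \<nu>) (1 / \<mu>))"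
  unfolding is_inv_def all_idx by (simp add: UNIV_idx)

lemma orbit_param:
  assumes "R \<in> Rs"
  shows "orbit R \<subseteq> param_act R ` {x. param_det x \<noteq> 0}"
proof
  fix c assume "c \<in> orbit R"
  then obtain M N where MN: "grading_preserving M" "is_inv M N" "c = act M N R" by (elim orbitE)
  have l: "M F1 F1 \<noteq> 0" using detm_nonzero[OF MN(1,2)] by (auto simp: detm_def)
  \<comment> \<open>The odd factor \<open>1 / M F1 F1\<close> normalises the odd entry of the
    product \<open>L\<close> to 1, as in \<open>param_matrix\<close>.\<close>
  obtain \<nu> where \<nu>: "\<nu> \<noteq> 0"
    "act (cols 1 0 0 \<nu> (1 / M F1 F1)) (cols 1 0 0 (1 / \<nu>) (1 / (1 / M F1 F1))) R = R"
    using Rs_stabiliser[OF assms, of "1 / M F1 F1"] l by auto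
  let ?S = "cols 1 0 0 \<nu> (1 / M F1 F1)" and ?S' = "cols 1 0 0 (1 / \<nu>) (1 / (1 / M F1 F1))"
  define L where "L = mprod M ?S"
  have L: "grading_preserving L" unfolding L_def by (intro grading_preserving_mprod MN grading_preserving_cols)
  have inv: "is_inv L (mprod ?S' N)" unfolding L_def using MN(2) \<nu>(1) l
    by (intro is_inv_mprod is_inv_diag) auto
  have c: "c = act L (mprod ?S' N) R" unfolding MN(3) L_def act_mprod[symmetric] \<nu>(2) ..
  have "L F1 F1 = 1" unfolding L_def mprod_def using l by (simp add: UNIV_idx)
  then have "L = param_matrix (L E1 E1, L E2 E1, L E1 E2, L E2 E2)"
    using grading_preserving_eq_cols[OF L] unfolding param_matrix_def by simp
  then obtain x where x: "L = param_matrix x" by blast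
  have det: "detm L \<noteq> 0" using detm_nonzero[OF L inv] .
  have "c = param_act R x"
    unfolding c param_act_def param_det_def x[symmetric]
    using is_inv_unique[OF inv is_inv_adjm[OF L det]] by simp
  then show "c \<in> param_act R ` {x. param_det x \<noteq> 0}" using det unfolding x param_det_def by blast
qed

text \<open>The top member of a chain is irreducible, so the entire chain lies in one of the seven
  orbit closures.\<close>

lemma has_chain_PermVar_le:
  assumes "has_chain PermVar n"
  shows "n \<le> 4"
proof -
  obtain Z where Z: "\<And>i. i \<le> n \<Longrightarrow> Z i \<subseteq> PermVar \<and> zclosed (Z i) \<and> irreducible_set (Z i)"
    "\<And>i. i < n \<Longrightarrow> Z i \<subset> Z (Suc i)"
    using assms unfolding has_chain_def by blast
  obtain R where R: "R \<in> Rs" "Z n \<subseteq> zclosure (orbit R)"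
    using irreducible_subset_PermVar[of "Z n"] Z(1)[of n] by blast
  have "Z i \<subseteq> Z n" if "i \<le> n" for i
    using that by (induction rule: inc_induct) (use Z(2) in auto)
  moreover have "Z n \<subseteq> zclosure (param_act R ` {x. param_det x \<noteq> 0})"
    using R zclosure_least[OF zclosed_zclosure subset_trans[OF orbit_param[OF R(1)] subset_zclosure]] by blast
  ultimately have "has_chain (zclosure (param_act R ` {x. param_det x \<noteq> 0})) n"
    unfolding has_chain_def using Z by (intro exI[of _ Z]) blast
  then show ?thesis by (rule chain_bound)
qed

subsection \<open>Lower bound\<close>

text \<open>The algebra \<open>E1 E1 = \<alpha> E1\<close>, \<open>E2 E2 = \<beta> E2\<close> in the basis \<open>E1 = e1 + s E2\<close>, \<open>E2 = e2 + t e1\<close>.\<close>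
definition unipotent :: "complex \<Rightarrow> complex \<Rightarrow> idx \<Rightarrow> idx \<Rightarrow> complex" where
  "unipotent s t = cols (1 + s * t) s t 1 1"

definition two_idem :: "complex \<Rightarrow> complex \<Rightarrow> complex \<Rightarrow> complex \<Rightarrow> sc" where
  "two_idem \<alpha> \<beta> s t =
    act (unipotent s t) (adjm (unipotent s t)) (mk \<alpha> 0 0 0 0 0 0 \<beta> 0 0 0 0 0 0)"

lemma two_idem_PermVar: "two_idem \<alpha> \<beta> s t \<in> PermVar"
proof -
  have gp: "grading_preserving (unipotent s t)" unfolding unipotent_def by (rule grading_preserving_cols)
  have "detm (unipotent s t) = 1" by (simp add: unipotent_def detm_def)
  then have "is_inv (unipotent s t) (adjm (unipotent s t))" using is_inv_adjm[OF gp] by simp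
  moreover have "mk \<alpha> 0 0 0 0 0 0 \<beta> 0 0 0 0 0 0 \<in> PermVar"
    unfolding PermVar_def perm_sc_iff mem_Collect_eq all_idx
    by (simp add: even_sc_mk' UNIV_idx)
  ultimately show ?thesis unfolding two_idem_def by (intro PermVar_act gp)
qed

lemma poly_fun_two_idem:
  assumes "poly_fun \<alpha>" "poly_fun \<beta>" "poly_fun s" "poly_fun t"
  shows "poly_fun (\<lambda>\<tau>. two_idem (\<alpha> \<tau>) (\<beta> \<tau>) (s \<tau>) (t \<tau>) i j k)"
proof -
  have 1: "poly_fun (\<lambda>\<tau>. unipotent (s \<tau>) (t \<tau>) i j)" for i j
    unfolding unipotent_def using assms by (cases i; cases j; simp; intro poly_fun_intros)
  have 2: "poly_fun (\<lambda>\<tau>. adjm (unipotent (s \<tau>) (t \<tau>)) i j)" for i j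
    unfolding adjm_def by (cases i; cases j; simp; intro poly_fun_intros 1)
  show ?thesis
    unfolding two_idem_def act_def using assms
    by (intro poly_fun_intros 1 2 poly_fun_mk)
qed

text \<open>The first \<open>m\<close> parameters are free and the others zero: \<open>m = 0\<close>
  leaves only the zero algebra, and from \<open>m = 4\<close> on the family no longer grows.\<close>

definition two_idem_family :: "nat \<Rightarrow> sc set" where
  "two_idem_family m = {two_idem \<alpha> \<beta> s t | \<alpha> \<beta> s t.
    (m < 1 \<longrightarrow> \<alpha> = 0) \<and> (m < 2 \<longrightarrow> \<beta> = 0) \<and> (m < 3 \<longrightarrow> s = 0) \<and> (m < 4 \<longrightarrow> t = 0)}"

lemma two_idem_familyI:
  assumes "m < 1 \<Longrightarrow> \<alpha> = 0" "m < 2 \<Longrightarrow> \<beta> = 0" "m < 3 \<Longrightarrow> s = 0" "m < 4 \<Longrightarrow> t = 0"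
  shows "two_idem \<alpha> \<beta> s t \<in> two_idem_family m"
  using assms unfolding two_idem_family_def by blast

lemma irreducible_two_idem_family: "irreducible_set (two_idem_family m)"
proof (rule irreducible_set_if_rational_curves)
  show "two_idem_family m \<noteq> {}" unfolding two_idem_family_def by force
next
  fix u v assume uv: "u \<in> two_idem_family m" "v \<in> two_idem_family m"
  obtain \<alpha> \<beta> s t where
    u: "u = two_idem \<alpha> \<beta> s t" "m < 1 \<longrightarrow> \<alpha> = 0" "m < 2 \<longrightarrow> \<beta> = 0" "m < 3 \<longrightarrow> s = 0" "m < 4 \<longrightarrow> t = 0"
    using uv(1) unfolding two_idem_family_def by blast
  obtain \<alpha>' \<beta>' s' t' where
    v: "v = two_idem \<alpha>' \<beta>' s' t'" "m < 1 \<longrightarrow> \<alpha>' = 0" "m < 2 \<longrightarrow> \<beta>' = 0" "m < 3 \<longrightarrow> s' = 0" "m < 4 \<longrightarrow> t' = 0"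
    using uv(2) unfolding two_idem_family_def by blast
  define \<gamma> where "\<gamma> \<tau> = two_idem ((1 - \<tau>) * \<alpha> + \<tau> * \<alpha>') ((1 - \<tau>) * \<beta> + \<tau> * \<beta>')
    ((1 - \<tau>) * s + \<tau> * s') ((1 - \<tau>) * t + \<tau> * t')" for \<tau>
  have "poly_fun (\<lambda>\<tau>. \<gamma> \<tau> i j k)" for i j k
    unfolding \<gamma>_def by (intro poly_fun_two_idem poly_fun_intros)
  moreover have "\<gamma> \<tau> \<in> two_idem_family m" for \<tau>
    unfolding \<gamma>_def by (rule two_idem_familyI) (use u(2-5) v(2-5) in auto)
  moreover have "\<gamma> 0 = u" "\<gamma> 1 = v" unfolding \<gamma>_def u(1) v(1) by simp_all
  ultimately show "\<exists>s \<gamma> \<gamma>' t0 t1. poly_fun s \<and> (\<forall>i j k. poly_fun (\<gamma>' i j k)) \<and>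
      (\<forall>t i j k. s t \<noteq> 0 \<longrightarrow> \<gamma> t \<in> two_idem_family m \<and> s t * \<gamma> t i j k = \<gamma>' i j k t) \<and>
      s t0 \<noteq> 0 \<and> s t1 \<noteq> 0 \<and> \<gamma> t0 = u \<and> \<gamma> t1 = v"
    by (intro exI[of _ "\<lambda>_. 1"] exI[of _ \<gamma>] exI[of _ "\<lambda>i j k t. \<gamma> t i j k"] exI[of _ 0] exI[of _ 1]) simp
qed

lemma zclosure_psubsetI:
  assumes "A \<subseteq> B" "p \<in> polyfun" "\<And>a. a \<in> A \<Longrightarrow> p a = 0" "b \<in> B" "p b \<noteq> 0"
  shows "zclosure A \<subset> zclosure B"
proof -
  have "zclosure A \<subseteq> zclosure B"
    using assms(1) subset_zclosure zclosure_least zclosed_zclosure by (meson subset_trans)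
  moreover have "b \<notin> zclosure A" using zclosureD[OF _ assms(2,3)] assms(5) by blast
  ultimately show ?thesis using assms(4) subset_zclosure by blast
qed

text \<open>Test coordinates for strict inclusions. Beyond the two scalars: \<open>s = t = 0\<close>
  keeps \<open>e1 e1\<close> on the line of \<open>e1\<close>, and \<open>t = 0\<close> keeps
  \<open>e2 e2\<close> on that of \<open>e2\<close>, until the next parameter is freed.\<close>

lemma two_idem_entries:
  "two_idem 0 0 0 0 E1 E1 E1 = 0" "two_idem 1 0 0 0 E1 E1 E1 = 1"
  "two_idem \<alpha> 0 0 0 E2 E2 E2 = 0" "two_idem 1 1 0 0 E2 E2 E2 = 1"
  "two_idem \<alpha> \<beta> 0 0 E1 E1 E2 = 0" "two_idem 1 1 1 0 E1 E1 E2 = 2"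
  "two_idem \<alpha> \<beta> s 0 E2 E2 E1 = 0" "two_idem 1 1 0 1 E2 E2 E1 = 2"
  by (simp_all add: two_idem_def unipotent_def adjm_def act_def UNIV_idx)

lemma two_idem_family_psubset:
  assumes "m < 4"
  shows "zclosure (two_idem_family m) \<subset> zclosure (two_idem_family (Suc m))"
proof -
  have sub: "two_idem_family m \<subseteq> two_idem_family (Suc m)"
    unfolding two_idem_family_def by fastforce
  consider "m = 0" | "m = 1" | "m = 2" | "m = 3" using assms by linarith
  then show ?thesis
  proof cases
    case 1
    have "two_idem 1 0 0 0 \<in> two_idem_family (Suc m)" unfolding 1 by (rule two_idem_familyI) auto
    then show ?thesis
      by (rule zclosure_psubsetI[OF sub pcoord[of E1 E1 E1], rotated]) (auto simp: two_idem_family_def 1 two_idem_entries)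
  next
    case 2
    have "two_idem 1 1 0 0 \<in> two_idem_family (Suc m)" unfolding 2 by (rule two_idem_familyI) auto
    then show ?thesis
      by (rule zclosure_psubsetI[OF sub pcoord[of E2 E2 E2], rotated]) (auto simp: two_idem_family_def 2 two_idem_entries)
  next
    case 3
    have "two_idem 1 1 1 0 \<in> two_idem_family (Suc m)" unfolding 3 by (rule two_idem_familyI) auto
    then show ?thesis
      by (rule zclosure_psubsetI[OF sub pcoord[of E1 E1 E2], rotated]) (auto simp: two_idem_family_def 3 two_idem_entries)
  next
    case 4
    have "two_idem 1 1 0 1 \<in> two_idem_family (Suc m)" unfolding 4 by (rule two_idem_familyI) auto
    then show ?thesis
      by (rule zclosure_psubsetI[OF sub pcoord[of E2 E2 E1], rotated]) (auto simp: two_idem_family_def 4 two_idem_entries)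
  qed
qed

lemma has_chain_PermVar: "has_chain PermVar 4"
  unfolding has_chain_def
proof (intro exI conjI allI impI)
  fix i :: nat
  have "two_idem_family i \<subseteq> PermVar" unfolding two_idem_family_def using two_idem_PermVar by blast
  then show "zclosure (two_idem_family i) \<subseteq> PermVar" by (rule zclosure_least[OF zclosed_PermVar])
  show "zclosed (zclosure (two_idem_family i))" by (rule zclosed_zclosure)
  show "irreducible_set (zclosure (two_idem_family i))"
    by (rule irreducible_set_zclosure[OF irreducible_two_idem_family])
qed (rule two_idem_family_psubset)

lemma variety_dim_PermVar: "variety_dim PermVar = 4"
  unfolding variety_dim_def
proof (rule antisym)
  show "Sup (enat ` {n. has_chain PermVar n}) \<le> 4"
    by (rule Sup_least) (auto dest!: has_chain_PermVar_le simp: numeral_eq_enat)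
  show "4 \<le> Sup (enat ` {n. has_chain PermVar n})"
    by (rule Sup_upper) (use has_chain_PermVar in \<open>auto simp: numeral_eq_enat\<close>)
qed

theorem mainTheorem6:
  shows "{Z. irr_component PermVar Z} =
           {zclosure (orbit R01), zclosure (orbit R02), zclosure (orbit R04),
            zclosure (orbit R10), zclosure (orbit R25), zclosure (orbit R31),
            zclosure (orbit R33)}
       \<and> card {Z. irr_component PermVar Z} = 7
       \<and> variety_dim PermVar = 4
       \<and> {c. rigid PermVar c} =
           orbit R01 \<union> orbit R02 \<union> orbit R04 \<union> orbit R10 \<union> orbit R25 \<union> orbit R31 \<union> orbit R33"
proof (intro conjI)
  show "{Z. irr_component PermVar Z} =
           {zclosure (orbit R01), zclosure (orbit R02), zclosure (orbit R04),
            zclosure (orbit R10), zclosure (orbit R25), zclosure (orbit R31),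
            zclosure (orbit R33)}"
    unfolding irr_components_PermVar Rs_def by simp
  have "inj_on (\<lambda>R. zclosure (orbit R)) Rs"
    using Rs_zclosure_subset by (intro inj_onI) blast
  then show "card {Z. irr_component PermVar Z} = 7"
    unfolding irr_components_PermVar using card_image card_Rs by metis
  show "variety_dim PermVar = 4" by (rule variety_dim_PermVar)
  show "{c. rigid PermVar c} =
           orbit R01 \<union> orbit R02 \<union> orbit R04 \<union> orbit R10 \<union> orbit R25 \<union> orbit R31 \<union> orbit R33"
    unfolding rigid_PermVar_iff Rs_def by auto
qed

end
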